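(* Let $M\subset K^n$ be a $K$-analytic manifold of type $k$, with induced measure $\mu_M$, and suppose that the characteristic of $K$ is either $0$ or $>k$. Then there exists a real number $p_0>1$, depending on $M$, such that for all $p$ with $1\leq p\leq p_0$ the manifold $M$ has the $L^p$ restriction property with $q=2$; that is, for every $p$ with $1\le p\le p_0$ and every compact open subset $M_0$ of $M$ there is a constant $A_{p,2}(M_0)$ such that $$\Big(\int_{M_0}|\widehat f(\xi)|^2\,d\mu_M(\xi)\Big)^{1/2}\leq A_{p,2}(M_0)\cdot\|f\|_{L^p(K^n)}$$ for each Schwartz-Bruhat function $f$ on $K^n$ with Fourier transform $\widehat f$.
   Context: $K$ is a non-archimedean local field with valuation ring $\mathcal{O}_K$, maximal ideal $\mathcal{M}_K$, and residue field with $q_K$ elements. The norm on $K$ is normalized so that a uniformizer has norm $q_K^{-1}$, and $|x|=\max_i|x_i|$ for $x\in K^n$. $\psi:K\to\mathbf{C}^\times$ is an additive character of $K$ which is trivial on $\mathcal{M}_K$ and nontrivial on $\mathcal{O}_K$. $|dx|$ is the Haar measure on $K^n$ with $\mathcal{O}_K^n$ of measure $1$. Schwartz-Bruhat functions on $K^n$ are the locally constant, compactly supported functions $K^n\to\mathbf{C}$. The Fourier transform is $\widehat f(\xi)=\int_{K^n}\psi(x\cdot\xi)f(x)|dx|$, where $x\cdot\xi=\sum_ix_i\xi_i$. $K$-analytic functions: for $X\subset K^d$ open, $f:X\to K^m$ is $K$-analytic if there is an open cover of $X$ such that on each open $U$ of the cover $f$ is given by $m$ power series converging on $U$. $K$-analytic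 manifolds: a subset $M\subset K^n$ is a $K$-analytic manifold of dimension $d$ if there is an open cover of $M$ such that for each open $U$ in the cover there is a coordinate projection $p_U:K^n\to K^d$ onto $d$ of the $n$ standard coordinates inducing a bijection $U\to U'$ onto an open $U'\subset K^d$, and there are $K$-analytic functions $f_1,\dots,f_n:U'\to K$ such that $f=(f_1,\dots,f_n)$ is the inverse of $p_U$ on $U$. The cover and the projections can be chosen such that the $p_U$ are isometries on $U$; the induced measure $\mu_M$ on $M$ is the pull-back via these isometries of the Haar measure on $K^d$ normalized so that $\mathcal{O}_K^d$ has measure $1$. A $K$-analytic manifold is a $K$-analytic manifold of some dimension $d$. Type: let $M\subset K^n$ be a $K$-analytic manifold of dimension $d$, $x_0\in M$, and let $f=(f_1,\dots,f_n):U'\to U\subset M$ be analytic coordinates on $M$ with $x_0\in U$, that is, $U$ is an open subset of $M$ containing $x_0$, $p_U:K^n\to K^d$ is a coordinate projection onto $d$ of the $n$ standard coordinates inducing a bijection from $U$ onto an open $U'\subset K^d$, and $f_1,\dots,f_n:U'\to K$ are $K$-analytic functions such that $f$ is the inverse of $p_U$ on $U$. $M$ is of finite type at $x_0$ if there exists $k>0$ such that for each nonzero $v\in K^n$ there exists $\alpha\in\mathbf{N}^d$ with $k\geq|\alpha|:=\sum_{i=1}^d\alpha_i>0$ and $$v\cdot(\partial^\alpha f/\partial x^\alpha)\neq0$$ at the point of $U'$ corresponding to $x_0$; the least such $k$ is the type of $M$ at $x_0$. If there is $k$ such that $M$ is of type $\leq k$ at each of its points, the least such integer $k$ is called the type of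 $M$. *)

theory Defs
  imports "HOL-Analysis.Analysis"
begin

text \<open>
  The library reserves \<open>norm\<close> for real normed spaces, hence a new parameter for the norm on
  \<open>K\<close>.
\<close>

class absval = minus +
  fixes absval :: "'a \<Rightarrow> real"
begin

definition valuation_ring :: "'a set" where
  "valuation_ring = {x. absval x \<le> 1}"

definition maximal_ideal :: "'a set" where
  "maximal_ideal = {x. absval x < 1}"

definition residue_field :: "'a set set" where
  "residue_field = valuation_ring //
     {(x, y). x \<in> valuation_ring \<and> y \<in> valuation_ring \<and> x - y \<in> maximal_ideal}"

end

text \<open>
  A field that is complete for a discrete valuation and has a finite residue field.  The last
  axiom contains both the discreteness (the maximal ideal is generated by some
  \<open>\<pi>\<close>) and the normalisation of the norm; the norm is nontrivial because the residue field
  contains the distinct classes of 0 and 1.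
\<close>

class nonarch_local_field = field + complete_space + absval +
  assumes dist_absval: "dist x y = absval (x - y)"
    and absval_mult: "absval (x * y) = absval x * absval y"
    and absval_add_le_max: "absval (x + y) \<le> max (absval x) (absval y)"
    and finite_residue_field: "finite residue_field"
    and normalized_uniformizer:
      "\<exists>\<pi>. absval \<pi> = 1 / real (card residue_field) \<and>
         (\<forall>z. z \<in> maximal_ideal \<longleftrightarrow> absval z \<le> absval \<pi>)"

text \<open>
  Continuity and unitarity are not required: both hold as soon as \<open>\<psi>\<close> is trivial on the maximal
  ideal, because that ideal is open and \<open>K\<close> modulo it is a torsion group.
\<close>

definition additive_character :: "('a::ab_group_add \<Rightarrow> complex) \<Rightarrow> bool" where
  "additive_character \<psi> \<longleftrightarrow>
     (\<forall>x. \<psi> x \<noteq> 0) \<and> (\<forall>x y. \<psi> (x + y) = \<psi> x * \<psi> y)"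

text \<open>
  For a finite set \<open>I\<close> of indices, \<open>K\<^sup>I\<close> is the set of functions
  \<open>I \<rightarrow> K\<close> (extended by \<open>undefined\<close>), with the product topology, which is the topology
  of the maximum norm.  The space \<open>K\<^sup>n\<close> is the case \<open>I = {..<n}\<close>.  The choice of
  \<open>d\<close> of the \<open>n\<close> standard coordinates is a set \<open>J \<subseteq> {..<n}\<close> with \<open>d\<close>
  elements; the copy of \<open>K\<^sup>d\<close> onto which one projects is \<open>K\<^sup>J\<close>, and the
  projection is \<open>\<lambda>x. restrict x J\<close>.
\<close>

abbreviation Kspace :: "'i set \<Rightarrow> ('i \<Rightarrow> 'a) set" where
  "Kspace I \<equiv> I \<rightarrow>\<^sub>E UNIV"

abbreviation Ktop :: "'i set \<Rightarrow> ('i \<Rightarrow> 'a::topological_space) topology" where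
  "Ktop I \<equiv> product_topology (\<lambda>_. euclidean) I"

text \<open>Inserting 0 only matters for the empty set of indices.\<close>

definition max_norm :: "'i set \<Rightarrow> ('i \<Rightarrow> 'a::absval) \<Rightarrow> real" where
  "max_norm I x = Max (insert 0 ((\<lambda>i. absval (x i)) ` I))"

definition borel_sets :: "'b topology \<Rightarrow> 'b set set" where
  "borel_sets X = sigma_sets (topspace X) {U. openin X U}"

text \<open>
  Such a measure exists and is unique; finiteness on compact sets follows from the last condition,
  and regularity is then automatic because \<open>K\<^sup>I\<close> is locally compact and second countable.
\<close>

definition normalized_haar ::
    "'i set \<Rightarrow> ('i \<Rightarrow> 'a::nonarch_local_field) measure \<Rightarrow> bool" where
  "normalized_haar I \<mu> \<longleftrightarrow>
     space \<mu> = Kspace I \<and>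
     sets \<mu> = borel_sets (Ktop I) \<and>
     (\<forall>a\<in>Kspace I. \<forall>A\<in>sets \<mu>. emeasure \<mu> ((\<lambda>x. \<lambda>i\<in>I. a i + x i) ` A) = emeasure \<mu> A) \<and>
     emeasure \<mu> (I \<rightarrow>\<^sub>E valuation_ring) = 1"

definition K_analytic_on ::
    "'i set \<Rightarrow> ('i \<Rightarrow> 'a::nonarch_local_field) set \<Rightarrow> (('i \<Rightarrow> 'a) \<Rightarrow> 'a) \<Rightarrow> bool" where
  "K_analytic_on J X g \<longleftrightarrow>
     (\<exists>\<U>. X = \<Union>\<U> \<and>
       (\<forall>U\<in>\<U>. openin (Ktop J) U \<and>
         (\<exists>a\<in>U. \<exists>c :: ('i \<Rightarrow> nat) \<Rightarrow> 'a. \<forall>x\<in>U.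
            ((\<lambda>\<alpha>. c \<alpha> * (\<Prod>i\<in>J. (x i - a i) ^ \<alpha> i)) has_sum g x) (J \<rightarrow>\<^sub>E UNIV))))"

text \<open>
  Analytic coordinates \<open>f\<close> on the open subset \<open>U\<close> of \<open>M\<close>, inverse to the
  projection to the coordinates in \<open>J\<close>.
\<close>

definition analytic_chart ::
    "nat \<Rightarrow> nat \<Rightarrow> (nat \<Rightarrow> 'a::nonarch_local_field) set \<Rightarrow>
     (nat \<Rightarrow> 'a) set \<Rightarrow> nat set \<Rightarrow> ((nat \<Rightarrow> 'a) \<Rightarrow> (nat \<Rightarrow> 'a)) \<Rightarrow> bool" where
  "analytic_chart n d M U J f \<longleftrightarrow>
     J \<subseteq> {..<n} \<and> card J = d \<and>
     openin (subtopology (Ktop {..<n}) M) U \<and>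
     openin (Ktop J) ((\<lambda>x. restrict x J) ` U) \<and>
     (\<forall>i<n. K_analytic_on J ((\<lambda>x. restrict x J) ` U) (\<lambda>y. f y i)) \<and>
     (\<forall>x\<in>U. f (restrict x J) = x)"

definition K_analytic_manifold ::
    "nat \<Rightarrow> nat \<Rightarrow> (nat \<Rightarrow> 'a::nonarch_local_field) set \<Rightarrow> bool" where
  "K_analytic_manifold n d M \<longleftrightarrow>
     M \<subseteq> Kspace {..<n} \<and>
     (\<exists>\<U>. M = \<Union>\<U> \<and> (\<forall>U\<in>\<U>. \<exists>J f. analytic_chart n d M U J f))"

text \<open>
  The argument \<open>haar\<close> is the family of normalised Haar measures on the spaces
  \<open>K\<^sup>J\<close>.  The measure does not depend on the cover by isometric charts.
\<close>

definition induced_measure ::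
    "(nat set \<Rightarrow> (nat \<Rightarrow> 'a::nonarch_local_field) measure) \<Rightarrow> nat \<Rightarrow> nat \<Rightarrow>
     (nat \<Rightarrow> 'a) set \<Rightarrow> (nat \<Rightarrow> 'a) measure \<Rightarrow> bool" where
  "induced_measure haar n d M \<mu> \<longleftrightarrow>
     space \<mu> = M \<and>
     sets \<mu> = borel_sets (subtopology (Ktop {..<n}) M) \<and>
     (\<exists>\<U>. M = \<Union>\<U> \<and>
       (\<forall>U\<in>\<U>. \<exists>J f. analytic_chart n d M U J f \<and>
          (\<forall>x\<in>U. \<forall>y\<in>U.
             max_norm J (\<lambda>i. x i - y i) = max_norm {..<n} (\<lambda>i. x i - y i)) \<and>
          (\<forall>A\<in>sets \<mu>. A \<subseteq> U \<longrightarrow>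
             emeasure \<mu> A = emeasure (haar J) ((\<lambda>x. restrict x J) ` A))))"

definition partial_deriv ::
    "'i \<Rightarrow> (('i \<Rightarrow> 'a::nonarch_local_field) \<Rightarrow> 'a) \<Rightarrow> ('i \<Rightarrow> 'a) \<Rightarrow> 'a" where
  "partial_deriv j g y = Lim (at 0) (\<lambda>h. (g (y(j := y j + h)) - g y) / h)"

text \<open>
  \<open>\<partial>\<^sup>\<alpha>\<close> for \<open>\<alpha> \<in> \<nat>\<^sup>J\<close>.  The partial derivatives are taken in the order of the
  indices, which is immaterial for analytic functions.
\<close>

definition multi_deriv ::
    "nat set \<Rightarrow> (nat \<Rightarrow> nat) \<Rightarrow> ((nat \<Rightarrow> 'a::nonarch_local_field) \<Rightarrow> 'a) \<Rightarrow>
     (nat \<Rightarrow> 'a) \<Rightarrow> 'a" where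
  "multi_deriv J \<alpha> g = fold (\<lambda>j. partial_deriv j ^^ \<alpha> j) (sorted_list_of_set J) g"

text \<open>
  The condition does not depend on the chart around \<open>x\<^sub>0\<close>: by the chain rule, a derivative of
  order \<open>\<alpha>\<close> in one chart is a combination of derivatives of orders
  \<open>0 < \<bar>\<beta>\<bar> \<le> \<bar>\<alpha>\<bar>\<close> in the other.
\<close>

definition type_at_le ::
    "nat \<Rightarrow> nat \<Rightarrow> (nat \<Rightarrow> 'a::nonarch_local_field) set \<Rightarrow> (nat \<Rightarrow> 'a) \<Rightarrow> nat \<Rightarrow> bool" where
  "type_at_le n d M x\<^sub>0 k \<longleftrightarrow>
     0 < k \<and>
     (\<forall>U J f. analytic_chart n d M U J f \<and> x\<^sub>0 \<in> U \<longrightarrow>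
       (\<forall>v\<in>Kspace {..<n}. (\<exists>i<n. v i \<noteq> 0) \<longrightarrow>
         (\<exists>\<alpha>\<in>Kspace J. 0 < (\<Sum>j\<in>J. \<alpha> j) \<and> (\<Sum>j\<in>J. \<alpha> j) \<le> k \<and>
            (\<Sum>i<n. v i * multi_deriv J \<alpha> (\<lambda>y. f y i) (restrict x\<^sub>0 J)) \<noteq> 0)))"

definition has_type ::
    "nat \<Rightarrow> nat \<Rightarrow> (nat \<Rightarrow> 'a::nonarch_local_field) set \<Rightarrow> nat \<Rightarrow> bool" where
  "has_type n d M k \<longleftrightarrow>
     (\<forall>x\<in>M. type_at_le n d M x k) \<and> (\<forall>l<k. \<not> (\<forall>x\<in>M. type_at_le n d M x l))"

definition schwartz_bruhat ::
    "nat \<Rightarrow> ((nat \<Rightarrow> 'a::nonarch_local_field) \<Rightarrow> complex) \<Rightarrow> bool" where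
  "schwartz_bruhat n f \<longleftrightarrow>
     (\<forall>x\<in>Kspace {..<n}. \<exists>U. openin (Ktop {..<n}) U \<and> x \<in> U \<and> (\<forall>y\<in>U. f y = f x)) \<and>
     (\<exists>C. compactin (Ktop {..<n}) C \<and> (\<forall>x\<in>Kspace {..<n} - C. f x = 0))"

definition fourier ::
    "(nat set \<Rightarrow> (nat \<Rightarrow> 'a::nonarch_local_field) measure) \<Rightarrow> ('a \<Rightarrow> complex) \<Rightarrow> nat \<Rightarrow>
     ((nat \<Rightarrow> 'a) \<Rightarrow> complex) \<Rightarrow> (nat \<Rightarrow> 'a) \<Rightarrow> complex" where
  "fourier haar \<psi> n f \<xi> = (LINT x|haar {..<n}. \<psi> (\<Sum>i<n. x i * \<xi> i) * f x)"

definition Lp_norm :: "'b measure \<Rightarrow> real \<Rightarrow> ('b \<Rightarrow> complex) \<Rightarrow> real" where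
  "Lp_norm \<mu> p f = (LINT x|\<mu>. norm (f x) powr p) powr (1 / p)"

definition Lp_restriction_property ::
    "(nat set \<Rightarrow> (nat \<Rightarrow> 'a::nonarch_local_field) measure) \<Rightarrow> ('a \<Rightarrow> complex) \<Rightarrow> nat \<Rightarrow>
     (nat \<Rightarrow> 'a) set \<Rightarrow> (nat \<Rightarrow> 'a) measure \<Rightarrow> real \<Rightarrow> real \<Rightarrow> bool" where
  "Lp_restriction_property haar \<psi> n M \<mu> p q \<longleftrightarrow>
     (\<forall>M\<^sub>0. compactin (Ktop {..<n}) M\<^sub>0 \<and> openin (subtopology (Ktop {..<n}) M) M\<^sub>0 \<longrightarrow>
       (\<exists>A::real. \<forall>f. schwartz_bruhat n f \<longrightarrow>
          (LINT \<xi>:M\<^sub>0|\<mu>. norm (fourier haar \<psi> n f \<xi>) powr q) powr (1 / q)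
            \<le> A * Lp_norm (haar {..<n}) p f))"

end

theory Submission
  imports Defs
begin

text \<open>
  Let \<open>h(x) = \<integral> \<psi> (x \<cdot> \<xi>) d\<mu>(\<xi>)\<close>, the integral being over the compact open set \<open>M0\<close>.  Everything
  follows from a bound \<open>\<bar>h(x)\<bar> \<le> A \<bar>x\<bar>\<^bsup>-\<delta>\<^esup>\<close> for \<open>\<bar>x\<bar> \<ge> 1\<close>, where only \<open>A\<close> depends on \<open>M0\<close>: the square
  of the \<open>L\<^sup>2\<close> norm of the Fourier transform of \<open>f\<close> on \<open>M0\<close> is
  \<open>\<integral> \<integral> f(x) cnj(f(y)) h(x - y) dx dy\<close>, and Young's inequality bounds this by the square of the
  \<open>L\<^sup>p\<close> norm of \<open>f\<close> times the \<open>L\<^sup>r\<close> norm of \<open>h\<close>, with \<open>2 r\<close> conjugate to \<open>p\<close>.  As \<open>p\<close> tends to 1,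
  \<open>r\<close> tends to infinity, and \<open>h\<close> is in \<open>L\<^sup>r\<close> as soon as \<open>\<delta> r > n\<close> (\<open>restriction_of_decaying\<close>).  Since
  \<open>f\<close> is locally constant with compact support, all integrals over \<open>K\<^sup>n\<close> are finite sums.

  The decay of \<open>h\<close> is local.  Balls of an ultrametric space are nested or disjoint, so \<open>M0\<close> is a
  disjoint union of finitely many balls of \<open>M\<close>, as small as necessary
  (\<open>decaying_compact_open\<close>).  An isometric chart maps such a ball onto a ball of
  \<open>K\<^sup>J\<close> and \<open>\<mu>\<close> to Haar measure, and turns \<open>h\<close> into an integral of \<open>\<psi> (l \<phi>(y))\<close> where
  \<open>\<phi> = v \<cdot> f\<close> for a unit vector \<open>v\<close> and \<open>\<bar>l\<bar> = \<bar>x\<bar>\<close> (\<open>decaying_ball_in_manifold\<close>).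

  The oscillatory integral is estimated through one partial derivative \<open>g\<close> of \<open>\<phi>\<close>.  Choose balls of
  radius about \<open>\<bar>l\<bar>\<^bsup>-1/2\<^esup>\<close>.  On such a ball the second order part of \<open>l \<phi>\<close> lies in the maximal ideal,
  where \<open>\<psi>\<close> is trivial, so a small translation multiplies \<open>\<psi> (l \<phi>)\<close> by a constant; unless \<open>\<bar>g\<bar>\<close> is
  at most about \<open>\<bar>l\<bar>\<^bsup>-1/2\<^esup>\<close>, the constant can be made different from 1, and the integral over the ball
  is exactly 0.  Hence the whole integral is at most the measure of the set
  where \<open>\<bar>g\<bar> \<le> \<eta>\<close>, for some \<open>\<eta>\<close> about \<open>\<bar>l\<bar>\<^bsup>-1/2\<^esup>\<close> (\<open>oscillatory_integral_le\<close>).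

  By the type condition some derivative of \<open>\<phi>\<close> of order at most \<open>k\<close> does not vanish at the
  point; take for \<open>g\<close> the first step on the way to it.  Induction along the remaining derivatives shows
  that the set where \<open>\<bar>g\<bar> \<le> \<epsilon>\<close> has measure at most a constant times a power of \<open>\<epsilon>\<close>
  (\<open>sublevel_estimate\<close>).  Both estimates use only that the derivatives are Lipschitz and have
  Taylor expansions of the first order in each coordinate direction, which power series satisfy because
  monomials do (\<open>K_analytic_on_derivatives\<close>).  The constants are uniform in \<open>v\<close> because the unit sphere
  of \<open>K\<^sup>n\<close> is compact (\<open>decay_near_point_of_finite_type\<close>).  The resulting exponent
  \<open>\<delta> = 3\<^bsup>-k\<^esup> / 2\<close> depends on \<open>k\<close> alone, which makes the range of \<open>p\<close> independent of \<open>M0\<close>.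
\<close>

section \<open>Non-archimedean local fields\<close>

lemma absval_ge_0 [simp]: "0 \<le> absval (x::'a::nonarch_local_field)"
  using dist_absval[of x 0] zero_le_dist[of x 0] by simp

lemma absval_eq_0_iff [simp]: "absval (x::'a::nonarch_local_field) = 0 \<longleftrightarrow> x = 0"
  using dist_absval[of x 0] dist_eq_0_iff[of x 0] by simp

lemma absval_zero [simp]: "absval (0::'a::nonarch_local_field) = 0"
  by simp

lemma absval_pos_iff [simp]: "0 < absval (x::'a::nonarch_local_field) \<longleftrightarrow> x \<noteq> 0"
  using absval_ge_0[of x] absval_eq_0_iff[of x] by linarith

lemma absval_one [simp]: "absval (1::'a::nonarch_local_field) = 1"
  using absval_mult[of 1 "1::'a"] absval_pos_iff[of "1::'a"] by simp

lemma absval_minus [simp]: "absval (- x) = absval (x::'a::nonarch_local_field)"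
  using dist_absval[of 0 x] dist_absval[of x 0] by (simp add: dist_commute)

lemma absval_minus_commute: "absval (x - y) = absval (y - (x::'a::nonarch_local_field))"
  using absval_minus[of "x - y"] by simp

lemma absval_power: "absval (x ^ m) = absval (x::'a::nonarch_local_field) ^ m"
  by (induction m) (simp_all add: absval_mult)

lemma absval_prod: "absval (prod f A) = (\<Prod>i\<in>A. absval (f i :: 'a::nonarch_local_field))"
  by (induction A rule: infinite_finite_induct) (simp_all add: absval_mult)

lemma absval_inverse: "absval (inverse x) = inverse (absval (x::'a::nonarch_local_field))"
proof (cases "x = 0")
  case False
  then have "absval x * absval (inverse x) = 1"
    by (simp flip: absval_mult)
  then show ?thesis
    by (simp add: inverse_unique)
qed simp

lemma absval_divide: "absval (x / y) = absval x / absval (y::'a::nonarch_local_field)"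
  by (simp add: field_class.field_divide_inverse absval_mult absval_inverse divide_inverse)

lemma absval_add_le:
  "absval x \<le> C \<Longrightarrow> absval y \<le> C \<Longrightarrow> absval (x + y) \<le> C" for x :: "'a::nonarch_local_field"
  using absval_add_le_max[of x y] by linarith

lemma absval_diff_le:
  "absval x \<le> C \<Longrightarrow> absval y \<le> C \<Longrightarrow> absval (x - y) \<le> C" for x :: "'a::nonarch_local_field"
  using absval_add_le[of x C "- y"] by simp

lemma absval_add_less:
  "absval x < C \<Longrightarrow> absval y < C \<Longrightarrow> absval (x + y) < C" for x :: "'a::nonarch_local_field"
  using absval_add_le_max[of x y] by linarith

lemma absval_trans_le:
  "absval (x - y) \<le> C \<Longrightarrow> absval (y - z) \<le> C \<Longrightarrow> absval (x - z) \<le> C"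
  for x :: "'a::nonarch_local_field"
  using absval_add_le[of "x - y" C "y - z"] by simp

lemma absval_sum_le:
  assumes "0 \<le> C" "\<And>i. i \<in> A \<Longrightarrow> absval (f i :: 'a::nonarch_local_field) \<le> C"
  shows "absval (sum f A) \<le> C"
  using assms(2)
proof (induction A rule: infinite_finite_induct)
  case (insert x F)
  then show ?case
    by (auto intro!: absval_add_le)
qed (use assms(1) in auto)

text \<open>In an ultrametric triangle the two longest sides are equal.\<close>

lemma absval_eq_of_dominant:
  "absval (x - y) < absval y \<Longrightarrow> absval x = absval (y::'a::nonarch_local_field)"
  using absval_add_le_max[of "x - y" y] absval_add_le_max[of "y - x" x] absval_minus_commute[of x y]
  by (auto simp: max_def split: if_splits)

lemma absval_of_nat_le_1: "absval (of_nat m :: 'a::nonarch_local_field) \<le> 1"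
  by (induction m) (auto intro: absval_add_le)

lemma card_residue_field_ge_2: "2 \<le> card (residue_field :: 'a::nonarch_local_field set set)"
proof -
  let ?r = "{(x, y). x \<in> valuation_ring \<and> y \<in> valuation_ring \<and> x - (y::'a) \<in> maximal_ideal}"
  have "?r `` {0} \<noteq> ?r `` {1}"
    by (auto simp: maximal_ideal_def valuation_ring_def set_eq_iff intro!: exI[of _ "1::'a"])
  moreover have "?r `` {x} \<in> residue_field" if "absval x \<le> 1" for x :: 'a
    unfolding residue_field_def by (rule quotientI) (use that in \<open>simp add: valuation_ring_def\<close>)
  from this[of 0] this[of 1] have "{?r `` {0}, ?r `` {1}} \<subseteq> residue_field"
    by (simp del: Image_singleton_iff)
  ultimately show ?thesis
    using card_mono[OF finite_residue_field, of "{?r `` {0}, ?r `` {1}}"] by simp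
qed

definition residue_card :: "'a::nonarch_local_field itself \<Rightarrow> real" where
  "residue_card _ = real (card (residue_field :: 'a set set))"

lemma residue_card_ge_2: "2 \<le> residue_card TYPE('a::nonarch_local_field)"
  unfolding residue_card_def using card_residue_field_ge_2[where 'a='a] by linarith

lemma uniformizer_exists:
  "\<exists>\<pi>::'a::nonarch_local_field. absval \<pi> = 1 / residue_card TYPE('a) \<and> \<pi> \<noteq> 0 \<and>
     (\<forall>z::'a. absval z < 1 \<longleftrightarrow> absval z \<le> 1 / residue_card TYPE('a))"
proof -
  obtain \<pi> :: 'a where \<pi>: "absval \<pi> = 1 / residue_card TYPE('a)"
      "\<forall>z::'a. absval z < 1 \<longleftrightarrow> absval z \<le> 1 / residue_card TYPE('a)"
    using normalized_uniformizer[where 'a='a] by (auto simp: maximal_ideal_def residue_card_def)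
  moreover have "\<pi> \<noteq> 0"
    using \<pi>(1) residue_card_ge_2[where 'a='a] by auto
  ultimately show ?thesis
    by blast
qed

lemma residue_representatives:
  "\<exists>D :: 'a::nonarch_local_field set. finite D \<and> real (card D) = residue_card TYPE('a) \<and>
     (\<forall>x\<in>D. absval x \<le> 1) \<and>
     (\<forall>x\<in>D. \<forall>y\<in>D. x \<noteq> y \<longrightarrow> 1 \<le> absval (x - y)) \<and>
     (\<forall>x. absval x \<le> 1 \<longrightarrow> (\<exists>d\<in>D. absval (x - d) < 1))"
proof -
  let ?r = "{(x, y). x \<in> valuation_ring \<and> y \<in> valuation_ring \<and> x - (y::'a) \<in> maximal_ideal}"
  let ?c = "\<lambda>X. SOME x::'a. x \<in> X"
  have sym: "absval (y - x) < 1" if "absval (x - y) < 1" for x y :: 'a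
    using that by (simp add: absval_minus_commute)
  have trans: "absval (x - z) < 1" if "absval (x - y) < 1" "absval (y - z) < 1" for x y z :: 'a
    using absval_add_less[OF that] by simp
  have eqv: "equiv valuation_ring ?r"
    by (intro equivI refl_onI symI transI) (auto intro: sym trans simp: maximal_ideal_def)
  have in_c: "?c X \<in> X" if "X \<in> residue_field" for X :: "'a set"
    using in_quotient_imp_non_empty[OF eqv] that unfolding residue_field_def by (simp add: some_in_eq)
  have sub: "X \<subseteq> valuation_ring" if "X \<in> residue_field" for X :: "'a set"
    using in_quotient_imp_subset[OF eqv] that unfolding residue_field_def by simp
  have eqX: "X = Y" if "X \<in> residue_field" "Y \<in> residue_field" "x \<in> X" "y \<in> Y" "absval (x - y) < 1" for X Y :: "'a set" and x y
  proof (rule quotient_eqI[OF eqv])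
    show "(x, y) \<in> ?r"
      using that sub[of X] sub[of Y] by (auto simp: maximal_ideal_def)
  qed (use that in \<open>auto simp: residue_field_def\<close>)
  have "inj_on ?c residue_field"
    using eqX in_c by (intro inj_onI) (metis absval_zero diff_self zero_less_one)
  then have "real (card (?c ` residue_field)) = residue_card TYPE('a)"
    by (simp add: card_image residue_card_def)
  moreover have "\<exists>d\<in>?c ` residue_field. absval (x - d) < 1" if "absval x \<le> 1" for x :: 'a
  proof -
    have X: "?r `` {x} \<in> residue_field" 
      using that by (auto simp: residue_field_def quotient_def valuation_ring_def)
    have "absval (x - ?c (?r `` {x})) < 1"
      using in_c[OF X] by (simp only: Image_singleton_iff mem_Collect_eq case_prod_conv maximal_ideal_def) auto
    then show ?thesis
      using X by blast
  qed
  moreover have "1 \<le> absval (x - y)" if xy: "x \<in> ?c ` residue_field" "y \<in> ?c ` residue_field" "x \<noteq> y" for x y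
  proof (rule ccontr)
    assume "\<not> 1 \<le> absval (x - y)"
    moreover obtain X Y where "x = ?c X" "X \<in> residue_field" "y = ?c Y" "Y \<in> residue_field"
      using xy(1,2) by blast
    ultimately show False
      using eqX[of X Y x y] in_c[of X] in_c[of Y] xy(3) by simp
  qed
  ultimately show ?thesis
    using finite_residue_field in_c sub
    by (intro exI[of _ "?c ` residue_field"]) (fastforce simp: valuation_ring_def)
qed

text \<open>
  Iterating the choice of representatives of the residue field gives representatives of the
  valuation ring modulo the \<open>N\<close>-th power of the maximal ideal; points in distinct classes are farther
  apart than the radius of a class.
\<close>

lemma digit_expansions:
  "\<exists>Z :: 'a::nonarch_local_field set. finite Z \<and> real (card Z) = residue_card TYPE('a) ^ N \<and>
     (\<forall>z\<in>Z. absval z \<le> 1) \<and>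
     (\<forall>z\<in>Z. \<forall>w\<in>Z. z \<noteq> w \<longrightarrow> 1 / residue_card TYPE('a) ^ N < absval (z - w)) \<and>
     (\<forall>x. absval x \<le> 1 \<longrightarrow> (\<exists>z\<in>Z. absval (x - z) \<le> 1 / residue_card TYPE('a) ^ N))"
proof (induction N)
  case 0
  show ?case
    by (intro exI[of _ "{0::'a}"]) auto
next
  case (Suc N)
  let ?q = "residue_card TYPE('a)"
  have q: "2 \<le> ?q" by (rule residue_card_ge_2)
  obtain \<pi> :: 'a where \<pi>: "absval \<pi> = 1 / ?q" "\<pi> \<noteq> 0" "\<And>z::'a. absval z < 1 \<longleftrightarrow> absval z \<le> 1 / ?q"
    using uniformizer_exists[where 'a='a] by blast
  obtain D :: "'a set" where D: "finite D" "real (card D) = ?q" "\<And>x. x \<in> D \<Longrightarrow> absval x \<le> 1"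
    "\<And>x y. x \<in> D \<Longrightarrow> y \<in> D \<Longrightarrow> x \<noteq> y \<Longrightarrow> 1 \<le> absval (x - y)"
    "\<And>x. absval x \<le> 1 \<Longrightarrow> \<exists>d\<in>D. absval (x - d) < 1"
    using residue_representatives[where 'a='a] by metis
  obtain Z :: "'a set" where Z: "finite Z" "real (card Z) = ?q ^ N" "\<And>z. z \<in> Z \<Longrightarrow> absval z \<le> 1"
     "\<And>z w. z \<in> Z \<Longrightarrow> w \<in> Z \<Longrightarrow> z \<noteq> w \<Longrightarrow> 1 / ?q ^ N < absval (z - w)"
     "\<And>x. absval x \<le> 1 \<Longrightarrow> \<exists>z\<in>Z. absval (x - z) \<le> 1 / ?q ^ N"
    using Suc by metis
  let ?f = "\<lambda>(d, z). d + \<pi> * z"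
  have small: "absval (\<pi> * z) \<le> 1 / ?q" if "absval z \<le> 1" for z
    using that q by (simp add: absval_mult \<pi> divide_simps)
  have sep: "1 / ?q ^ Suc N < absval (?f (d, z) - ?f (e, w))"
    if "d \<in> D" "e \<in> D" "z \<in> Z" "w \<in> Z" "(d, z) \<noteq> (e, w)" for d e z w
  proof (cases "d = e")
    case True
    then have "1 / ?q ^ N < absval (z - w)"
      using Z(4) that by auto
    then have "1 / ?q ^ Suc N < absval (\<pi> * (z - w))"
      using q by (simp only: absval_mult \<pi>) (simp add: field_simps)
    then show ?thesis
      using True by (simp add: algebra_simps)
  next
    case False
    have "absval (\<pi> * z - \<pi> * w) \<le> 1 / ?q"
      using small that Z(3) by (intro absval_diff_le) auto
    moreover have "1 / ?q < 1"
      using q by simp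
    ultimately have "absval ((?f (d, z) - ?f (e, w)) - (d - e)) < absval (d - e)"
      using D(4)[OF that(1,2) False] by (simp add: algebra_simps)
    then have "absval (?f (d, z) - ?f (e, w)) = absval (d - e)"
      by (rule absval_eq_of_dominant)
    moreover have "1 / ?q ^ Suc N < 1"
      using q one_less_power[of ?q "Suc N"] by (simp add: divide_simps)
    ultimately show ?thesis
      using D(4)[OF that(1,2) False] by linarith
  qed
  have inj: "inj_on ?f (D \<times> Z)"
  proof (rule inj_onI, clarify)
    fix d z e w
    assume "d \<in> D" "z \<in> Z" "e \<in> D" "w \<in> Z" "d + \<pi> * z = e + \<pi> * w"
    moreover have "0 < 1 / ?q ^ Suc N"
      using q by simp
    ultimately show "d = e \<and> z = w"
      using sep[of d e z w] by auto
  qed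
  have cover: "\<exists>z\<in>?f ` (D \<times> Z). absval (x - z) \<le> 1 / ?q ^ Suc N" if x: "absval x \<le> 1" for x
  proof -
    obtain d where d: "d \<in> D" "absval (x - d) \<le> 1 / ?q"
      using D(5)[OF x] \<pi>(3) by auto
    then have "absval ((x - d) / \<pi>) \<le> 1"
      using q by (simp add: absval_divide \<pi> divide_simps)
    then obtain z where z: "z \<in> Z" "absval ((x - d) / \<pi> - z) \<le> 1 / ?q ^ N"
      using Z(5) by blast
    have "x - (d + \<pi> * z) = \<pi> * ((x - d) / \<pi> - z)"
      using \<pi>(2) by (simp add: field_simps)
    then have "absval (x - (d + \<pi> * z)) \<le> 1 / ?q ^ Suc N"
      using z(2) q by (simp only: absval_mult \<pi>) (simp add: field_simps)
    then show ?thesis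
      using d z by (intro bexI[of _ "d + \<pi> * z"]) auto
  qed
  show ?case
  proof (intro exI[of _ "?f ` (D \<times> Z)"] conjI ballI impI allI)
    show "real (card (?f ` (D \<times> Z))) = ?q ^ Suc N"
      using inj D(2) Z(2) by (simp add: card_image card_cartesian_product)
    show "absval z \<le> 1" if "z \<in> ?f ` (D \<times> Z)" for z
    proof -
      have "1 / ?q \<le> 1" using q by simp
      then show ?thesis
      using that D(3) Z(3) by (auto intro!: absval_add_le order_trans[OF small])
    qed
    show "1 / ?q ^ Suc N < absval (u - v)"
      if uv: "u \<in> ?f ` (D \<times> Z)" "v \<in> ?f ` (D \<times> Z)" "u \<noteq> v" for u v
    proof -
      obtain d z e w where *: "d \<in> D" "z \<in> Z" "u = ?f (d, z)" "e \<in> D" "w \<in> Z" "v = ?f (e, w)"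
        using uv(1,2) by blast
      then have "(d, z) \<noteq> (e, w)"
        using uv(3) by blast
      then show ?thesis
        using sep[of d e z w] * by simp
    qed
  qed (use D(1) Z(1) cover in auto)
qed

lemma absval_scale:
  fixes \<rho> :: real
  assumes "0 < \<rho>"
  obtains t :: "'a::nonarch_local_field"
  where "t \<noteq> 0" "absval t \<le> \<rho>" "\<rho> < residue_card TYPE('a) * absval t"
proof -
  let ?q = "residue_card TYPE('a)"
  have q: "2 \<le> ?q" by (rule residue_card_ge_2)
  obtain \<pi> :: 'a where \<pi>: "absval \<pi> = 1 / ?q" "\<pi> \<noteq> 0" "\<And>z::'a. absval z < 1 \<longleftrightarrow> absval z \<le> 1 / ?q"
    using uniformizer_exists[where 'a='a] by blast
  define m where "m = \<lfloor>log ?q \<rho>\<rfloor>"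
  have abs: "absval (\<pi> powi (- m)) = ?q powr m"
    using q \<pi>(1) by (simp add: power_int_def absval_power absval_inverse powr_real_of_int power_divide power_inverse divide_inverse)
  show ?thesis
  proof (rule that)
    show "\<pi> powi (- m) \<noteq> 0" using \<pi>(2) by simp
    have "?q powr m \<le> ?q powr (log ?q \<rho>)"
      using q by (intro powr_mono) (auto simp: m_def)
    then show "absval (\<pi> powi (- m)) \<le> \<rho>"
      using abs q assms by simp
    have "?q powr (log ?q \<rho>) < ?q powr (m + 1)"
      using q by (intro powr_less_mono) (auto simp: m_def)
    then show "\<rho> < ?q * absval (\<pi> powi (- m))"
      using abs q assms by (simp add: powr_add mult.commute)
  qed
qed

lemma absval_finite_net:
  assumes "0 < e"
  obtains Z :: "'a::nonarch_local_field set"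
  where "finite Z" "\<And>x. absval x \<le> R \<Longrightarrow> \<exists>z\<in>Z. absval (x - z) \<le> e"
proof -
  let ?q = "residue_card TYPE('a)"
  have q: "2 \<le> ?q" by (rule residue_card_ge_2)
  obtain t :: 'a where t: "t \<noteq> 0" "\<bar>R\<bar> + 1 < ?q * absval t"
    by (rule absval_scale[of "\<bar>R\<bar> + 1"]) auto
  obtain \<pi> :: 'a where \<pi>: "absval \<pi> = 1 / ?q" "\<pi> \<noteq> 0" "\<And>z::'a. absval z < 1 \<longleftrightarrow> absval z \<le> 1 / ?q"
    using uniformizer_exists[where 'a='a] by blast
  define s where "s = t / \<pi>"
  have s: "s \<noteq> 0" "R \<le> absval s"
    using t \<pi> by (auto simp: s_def absval_divide mult.commute)
  obtain N where "absval s / e < ?q ^ N"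
    using real_arch_pow[of ?q "absval s / e"] q by auto
  then have N: "absval s / ?q ^ N \<le> e"
    using q assms by (simp add: field_simps)
  obtain Z :: "'a set" where Z: "finite Z" "\<And>x. absval x \<le> 1 \<Longrightarrow> \<exists>z\<in>Z. absval (x - z) \<le> 1 / ?q ^ N"
    using digit_expansions[of N] by metis
  show ?thesis
  proof (rule that[of "(\<lambda>z. s * z) ` Z"])
    fix x :: 'a assume "absval x \<le> R"
    then have "absval (x / s) \<le> 1"
      using s by (simp add: absval_divide)
    then obtain z where z: "z \<in> Z" "absval (x / s - z) \<le> 1 / ?q ^ N"
      using Z by blast
    have "x - s * z = s * (x / s - z)"
      using s by (simp add: algebra_simps)
    then have "absval (x - s * z) \<le> absval s * (1 / ?q ^ N)"
      using mult_left_mono[OF z(2) absval_ge_0[of s]] by (simp add: absval_mult)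
    then show "\<exists>z\<in>(\<lambda>z. s * z) ` Z. absval (x - z) \<le> e"
      using z(1) N by (intro bexI[of _ "s * z"]) auto
  qed (use Z in auto)
qed

text \<open>
  The scaled representatives modulo a suitable power of the maximal ideal.  Rounding both radii to
  norms of elements of \<open>K\<close> costs the factor \<open>q\<^sup>2\<close>.
\<close>

lemma absval_separated_set:
  assumes "0 < \<rho>" "0 < \<sigma>"
  obtains Z :: "'a::nonarch_local_field set"
  where "finite Z" "\<And>z. z \<in> Z \<Longrightarrow> absval z \<le> \<rho>"
    "\<And>z w. z \<in> Z \<Longrightarrow> w \<in> Z \<Longrightarrow> z \<noteq> w \<Longrightarrow> \<sigma> < absval (z - w)"
    "\<rho> / (\<sigma> * residue_card TYPE('a) ^ 2) \<le> real (card Z)"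
proof -
  let ?q = "residue_card TYPE('a)"
  have q: "2 \<le> ?q" by (rule residue_card_ge_2)
  obtain t :: 'a where t: "t \<noteq> 0" "absval t \<le> \<rho>" "\<rho> < ?q * absval t"
    by (rule absval_scale[OF assms(1)])
  obtain N0 where N0: "absval t / \<sigma> < ?q ^ N0"
    using real_arch_pow[of ?q "absval t / \<sigma>"] q by auto
  define N where "N = (LEAST N. absval t / ?q ^ Suc N < \<sigma>)"
  have "?q ^ N0 \<le> ?q ^ Suc N0"
    using q by (intro power_increasing) auto
  then have "absval t / \<sigma> < ?q ^ Suc N0"
    using N0 by linarith
  then have "absval t / ?q ^ Suc N0 < \<sigma>"
    using q assms by (simp add: field_simps del: power_Suc)
  then have N: "absval t / ?q ^ Suc N < \<sigma>"
    unfolding N_def by (rule LeastI)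
  have N': "N = 0 \<or> \<sigma> \<le> absval t / ?q ^ N"
    using not_less_Least[of "N - 1" "\<lambda>N. absval t / ?q ^ Suc N < \<sigma>"]
    by (cases N) (auto simp: N_def not_less)
  obtain Z :: "'a set" where Z: "finite Z" "real (card Z) = ?q ^ N" "\<And>z. z \<in> Z \<Longrightarrow> absval z \<le> 1"
     "\<And>z w. z \<in> Z \<Longrightarrow> w \<in> Z \<Longrightarrow> z \<noteq> w \<Longrightarrow> 1 / ?q ^ N < absval (z - w)"
    using digit_expansions[of N] by metis
  show ?thesis
  proof (rule that[of "(\<lambda>z. t * z) ` Z"])
    show "absval z \<le> \<rho>" if "z \<in> (\<lambda>z. t * z) ` Z" for z
      using that t(2) Z(3) mult_left_le[of "absval _" "absval t"] 
      by (fastforce simp: absval_mult intro: order_trans)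
    show "\<sigma> < absval (z - w)" if zw: "z \<in> (\<lambda>z. t * z) ` Z" "w \<in> (\<lambda>z. t * z) ` Z" "z \<noteq> w" for z w
    proof (cases "N = 0")
      case True
      then have "card Z = 1" using Z(2) by simp
      then show ?thesis using that by (auto simp: card_1_singleton_iff)
    next
      case False
      obtain z' w' where *: "z = t * z'" "w = t * w'" "z' \<in> Z" "w' \<in> Z" "z' \<noteq> w'"
        using zw by auto
      have "absval t * (1 / ?q ^ N) < absval t * absval (z' - w')"
        using Z(4)[OF *(3-5)] t by (intro mult_strict_left_mono) auto
      moreover have "\<sigma> \<le> absval t * (1 / ?q ^ N)"
        using N' False by auto
      ultimately show ?thesis
        unfolding * by (simp flip: right_diff_distrib absval_mult)
    qed
    have "absval t < ?q ^ Suc N * \<sigma>"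
      using N q by (simp add: pos_divide_less_eq mult.commute del: power_Suc)
    then have "?q * absval t \<le> ?q * (?q ^ Suc N * \<sigma>)"
      using q by (intro mult_left_mono) auto
    then have "\<rho> \<le> ?q * (?q ^ Suc N * \<sigma>)"
      using t(3) by linarith
    then have "\<rho> / (\<sigma> * ?q ^ 2) \<le> ?q ^ N"
      using assms q by (simp add: power2_eq_square field_simps)
    also have "\<dots> = real (card ((\<lambda>z. t * z) ` Z))"
      using t Z(2) by (subst card_image) (auto intro!: inj_onI)
    finally show "\<rho> / (\<sigma> * ?q ^ 2) \<le> real (card ((\<lambda>z. t * z) ` Z))" .
  qed (use Z in auto)
qed

lemma compact_absval_ball: "compact {x::'a::nonarch_local_field. absval x \<le> R}"
  unfolding compact_eq_totally_bounded
proof (intro conjI allI impI)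
  have eq: "{x::'a. absval x \<le> R} = cball 0 R"
    by (auto simp: dist_absval)
  show "complete {x::'a. absval x \<le> R}"
    unfolding eq complete_eq_closed by simp
  fix e :: real assume "0 < e"
  then obtain Z :: "'a set" where Z: "finite Z" "\<And>x. absval x \<le> R \<Longrightarrow> \<exists>z\<in>Z. absval (x - z) \<le> e / 2"
    using absval_finite_net[of "e / 2" R] by auto
  show "\<exists>k. finite k \<and> {x::'a. absval x \<le> R} \<subseteq> (\<Union>x\<in>k. ball x e)"
  proof (intro exI[of _ Z] conjI subsetI)
    fix x assume "x \<in> {x::'a. absval x \<le> R}"
    then obtain z where "z \<in> Z" "absval (x - z) \<le> e / 2"
      using Z by auto
    then show "x \<in> (\<Union>x\<in>Z. ball x e)"
      using \<open>0 < e\<close> by (auto simp: dist_absval absval_minus_commute[of z x] intro!: bexI[of _ z])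
  qed (rule Z)
qed


instance nonarch_local_field \<subseteq> topological_ab_group_add
proof
  fix a b :: 'a
  show "LIM x (nhds a \<times>\<^sub>F nhds b). fst x + snd x :> nhds (a + b)"
  proof (rule tendstoI)
    fix e :: real assume e: "0 < e"
    have "eventually (\<lambda>x. dist x a < e) (nhds a)" "eventually (\<lambda>x. dist x b < e) (nhds b)"
      using e by (auto simp: eventually_nhds_metric)
    then have "\<forall>\<^sub>F x in nhds a \<times>\<^sub>F nhds b. dist (fst x) a < e \<and> dist (snd x) b < e"
      unfolding eventually_prod_filter by fastforce
    then show "\<forall>\<^sub>F x in nhds a \<times>\<^sub>F nhds b. dist (fst x + snd x) (a + b) < e"
    proof eventually_elim
      case (elim x)
      then have "absval ((fst x - a) + (snd x - b)) < e"
        by (intro absval_add_less) (auto simp: dist_absval)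
      then show ?case
        by (simp add: dist_absval algebra_simps)
    qed
  qed
  show "(uminus \<longlongrightarrow> - a) (nhds a)"
  proof (rule tendstoI)
    fix e :: real assume e: "0 < e"
    then have "eventually (\<lambda>x. dist x a < e) (nhds a)"
      by (auto simp: eventually_nhds_metric)
    then show "\<forall>\<^sub>F x in nhds a. dist (- x) (- a) < e"
    proof eventually_elim
      case (elim x)
      then show ?case
        using absval_minus[of "x - a"] by (simp add: dist_absval)
    qed
  qed
qed

lemma has_sum_cmult_absval:
  fixes f :: "'i \<Rightarrow> 'a::nonarch_local_field"
  assumes "(f has_sum s) A"
  shows "((\<lambda>x. c * f x) has_sum (c * s)) A"
proof (cases "c = 0")
  case False
  show ?thesis
    unfolding has_sum_def
  proof (rule tendstoI)
    fix e :: real assume "0 < e"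
    then have "\<forall>\<^sub>F F in finite_subsets_at_top A. dist (sum f F) s < e / absval c"
      using assms False unfolding has_sum_def by (intro tendstoD) auto
    then show "\<forall>\<^sub>F F in finite_subsets_at_top A. dist (\<Sum>x\<in>F. c * f x) (c * s) < e"
    proof eventually_elim
      case (elim F)
      then show ?case
        using False by (simp add: dist_absval absval_mult pos_less_divide_eq mult.commute
          flip: sum_distrib_left right_diff_distrib)
    qed
  qed
qed simp

lemma has_sum_diff_absval:
  fixes f :: "'i \<Rightarrow> 'a::nonarch_local_field"
  assumes "(f has_sum s) A" "(g has_sum t) A"
  shows "((\<lambda>x. f x - g x) has_sum (s - t)) A"
  using has_sum_add[OF assms(1) has_sum_cmult_absval[OF assms(2), of "-1"]] by simp

lemma has_sum_absval_le:
  fixes f :: "'i \<Rightarrow> 'a::nonarch_local_field"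
  assumes "(f has_sum s) A" "0 \<le> C" "\<And>x. x \<in> A \<Longrightarrow> absval (f x) \<le> C"
  shows "absval s \<le> C"
proof (rule field_le_epsilon)
  fix e :: real assume e: "0 < e"
  then have "\<forall>\<^sub>F F in finite_subsets_at_top A. dist (sum f F) s < e"
    using assms(1) unfolding has_sum_def by (intro tendstoD) auto
  then obtain F where F: "finite F" "F \<subseteq> A" "dist (sum f F) s < e"
    unfolding eventually_finite_subsets_at_top by blast
  have "absval (s - sum f F) \<le> C + e" "absval (sum f F) \<le> C + e"
    using F e absval_sum_le[of C F f] assms
    by (auto simp: dist_absval absval_minus_commute[of s] intro!: order_trans[OF absval_sum_le[of C F f]])
  then show "absval s \<le> C + e"
    using absval_add_le by fastforce
qed

text \<open>
  The terms tend to zero.  For ultrametric sums this is the same as summability, so convergence of a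
  power series is a condition on its terms that passes to termwise smaller families.
\<close>

definition null_family :: "('i \<Rightarrow> 'a::nonarch_local_field) \<Rightarrow> 'i set \<Rightarrow> bool" where
  "null_family f A \<longleftrightarrow> (\<forall>e>0. finite {x\<in>A. e \<le> absval (f x)})"

lemma null_family_mono:
  fixes f g :: "'i \<Rightarrow> 'a::nonarch_local_field"
  assumes "null_family f A" "0 < C" "\<And>x. x \<in> A \<Longrightarrow> absval (g x) \<le> C * absval (f x)"
  shows "null_family g A"
  unfolding null_family_def
proof (intro allI impI)
  fix e :: real assume "0 < e"
  then have "finite {x\<in>A. e / C \<le> absval (f x)}"
    using assms(1,2) by (simp add: null_family_def)
  then show "finite {x\<in>A. e \<le> absval (g x)}"
    using assms(2,3) by (rule_tac finite_subset) (auto simp: pos_divide_le_eq mult.commute intro: order_trans)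
qed

lemma has_sum_imp_null_family:
  fixes f :: "'i \<Rightarrow> 'a::nonarch_local_field"
  assumes "(f has_sum s) A"
  shows "null_family f A"
  unfolding null_family_def
proof (intro allI impI)
  fix e :: real assume e: "0 < e"
  then have "\<forall>\<^sub>F F in finite_subsets_at_top A. dist (sum f F) s < e"
    using assms unfolding has_sum_def by (intro tendstoD) auto
  then obtain F where F: "finite F" "F \<subseteq> A"
    "\<And>G. finite G \<Longrightarrow> F \<subseteq> G \<Longrightarrow> G \<subseteq> A \<Longrightarrow> dist (sum f G) s < e"
    unfolding eventually_finite_subsets_at_top by metis
  have "absval (f x) < e" if "x \<in> A" "x \<notin> F" for x
  proof -
    have "absval (sum f (insert x F) - s) < e" "absval (s - sum f F) < e"
      using F(3)[of "insert x F"] F(3)[of F] F(1,2) that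
      by (auto simp: dist_absval absval_minus_commute[of s])
    then have "absval ((sum f (insert x F) - s) + (s - sum f F)) < e"
      by (rule absval_add_less)
    then show ?thesis
      using F(1) that by simp
  qed
  then have "{x\<in>A. e \<le> absval (f x)} \<subseteq> F"
    by force
  then show "finite {x\<in>A. e \<le> absval (f x)}"
    using F(1) finite_subset by blast
qed

lemma null_family_has_sum:
  fixes f :: "'i \<Rightarrow> 'a::nonarch_local_field"
  assumes "null_family f A"
  shows "(f has_sum (infsum f A)) A"
proof -
  define F where "F m = {x\<in>A. 1 / real (Suc m) \<le> absval (f x)}" for m
  have fin: "finite (F m)" for m
    using assms unfolding null_family_def F_def by auto
  have close: "absval (sum f G - sum f H) \<le> 1 / real (Suc m)"
    if "finite G" "finite H" "F m \<subseteq> G" "F m \<subseteq> H" "G \<subseteq> A" "H \<subseteq> A" for G H m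
  proof -
    have *: "absval (sum f G - sum f (F m)) \<le> 1 / real (Suc m)"
      if "finite G" "F m \<subseteq> G" "G \<subseteq> A" for G
    proof -
      have "sum f G - sum f (F m) = sum f (G - F m)"
        using that fin by (subst sum_diff) auto
      also have "absval \<dots> \<le> 1 / real (Suc m)"
        using that by (intro absval_sum_le) (auto simp: F_def)
      finally show ?thesis .
    qed
    have "absval (sum f (F m) - sum f H) \<le> 1 / real (Suc m)"
      unfolding absval_minus_commute[of "sum f (F m)"] by (rule *) (use that in simp_all)
    then show ?thesis
      by (rule absval_trans_le[OF *[OF that(1,3,5)]])
  qed
  have mono: "F m \<subseteq> F m'" if "m \<le> m'" for m m'
  proof -
    have "1 / real (Suc m') \<le> 1 / real (Suc m)"
      using that by (intro divide_left_mono) auto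
    then show ?thesis
      unfolding F_def by (blast intro: order_trans)
  qed
  have "Cauchy (\<lambda>m. sum f (F m))"
  proof (rule metric_CauchyI)
    fix e :: real assume "0 < e"
    then obtain N where N: "1 / real (Suc N) < e"
      using reals_Archimedean by (metis inverse_eq_divide)
    show "\<exists>N. \<forall>m\<ge>N. \<forall>l\<ge>N. dist (sum f (F m)) (sum f (F l)) < e"
    proof (intro exI[of _ N] allI impI)
      fix m l assume "N \<le> m" "N \<le> l"
      then have "absval (sum f (F m) - sum f (F l)) \<le> 1 / real (Suc N)"
        using fin mono by (intro close) (auto simp: F_def)
      then show "dist (sum f (F m)) (sum f (F l)) < e"
        using N by (simp add: dist_absval)
    qed
  qed
  then obtain s where s: "(\<lambda>m. sum f (F m)) \<longlonglongrightarrow> s"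
    using Cauchy_convergent_iff convergent_def by blast
  have "(f has_sum s) A"
    unfolding has_sum_def
  proof (rule tendstoI)
    fix e :: real assume "0 < e"
    then obtain N where N: "1 / real (Suc N) < e"
      using reals_Archimedean by (metis inverse_eq_divide)
    obtain m where m: "N \<le> m" "dist (sum f (F m)) s < e"
      using eventually_happens[OF eventually_conj[OF eventually_ge_at_top[of N] tendstoD[OF s \<open>0 < e\<close>]]]
      by auto
    have "dist (sum f G) s < e" if G: "finite G" "F N \<subseteq> G" "G \<subseteq> A" for G
    proof -
      have "absval (sum f G - sum f (F m)) \<le> 1 / real (Suc N)"
        using fin mono[OF m(1)] G by (intro close) (auto simp: F_def)
      then have "absval ((sum f G - sum f (F m)) + (sum f (F m) - s)) < e"
        using N m by (intro absval_add_less) (auto simp: dist_absval)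
      then show ?thesis by (simp add: dist_absval)
    qed
    then show "\<forall>\<^sub>F G in finite_subsets_at_top A. dist (sum f G) s < e"
      unfolding eventually_finite_subsets_at_top using fin by (intro exI[of _ "F N"]) (auto simp: F_def)
  qed
  then show ?thesis
    by (metis infsumI)
qed

lemma at_zero_neq_bot: "at (0::'a::nonarch_local_field) \<noteq> bot"
proof -
  have "\<exists>y. y \<noteq> 0 \<and> dist y (0::'a) < e" if e: "0 < e" for e :: real
  proof -
    obtain t :: 'a where "t \<noteq> 0" "absval t \<le> e / 2"
      using absval_scale[where 'a='a, of "e / 2"] e by (metis half_gt_zero)
    then show ?thesis
      using e by (intro exI[of _ t]) (auto simp: dist_absval)
  qed
  then show ?thesis
    by (auto simp: trivial_limit_def eventually_at)
qed

section \<open>Balls in the spaces \<open>K\<^sup>I\<close>\<close>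

definition kball :: "'i set \<Rightarrow> ('i \<Rightarrow> 'a::nonarch_local_field) \<Rightarrow> real \<Rightarrow> ('i \<Rightarrow> 'a) set" where
  "kball I x e = {y \<in> Kspace I. \<forall>i\<in>I. absval (y i - x i) \<le> e}"

lemma kball_subset_Kspace: "kball I x e \<subseteq> Kspace I"
  by (auto simp: kball_def)

lemma center_in_kball: "x \<in> Kspace I \<Longrightarrow> 0 \<le> e \<Longrightarrow> x \<in> kball I x e"
  by (auto simp: kball_def)

lemma kball_mono: "e \<le> e' \<Longrightarrow> kball I x e \<subseteq> kball I x e'"
  by (auto simp: kball_def intro: order_trans)

lemma kball_recenter:
  assumes "y \<in> kball I x e"
  shows "kball I y e = kball I x e"
proof -
  have "absval (z i - y i) \<le> e \<longleftrightarrow> absval (z i - x i) \<le> e" if "i \<in> I" for z i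
    using assms that absval_trans_le[of "z i" "y i" e "x i"] absval_trans_le[of "z i" "x i" e "y i"]
    by (auto simp: kball_def absval_minus_commute[of "x i"])
  then show ?thesis
    by (auto simp: kball_def)
qed

lemma kball_nested_or_disjoint:
  assumes "e \<le> e'"
  shows "kball I x e \<subseteq> kball I y e' \<or> kball I x e \<inter> kball I y e' = {}"
proof (cases "kball I x e \<inter> kball I y e' = {}")
  case False
  then obtain z where "z \<in> kball I x e" "z \<in> kball I y e'"
    by auto
  then have "kball I x e = kball I z e" "kball I y e' = kball I z e'"
    using kball_recenter by blast+
  then show ?thesis
    using kball_mono[OF assms] by blast
qed simp

lemma openin_Ktop_iff:
  fixes U :: "('i \<Rightarrow> 'a::nonarch_local_field) set"
  assumes "finite I"
  shows "openin (Ktop I) U \<longleftrightarrow> U \<subseteq> Kspace I \<and> (\<forall>x\<in>U. \<exists>e>0. kball I x e \<subseteq> U)"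
proof (intro iffI conjI subsetI ballI)
  fix x assume "openin (Ktop I) U" "x \<in> U"
  then show "x \<in> Kspace I"
    using openin_subset by fastforce
next
  fix x assume "openin (Ktop I) U" "x \<in> U"
  then obtain V where V: "\<forall>i\<in>I. open (V i)" "x \<in> Pi\<^sub>E I V" "Pi\<^sub>E I V \<subseteq> U"
    unfolding openin_product_topology_alt by force
  have "\<exists>e>0. \<forall>y. absval (y - x i) \<le> e \<longrightarrow> y \<in> V i" if "i \<in> I" for i
  proof -
    have "open (V i)" "x i \<in> V i"
      using that V by auto
    then obtain e where "e > 0" "\<And>y. absval (y - x i) < e \<Longrightarrow> y \<in> V i"
      unfolding open_dist by (auto simp: dist_absval)
    then show ?thesis
      by (intro exI[of _ "e / 2"]) auto
  qed
  then obtain e where e: "\<And>i. i \<in> I \<Longrightarrow> e i > (0::real)"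
      "\<And>i y. i \<in> I \<Longrightarrow> absval (y - x i) \<le> e i \<Longrightarrow> y \<in> V i"
    by metis
  define e' where "e' = Min (insert 1 (e ` I))"
  have e': "0 < e'" "\<And>i. i \<in> I \<Longrightarrow> e' \<le> e i"
    using assms e(1) by (auto simp: e'_def)
  have "kball I x e' \<subseteq> Pi\<^sub>E I V"
    using e(2) e'(2) by (fastforce simp: kball_def PiE_iff extensional_def)
  then show "\<exists>e>0. kball I x e \<subseteq> U"
    using V(3) e'(1) by blast
next
  assume "U \<subseteq> Kspace I \<and> (\<forall>x\<in>U. \<exists>e>0. kball I x e \<subseteq> U)"
  then have U: "U \<subseteq> Kspace I" "\<forall>x\<in>U. \<exists>e>0. kball I x e \<subseteq> U"
    by auto
  show "openin (Ktop I) U"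
    unfolding openin_product_topology_alt
  proof
    fix x assume x: "x \<in> U"
    then obtain e where e: "e > 0" "kball I x e \<subseteq> U"
      using U by blast
    have "x \<in> Pi\<^sub>E I (\<lambda>i. ball (x i) e)"
      using x U(1) e(1) by (auto simp: PiE_iff)
    moreover have "Pi\<^sub>E I (\<lambda>i. ball (x i) e) \<subseteq> kball I x e"
      by (force simp: kball_def PiE_iff extensional_def dist_absval absval_minus_commute)
    ultimately show "\<exists>U'. finite {i \<in> I. U' i \<noteq> topspace euclidean} \<and> (\<forall>i\<in>I. openin euclidean (U' i)) \<and>
        x \<in> Pi\<^sub>E I U' \<and> Pi\<^sub>E I U' \<subseteq> U"
      using assms e(2) by (intro exI[of _ "\<lambda>i. ball (x i) e"]) auto
  qed
qed

lemma openin_kball: "finite I \<Longrightarrow> 0 < e \<Longrightarrow> openin (Ktop I) (kball I x e)"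
  using kball_recenter by (fastforce simp: openin_Ktop_iff kball_subset_Kspace)

lemma compactin_kball:
  fixes x :: "'i \<Rightarrow> 'a::nonarch_local_field"
  shows "compactin (Ktop I) (kball I x e)"
proof -
  have "kball I x e = Pi\<^sub>E I (\<lambda>i. cball (x i) e)"
    by (auto simp: kball_def PiE_iff extensional_def dist_absval absval_minus_commute)
  moreover have "compact (cball a e)" for a :: 'a
  proof -
    have "cball a e = (\<lambda>y. a + y) ` {y. absval y \<le> e}"
    proof (intro equalityI subsetI)
      fix y assume "y \<in> cball a e"
      then have "y = a + (y - a)" "absval (y - a) \<le> e"
        by (simp_all add: dist_absval absval_minus_commute)
      then show "y \<in> (\<lambda>y. a + y) ` {y. absval y \<le> e}"
        by blast
    qed (auto simp: dist_absval)
    moreover have "continuous_on {y. absval y \<le> e} (\<lambda>y. a + y)"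
      by (intro continuous_intros)
    ultimately show ?thesis
      using compact_absval_ball compact_continuous_image by metis
  qed
  ultimately show ?thesis
    by (simp add: compactin_PiE)
qed

lemma compactin_finite_kball_cover:
  fixes C :: "('i \<Rightarrow> 'a::nonarch_local_field) set"
  assumes I: "finite I" and C: "compactin (Ktop I) C" and e: "\<And>x. x \<in> C \<Longrightarrow> 0 < e x"
  obtains T where "finite T" "T \<subseteq> C" "C \<subseteq> (\<Union>x\<in>T. kball I x (e x))"
proof -
  let ?b = "\<lambda>x. kball I x (e x)"
  have "\<exists>\<F>. finite \<F> \<and> \<F> \<subseteq> ?b ` C \<and> C \<subseteq> \<Union>\<F>"
  proof (rule compactinD[OF C])
    show "openin (Ktop I) U" if "U \<in> ?b ` C" for U
      using that e openin_kball[OF I] by blast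
    show "C \<subseteq> \<Union> (?b ` C)"
    proof
      fix x assume x: "x \<in> C"
      then have "x \<in> ?b x"
        using e[OF x] compactin_subset_topspace[OF C] by (intro center_in_kball) auto
      then show "x \<in> \<Union> (?b ` C)"
        using x by (intro UnionI[of "?b x"]) auto
    qed
  qed
  then obtain \<F> where \<F>: "finite \<F>" "\<F> \<subseteq> ?b ` C" "C \<subseteq> \<Union>\<F>"
    by (elim exE conjE)
  obtain T where "T \<subseteq> C" "finite T" "\<F> = ?b ` T"
    using finite_subset_image[OF \<F>(1,2)] by blast
  then show ?thesis
    using that[of T] \<F>(3) by simp
qed

lemma kball_finite_cover:
  fixes x :: "'i \<Rightarrow> 'a::nonarch_local_field"
  assumes "finite I" "0 < e"
  obtains Z where "finite Z" "kball I x R \<subseteq> (\<Union>a\<in>Z. kball I a e)"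
proof -
  obtain Z :: "'a set" where Z: "finite Z" "\<And>x. absval x \<le> R \<Longrightarrow> \<exists>z\<in>Z. absval (x - z) \<le> e"
    using absval_finite_net[OF assms(2), of R] by metis
  show ?thesis
  proof (rule that[of "(\<lambda>z. \<lambda>i\<in>I. x i + z i) ` (I \<rightarrow>\<^sub>E Z)"])
    show "finite ((\<lambda>z. \<lambda>i\<in>I. x i + z i) ` (I \<rightarrow>\<^sub>E Z))"
      using assms(1) Z(1) by (simp add: finite_PiE)
    show "kball I x R \<subseteq> (\<Union>a\<in>(\<lambda>z. \<lambda>i\<in>I. x i + z i) ` (I \<rightarrow>\<^sub>E Z). kball I a e)"
    proof
      fix y assume y: "y \<in> kball I x R"
      then have "\<forall>i\<in>I. \<exists>z\<in>Z. absval (y i - x i - z) \<le> e"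
        using Z(2) by (auto simp: kball_def)
      then obtain z where z: "\<And>i. i \<in> I \<Longrightarrow> z i \<in> Z \<and> absval (y i - x i - z i) \<le> e"
        by metis
      then have "y \<in> kball I (\<lambda>i\<in>I. x i + restrict z I i) e"
        using y by (auto simp: kball_def algebra_simps)
      moreover have "restrict z I \<in> I \<rightarrow>\<^sub>E Z"
        using z by auto
      ultimately show "y \<in> (\<Union>a\<in>(\<lambda>z. \<lambda>i\<in>I. x i + z i) ` (I \<rightarrow>\<^sub>E Z). kball I a e)"
        by blast
    qed
  qed
qed

lemma kball_partition:
  fixes x :: "'i \<Rightarrow> 'a::nonarch_local_field"
  assumes "finite I" "0 < e" "e \<le> R"
  obtains S where "finite S" "S \<subseteq> kball I x R" "disjoint_family_on (\<lambda>a. kball I a e) S"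
    "(\<Union>a\<in>S. kball I a e) = kball I x R"
proof -
  let ?P = "(\<lambda>a. kball I a e) ` kball I x R"
  obtain Z where Z: "finite Z" "kball I x R \<subseteq> (\<Union>a\<in>Z. kball I a e)"
    using kball_finite_cover[OF assms(1,2)] by blast
  have "?P \<subseteq> (\<lambda>a. kball I a e) ` Z"
  proof
    fix B assume "B \<in> ?P"
    then obtain y where y: "y \<in> kball I x R" "B = kball I y e"
      by blast
    then obtain z where "z \<in> Z" "y \<in> kball I z e"
      using Z(2) by blast
    then show "B \<in> (\<lambda>a. kball I a e) ` Z"
      using kball_recenter[of y I z e] y(2) by blast
  qed
  then have "finite ?P"
    using Z(1) finite_surj by blast
  obtain S where S: "S \<subseteq> kball I x R" "inj_on (\<lambda>a. kball I a e) S" "?P = (\<lambda>a. kball I a e) ` S"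
    using subset_image_inj[of ?P "\<lambda>a. kball I a e" "kball I x R"] by auto
  have sub: "kball I a e \<subseteq> kball I x R" if "a \<in> kball I x R" for a
    using kball_mono[OF assms(3), of I a] kball_recenter[OF that] by simp
  show ?thesis
  proof (rule that[OF _ S(1)])
    show "finite S"
      using \<open>finite ?P\<close> S(2,3) finite_image_iff by metis
    show "disjoint_family_on (\<lambda>a. kball I a e) S"
      unfolding disjoint_family_on_def
    proof (intro ballI impI)
      fix a b assume ab: "a \<in> S" "b \<in> S" "a \<noteq> b"
      show "kball I a e \<inter> kball I b e = {}"
      proof (rule ccontr)
        assume "kball I a e \<inter> kball I b e \<noteq> {}"
        then obtain c where "c \<in> kball I a e" "c \<in> kball I b e"
          by auto
        then have "kball I a e = kball I b e"
          using kball_recenter by metis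
        then show False
          using ab S(2) by (auto dest: inj_onD)
      qed
    qed
    have "(\<Union>a\<in>S. kball I a e) = \<Union> ?P"
      by (simp only: S(3))
    also have "\<dots> = kball I x R"
    proof (intro equalityI subsetI)
      fix y assume "y \<in> kball I x R"
      then show "y \<in> \<Union> ?P"
        using center_in_kball[of y I e] assms(2) kball_subset_Kspace[of I x R] by auto
    qed (use sub in blast)
    finally show "(\<Union>a\<in>S. kball I a e) = kball I x R" .
  qed
qed

section \<open>Haar measure and locally constant functions\<close>

lemma measurable_if_preimages_open:
  fixes F :: "'b \<Rightarrow> 'c::topological_space"
  assumes "space N = topspace X" "sets N = borel_sets X"
    and "\<And>S. openin X {x \<in> topspace X. F x \<in> S}"
  shows "F \<in> borel_measurable N"
proof (rule measurableI)
  fix S :: "'c set" assume "S \<in> sets borel"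
  have "F -` S \<inter> space N = {x \<in> topspace X. F x \<in> S}"
    using assms(1) by auto
  then show "F -` S \<inter> space N \<in> sets N"
    using assms(2,3) by (auto simp: borel_sets_def intro!: sigma_sets.Basic)
qed simp

locale haar_space =
  fixes I :: "'i set" and H :: "('i \<Rightarrow> 'a::nonarch_local_field) measure"
  assumes finite_I: "finite I" and normalized: "normalized_haar I H"
begin

lemma space_H: "space H = Kspace I"
  using normalized by (simp add: normalized_haar_def)

lemma sets_H: "sets H = borel_sets (Ktop I)"
  using normalized by (simp add: normalized_haar_def)

lemma openin_sets: "openin (Ktop I) U \<Longrightarrow> U \<in> sets H"
  by (auto simp: sets_H borel_sets_def intro!: sigma_sets.Basic)

lemma kball_sets [measurable]: "0 < e \<Longrightarrow> kball I x e \<in> sets H"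
  by (intro openin_sets openin_kball finite_I)

lemma emeasure_translate:
  "a \<in> Kspace I \<Longrightarrow> A \<in> sets H \<Longrightarrow> emeasure H ((\<lambda>x. \<lambda>i\<in>I. a i + x i) ` A) = emeasure H A"
  using normalized by (simp add: normalized_haar_def)

lemma emeasure_kball_cong:
  assumes "0 < e"
  shows "emeasure H (kball I a e) = emeasure H (kball I b e)"
proof -
  let ?c = "\<lambda>i\<in>I. b i - a i"
  have "(\<lambda>x. \<lambda>i\<in>I. ?c i + x i) ` kball I a e = kball I b e"
  proof (intro equalityI subsetI)
    fix y assume y: "y \<in> kball I b e"
    then have "y = (\<lambda>x. \<lambda>i\<in>I. ?c i + x i) (\<lambda>i\<in>I. y i - ?c i)"
      by (intro PiE_ext[of y I "\<lambda>_. UNIV"]) (auto simp: kball_def)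
    moreover have "(\<lambda>i\<in>I. y i - ?c i) \<in> kball I a e"
      using y by (auto simp: kball_def algebra_simps)
    ultimately show "y \<in> (\<lambda>x. \<lambda>i\<in>I. ?c i + x i) ` kball I a e"
      by blast
  qed (auto simp: kball_def algebra_simps)
  moreover have "?c \<in> Kspace I"
    by simp
  ultimately show ?thesis
    using emeasure_translate[of ?c "kball I a e"] kball_sets[OF assms] by metis
qed

lemma measure_kball_cong: "0 < e \<Longrightarrow> measure H (kball I a e) = measure H (kball I b e)"
  using emeasure_kball_cong[of e a b] by (simp add: measure_def)

lemma emeasure_unit_kball: "emeasure H (kball I a 1) = 1"
proof -
  have "kball I (\<lambda>i\<in>I. 0) 1 = (I \<rightarrow>\<^sub>E (valuation_ring :: 'a set))"
    by (auto simp: kball_def valuation_ring_def PiE_iff extensional_def)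
  then show ?thesis
    using emeasure_kball_cong[of 1 a "\<lambda>i\<in>I. 0"] normalized unfolding normalized_haar_def by simp
qed

text \<open>
  In each coordinate, \<open>q\<^sup>m\<close> translates of the unit ball cover the ball of radius \<open>q\<^sup>m\<close>.
\<close>

lemma emeasure_kball_le:
  "emeasure H (kball I a (residue_card TYPE('a) ^ m)) \<le> ennreal ((residue_card TYPE('a) ^ m) ^ card I)"
proof -
  let ?q = "residue_card TYPE('a)"
  have q: "2 \<le> ?q" by (rule residue_card_ge_2)
  obtain \<pi> :: 'a where \<pi>: "absval \<pi> = 1 / ?q" "\<pi> \<noteq> 0"
    using uniformizer_exists[where 'a='a] by blast
  obtain Z :: "'a set" where Z: "finite Z" "real (card Z) = ?q ^ m"
     "\<And>x. absval x \<le> 1 \<Longrightarrow> \<exists>z\<in>Z. absval (x - z) \<le> 1 / ?q ^ m"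
    using digit_expansions[where 'a='a, of m] by metis
  let ?c = "\<lambda>z. \<lambda>i\<in>I. a i + z i / \<pi> ^ m"
  let ?W = "I \<rightarrow>\<^sub>E Z"
  have fin: "finite ?W"
    using finite_I Z(1) by (simp add: finite_PiE)
  have "kball I a (?q ^ m) \<subseteq> (\<Union>z\<in>?W. kball I (?c z) 1)"
  proof
    fix y assume y: "y \<in> kball I a (?q ^ m)"
    have "\<exists>z\<in>Z. absval ((y i - a i) * \<pi> ^ m - z) \<le> 1 / ?q ^ m" if "i \<in> I" for i
    proof (rule Z(3))
      have "absval (y i - a i) \<le> ?q ^ m"
        using y that by (auto simp: kball_def)
      then show "absval ((y i - a i) * \<pi> ^ m) \<le> 1"
        using q by (simp add: absval_mult absval_power \<pi> power_divide divide_simps)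
    qed
    then obtain z where z: "\<And>i. i \<in> I \<Longrightarrow> z i \<in> Z \<and> absval ((y i - a i) * \<pi> ^ m - z i) \<le> 1 / ?q ^ m"
      by metis
    have "absval (y i - (a i + z i / \<pi> ^ m)) \<le> 1" if "i \<in> I" for i
    proof -
      have "y i - (a i + z i / \<pi> ^ m) = ((y i - a i) * \<pi> ^ m - z i) / \<pi> ^ m"
        using \<pi>(2) by (simp add: field_simps)
      then have "absval (y i - (a i + z i / \<pi> ^ m)) = absval ((y i - a i) * \<pi> ^ m - z i) * ?q ^ m"
        by (simp only: absval_divide absval_power \<pi>) (simp add: power_divide)
      also have "\<dots> \<le> 1 / ?q ^ m * ?q ^ m"
        using z[OF that] q by (intro mult_right_mono) auto
      also have "\<dots> = 1"
        using q by simp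
      finally show ?thesis .
    qed
    then have "y \<in> kball I (?c (restrict z I)) 1"
      using y by (auto simp: kball_def)
    moreover have "restrict z I \<in> ?W"
      using z by auto
    ultimately show "y \<in> (\<Union>z\<in>?W. kball I (?c z) 1)"
      by blast
  qed
  then have "emeasure H (kball I a (?q ^ m)) \<le> emeasure H (\<Union>z\<in>?W. kball I (?c z) 1)"
    using fin by (intro emeasure_mono) auto
  also have "\<dots> \<le> (\<Sum>z\<in>?W. emeasure H (kball I (?c z) 1))"
    using fin by (intro emeasure_subadditive_finite) auto
  also have "\<dots> = of_nat (card ?W)"
    by (simp add: emeasure_unit_kball)
  also have "\<dots> = ennreal (real (card ?W))"
    by (simp add: ennreal_of_nat_eq_real_of_nat)
  also have "real (card ?W) = (?q ^ m) ^ card I"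
    using finite_I Z(2) by (simp add: card_PiE)
  finally show ?thesis .
qed

lemma emeasure_kball_finite: "0 < e \<Longrightarrow> emeasure H (kball I a e) < \<infinity>"
proof -
  assume "0 < e"
  obtain m where "e < residue_card TYPE('a) ^ m"
    using real_arch_pow[of "residue_card TYPE('a)" e] residue_card_ge_2[where 'a='a] by auto
  then have "emeasure H (kball I a e) \<le> emeasure H (kball I a (residue_card TYPE('a) ^ m))"
    using \<open>0 < e\<close> by (intro emeasure_mono kball_mono kball_sets) auto
  also have "\<dots> < \<infinity>"
    using emeasure_kball_le[of a m] by (auto simp: less_top[symmetric] top_unique)
  finally show ?thesis .
qed

lemma fmeasurable_kball: "0 < e \<Longrightarrow> kball I a e \<in> fmeasurable H"
  using emeasure_kball_finite by (auto intro!: fmeasurableI)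

lemma measure_kball_le:
  "measure H (kball I a (residue_card TYPE('a) ^ m)) \<le> (residue_card TYPE('a) ^ m) ^ card I"
  using emeasure_kball_le[of a m] residue_card_ge_2[where 'a='a]
  by (simp add: measure_def enn2real_leI)

lemma locally_constant_measurable:
  assumes "\<And>x. x \<in> Kspace I \<Longrightarrow> \<exists>e>0. \<forall>y\<in>kball I x e. F y = F x"
  shows "F \<in> borel_measurable H"
proof (rule measurable_if_preimages_open[where X = "Ktop I"])
  fix S
  show "openin (Ktop I) {x \<in> topspace (Ktop I). F x \<in> S}"
    unfolding openin_Ktop_iff[OF finite_I]
  proof (intro conjI ballI)
    fix x assume "x \<in> {x \<in> topspace (Ktop I). F x \<in> S}"
    moreover from this obtain e where "e > 0" "\<forall>y\<in>kball I x e. F y = F x"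
      using assms[of x] by auto
    ultimately show "\<exists>e>0. kball I x e \<subseteq> {x \<in> topspace (Ktop I). F x \<in> S}"
      using kball_subset_Kspace[of I x e] by (intro exI[of _ e]) auto
  qed auto
qed (simp_all add: space_H sets_H)

lemma translate_measurable:
  assumes "a \<in> Kspace I"
  shows "(\<lambda>x. \<lambda>i\<in>I. a i + x i) \<in> measurable H H"
  unfolding sets_H borel_sets_def
proof (rule measurable_sigma_sets[where \<Omega> = "Kspace I" and A = "{U. openin (Ktop I) U}"])
  fix U :: "('i \<Rightarrow> 'a) set" assume "U \<in> {U. openin (Ktop I) U}"
  then have U: "openin (Ktop I) U" by simp
  have "openin (Ktop I) ((\<lambda>x. \<lambda>i\<in>I. a i + x i) -` U \<inter> space H)"
    unfolding openin_Ktop_iff[OF finite_I]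
  proof (intro conjI ballI)
    fix x assume x: "x \<in> (\<lambda>x. \<lambda>i\<in>I. a i + x i) -` U \<inter> space H"
    then obtain e where e: "e > 0" "kball I (\<lambda>i\<in>I. a i + x i) e \<subseteq> U"
      using U unfolding openin_Ktop_iff[OF finite_I] by auto
    have "kball I x e \<subseteq> (\<lambda>x. \<lambda>i\<in>I. a i + x i) -` U \<inter> space H"
    proof
      fix y assume y: "y \<in> kball I x e"
      then have "(\<lambda>i\<in>I. a i + y i) \<in> kball I (\<lambda>i\<in>I. a i + x i) e"
        by (auto simp: kball_def)
      then show "y \<in> (\<lambda>x. \<lambda>i\<in>I. a i + x i) -` U \<inter> space H"
        using e(2) y by (auto simp: kball_def space_H)
    qed
    then show "\<exists>e>0. kball I x e \<subseteq> (\<lambda>x. \<lambda>i\<in>I. a i + x i) -` U \<inter> space H"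
      using e(1) by blast
  qed (auto simp: space_H)
  then show "(\<lambda>x. \<lambda>i\<in>I. a i + x i) -` U \<inter> space H \<in> sets H"
    by (rule openin_sets)
next
  show "{U :: ('i \<Rightarrow> 'a) set. openin (Ktop I) U} \<subseteq> Pow (Kspace I)"
    using openin_subset by fastforce
qed (auto simp: sets_H borel_sets_def space_H)

lemma translate_preimage:
  assumes "A \<in> sets H"
  shows "(\<lambda>x. \<lambda>i\<in>I. a i + x i) -` A \<inter> space H = (\<lambda>x. \<lambda>i\<in>I. (\<lambda>i\<in>I. - a i) i + x i) ` A"
proof (intro equalityI subsetI)
  let ?b = "\<lambda>i\<in>I. - a i"
  fix x
  have sub: "A \<subseteq> Kspace I"
    using assms sets.sets_into_space space_H by blast
  {
    assume x: "x \<in> (\<lambda>x. \<lambda>i\<in>I. a i + x i) -` A \<inter> space H"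
    then have "x = (\<lambda>x. \<lambda>i\<in>I. ?b i + x i) (\<lambda>i\<in>I. a i + x i)"
      by (intro PiE_ext[of x I "\<lambda>_. UNIV"]) (auto simp: space_H)
    then show "x \<in> (\<lambda>x. \<lambda>i\<in>I. ?b i + x i) ` A"
      using x by blast
  next
    assume "x \<in> (\<lambda>x. \<lambda>i\<in>I. ?b i + x i) ` A"
    then obtain y where y: "y \<in> A" "x = (\<lambda>i\<in>I. ?b i + y i)"
      by blast
    have "(\<lambda>i\<in>I. a i + x i) = y"
      using y sub by (intro PiE_ext[of _ I "\<lambda>_. UNIV"]) auto
    then show "x \<in> (\<lambda>x. \<lambda>i\<in>I. a i + x i) -` A \<inter> space H"
      using y by (auto simp: space_H)
  }
qed

lemma translate_image_sets:
  assumes "a \<in> Kspace I" "A \<in> sets H"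
  shows "(\<lambda>x. \<lambda>i\<in>I. a i + x i) ` A \<in> sets H"
proof -
  let ?b = "\<lambda>i\<in>I. - a i"
  have "(\<lambda>i\<in>I. - ?b i) = a"
    using assms(1) by (intro PiE_ext[of _ I "\<lambda>_. UNIV"]) auto
  then have "(\<lambda>x. \<lambda>i\<in>I. a i + x i) ` A = (\<lambda>x. \<lambda>i\<in>I. ?b i + x i) -` A \<inter> space H"
    using translate_preimage[OF assms(2), of ?b] by simp
  also have "\<dots> \<in> sets H"
  proof (rule measurable_sets[OF translate_measurable assms(2)])
    show "?b \<in> Kspace I" by simp
  qed
  finally show ?thesis .
qed

lemma distr_translate:
  assumes "a \<in> Kspace I"
  shows "distr H H (\<lambda>x. \<lambda>i\<in>I. a i + x i) = H"
proof (rule measure_eqI)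
  let ?b = "\<lambda>i\<in>I. - a i"
  fix A assume "A \<in> sets (distr H H (\<lambda>x. \<lambda>i\<in>I. a i + x i))"
  then have A: "A \<in> sets H" by simp
  have "?b \<in> Kspace I" by simp
  then show "emeasure (distr H H (\<lambda>x. \<lambda>i\<in>I. a i + x i)) A = emeasure H A"
    unfolding emeasure_distr[OF translate_measurable[OF assms] A] translate_preimage[OF A]
    by (rule emeasure_translate[OF _ A])
qed simp

lemma integral_kball_translate:
  fixes F :: "('i \<Rightarrow> 'a) \<Rightarrow> complex"
  assumes "a \<in> Kspace I" "\<And>i. i \<in> I \<Longrightarrow> absval (a i) \<le> e" "0 < e" "F \<in> borel_measurable H"
  shows "(LINT x:kball I b e|H. F (\<lambda>i\<in>I. a i + x i)) = (LINT x:kball I b e|H. F x)"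
proof -
  let ?B = "kball I b e" and ?t = "\<lambda>x. \<lambda>i\<in>I. a i + x i"
  have iff: "?t x \<in> ?B \<longleftrightarrow> x \<in> ?B" if "x \<in> space H" for x
  proof -
    have "absval (a i + x i - b i) \<le> e \<longleftrightarrow> absval (x i - b i) \<le> e" if "i \<in> I" for i
      using absval_trans_le[of "a i + x i" "x i" e "b i"] absval_trans_le[of "x i" "a i + x i" e "b i"]
        assms(2)[OF that] by (auto simp: absval_minus_commute[of "x i" "a i + x i"])
    then show ?thesis
      using that by (auto simp: kball_def space_H)
  qed
  have "(LINT x:?B|H. F x) = (LINT x|distr H H ?t. indicator ?B x *\<^sub>R F x)"
    by (simp add: distr_translate assms set_lebesgue_integral_def)
  also have "\<dots> = (LINT x|H. indicator ?B (?t x) *\<^sub>R F (?t x))"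
    using assms by (intro integral_distr translate_measurable) auto
  also have "\<dots> = (LINT x:?B|H. F (?t x))"
    unfolding set_lebesgue_integral_def using iff
    by (intro Bochner_Integration.integral_cong) (auto simp: indicator_def)
  finally show ?thesis ..
qed

lemma set_integrable_kball:
  fixes F :: "('i \<Rightarrow> 'a) \<Rightarrow> complex"
  assumes "0 < e" "F \<in> borel_measurable H" "\<And>x. x \<in> kball I b e \<Longrightarrow> norm (F x) \<le> C"
  shows "set_integrable H (kball I b e) F"
  unfolding set_integrable_def
  using assms emeasure_kball_finite[of e b]
  by (intro integrableI_bounded_set_indicator[where B = C]) auto

lemma integral_kball_partition:
  fixes F :: "('i \<Rightarrow> 'a) \<Rightarrow> 'c::{banach, second_countable_topology}"
  assumes S: "finite S" "disjoint_family_on (\<lambda>a. kball I a e) S" and e: "0 < e"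
    and F: "\<And>a x. a \<in> S \<Longrightarrow> x \<in> kball I a e \<Longrightarrow> F x = F a"
  shows "(LINT x:(\<Union>a\<in>S. kball I a e)|H. F x) = (\<Sum>a\<in>S. measure H (kball I a e) *\<^sub>R F a)"
proof -
  have eq: "indicator (kball I a e) x *\<^sub>R F x = indicator (kball I a e) x *\<^sub>R F a" if "a \<in> S" for a x
    using F[OF that] by (auto simp: indicator_def)
  have int: "set_integrable H (kball I a e) F" if "a \<in> S" for a
    unfolding set_integrable_def eq[OF that]
    using e emeasure_kball_finite[OF e, of a] by (intro integrable_indicator_iff[THEN iffD2] integrable_scaleR_left) auto
  have "(LINT x:(\<Union>a\<in>S. kball I a e)|H. F x) = (\<Sum>a\<in>S. LINT x:kball I a e|H. F x)"
    using S e int by (intro set_integral_finite_Union) auto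
  also have "\<dots> = (\<Sum>a\<in>S. measure H (kball I a e) *\<^sub>R F a)"
  proof (rule sum.cong[OF refl])
    fix a assume "a \<in> S"
    then have "(LINT x:kball I a e|H. F x) = (LINT x|H. indicator (kball I a e) x *\<^sub>R F a)"
      unfolding set_lebesgue_integral_def by (intro Bochner_Integration.integral_cong refl eq)
    also have "\<dots> = measure H (kball I a e \<inter> space H) *\<^sub>R F a"
      using e emeasure_kball_finite[OF e, of a] by (subst integral_scaleR_left) (auto intro: integrable_indicator_iff[THEN iffD2])
    also have "kball I a e \<inter> space H = kball I a e"
      by (auto simp: kball_def space_H)
    finally show "(LINT x:kball I a e|H. F x) = measure H (kball I a e) *\<^sub>R F a" .
  qed
  finally show ?thesis .
qed

end

section \<open>Taylor estimates for power series\<close>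

definition taylor_on ::
    "('i \<Rightarrow> 'a) set \<Rightarrow> real \<Rightarrow> real \<Rightarrow> 'i \<Rightarrow> (('i \<Rightarrow> 'a::nonarch_local_field) \<Rightarrow> 'a) \<Rightarrow> (('i \<Rightarrow> 'a) \<Rightarrow> 'a) \<Rightarrow> bool"
  where "taylor_on B r C j g g' \<longleftrightarrow>
    (\<forall>y\<in>B. \<forall>z. absval z \<le> r \<longrightarrow> absval (g (y(j := y j + z)) - g y - g' y * z) \<le> C * absval z ^ 2)"

definition max_lipschitz_on ::
    "'i set \<Rightarrow> ('i \<Rightarrow> 'a) set \<Rightarrow> real \<Rightarrow> (('i \<Rightarrow> 'a::nonarch_local_field) \<Rightarrow> 'a) \<Rightarrow> bool"
  where "max_lipschitz_on J B C g \<longleftrightarrow>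
    (\<forall>y\<in>B. \<forall>y'\<in>B. \<forall>e\<ge>0. (\<forall>i\<in>J. absval (y i - y' i) \<le> e) \<longrightarrow> absval (g y - g y') \<le> C * e)"

lemma kball_update:
  assumes "y \<in> kball J x r" "j \<in> J" "absval z \<le> r"
  shows "y(j := y j + z) \<in> kball J x r"
proof -
  have "y(j := y j + z) \<in> kball J y r"
  proof -
    have "absval ((y(j := y j + z)) i - y i) \<le> r" if "i \<in> J" for i
      using assms(3) order_trans[OF absval_ge_0 assms(3)] by simp
    moreover have "y(j := y j + z) \<in> Kspace J"
      using assms(1,2) kball_subset_Kspace[of J x r] by (auto simp: PiE_iff extensional_def)
    ultimately show ?thesis
      by (simp add: kball_def)
  qed
  then show ?thesis
    using kball_recenter[OF assms(1)] by simp
qed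

lemma taylor_on_partial_deriv:
  fixes g :: "('i \<Rightarrow> 'a::nonarch_local_field) \<Rightarrow> 'a"
  assumes "taylor_on B r C j g g'" "0 < r" "y \<in> B"
  shows "partial_deriv j g y = g' y"
  unfolding partial_deriv_def
proof (rule tendsto_Lim[OF at_zero_neq_bot])
  show "((\<lambda>h. (g (y(j := y j + h)) - g y) / h) \<longlongrightarrow> g' y) (at 0)"
  proof (rule tendstoI)
    fix e :: real assume e: "0 < e"
    define d where "d = min r (e / (\<bar>C\<bar> + 1))"
    have C: "0 < \<bar>C\<bar> + 1" by linarith
    have d: "0 < d" "d \<le> r" "d \<le> e / (\<bar>C\<bar> + 1)"
      using assms(2) e C by (auto simp: d_def)
    then have d': "(\<bar>C\<bar> + 1) * d \<le> e"
      using C by (simp add: pos_le_divide_eq mult.commute)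
    have "dist ((g (y(j := y j + h)) - g y) / h) (g' y) < e" if h: "h \<noteq> 0" "absval h < d" for h
    proof -
      have "absval ((g (y(j := y j + h)) - g y) / h - g' y) = absval (g (y(j := y j + h)) - g y - g' y * h) / absval h"
        using h(1) by (simp add: diff_divide_distrib flip: absval_divide)
      also have "\<dots> \<le> C * absval h ^ 2 / absval h"
        using assms(1,3) h d by (intro divide_right_mono) (auto simp: taylor_on_def)
      also have "\<dots> = C * absval h"
        using h(1) by (simp add: power2_eq_square)
      also have "\<dots> \<le> (\<bar>C\<bar> + 1) * absval h"
        by (intro mult_right_mono) auto
      also have "\<dots> < (\<bar>C\<bar> + 1) * d"
        using h(2) by (intro mult_strict_left_mono) auto
      finally show ?thesis
        using d' by (simp add: dist_absval)
    qed
    then show "\<forall>\<^sub>F h in at 0. dist ((g (y(j := y j + h)) - g y) / h) (g' y) < e"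
      unfolding eventually_at using d(1) by (intro exI[of _ d]) (auto simp: dist_absval)
  qed
qed

text \<open>Two points of a ball are joined inside the ball by changing one coordinate after the other.\<close>

lemma max_lipschitz_on_coordinatewise:
  fixes G :: "('i \<Rightarrow> 'a::nonarch_local_field) \<Rightarrow> 'a"
  assumes "finite J"
    and L: "\<And>j y z. j \<in> J \<Longrightarrow> y \<in> kball J x r \<Longrightarrow> absval z \<le> r \<Longrightarrow>
      absval (G (y(j := y j + z)) - G y) \<le> L * absval z"
    and "0 \<le> L"
  shows "max_lipschitz_on J (kball J x r) L G"
proof -
  have *: "absval (G y - G y') \<le> L * e"
    if "finite F" "F \<subseteq> J" "y \<in> kball J x r" "y' \<in> kball J x r" "0 \<le> e"
      "\<forall>i\<in>J. absval (y i - y' i) \<le> e" "\<forall>i\<in>J - F. y i = y' i" for F y y' e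
    using that
  proof (induction F arbitrary: y rule: finite_induct)
    case empty
    then have "y = y'"
      by (intro PiE_ext[of y J "\<lambda>_. UNIV"]) (auto simp: kball_def)
    then show ?case
      using \<open>0 \<le> L\<close> empty by simp
  next
    case (insert j F)
    let ?z = "y' j - y j"
    let ?y = "y(j := y j + ?z)"
    have j: "j \<in> J" using insert by auto
    have z: "absval ?z \<le> r"
      using insert.prems(2,3) j absval_trans_le[of "y' j" "x j" r "y j"]
      by (auto simp: kball_def absval_minus_commute[of "x j"])
    have "absval (G ?y - G y') \<le> L * e"
    proof (rule insert.IH[of ?y])
      show "?y \<in> kball J x r"
        by (rule kball_update[OF insert.prems(2) j z])
    qed (use insert.prems in auto)
    moreover have "absval (G ?y - G y) \<le> L * e"
    proof -
      have "absval (G ?y - G y) \<le> L * absval ?z"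
        using insert.prems z j by (intro L)
      also have "\<dots> \<le> L * e"
        using insert.prems j \<open>0 \<le> L\<close> by (intro mult_left_mono) (auto simp: absval_minus_commute)
      finally show ?thesis .
    qed
    ultimately show ?case
      using absval_trans_le[of "G y" "G ?y" "L * e" "G y'"] absval_minus_commute[of "G y" "G ?y"] by simp
  qed
  show ?thesis
    unfolding max_lipschitz_on_def using *[OF assms(1)] by blast
qed

text \<open>
  The induction rests on the remainder of order \<open>m + 1\<close> being \<open>w + z\<close> times that of order \<open>m\<close>
  plus \<open>m w\<^bsup>m-1\<^esup> z\<^sup>2\<close>; the integer factors have norm at most 1.
\<close>

lemma power_taylor_le:
  fixes w z :: "'a::nonarch_local_field"
  assumes "absval w \<le> r" "absval z \<le> r"
  shows "absval ((w + z) ^ m - w ^ m - of_nat m * w ^ (m - 1) * z) * r ^ 2 \<le> absval z ^ 2 * r ^ m"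
proof (induction m)
  case (Suc m)
  let ?D = "(w + z) ^ m - w ^ m - of_nat m * w ^ (m - 1) * z"
  have r: "0 \<le> r"
    using assms absval_ge_0 order_trans by blast
  have eq: "(w + z) ^ Suc m - w ^ Suc m - of_nat (Suc m) * w ^ (Suc m - 1) * z
      = (w + z) * ?D + of_nat m * w ^ (m - 1) * z ^ 2"
    by (cases m) (simp_all add: algebra_simps power2_eq_square)
  have "absval ((w + z) * ?D) * r ^ 2 = absval (w + z) * (absval ?D * r ^ 2)"
    by (simp add: absval_mult)
  also have "\<dots> \<le> r * (absval z ^ 2 * r ^ m)"
    by (rule mult_mono[OF absval_add_le[OF assms] Suc]) (use r in auto)
  finally have 1: "absval ((w + z) * ?D) * r ^ 2 \<le> absval z ^ 2 * r ^ Suc m"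
    by (simp add: mult_ac)
  have 2: "absval (of_nat m * w ^ (m - 1) * z ^ 2) * r ^ 2 \<le> absval z ^ 2 * r ^ Suc m"
  proof (cases m)
    case (Suc l)
    have "absval (of_nat m * w ^ (m - 1) * z ^ 2) * r ^ 2
        = absval (of_nat m :: 'a) * (absval w ^ l * (absval z ^ 2 * r ^ 2))"
      using Suc by (simp add: absval_mult absval_power mult_ac del: of_nat_Suc)
    also have "\<dots> \<le> 1 * (r ^ l * (absval z ^ 2 * r ^ 2))"
      using assms r by (intro mult_mono absval_of_nat_le_1 power_mono) auto
    finally show ?thesis
      using Suc by (simp add: power2_eq_square mult_ac)
  qed (use r in auto)
  have "absval ((w + z) * ?D + of_nat m * w ^ (m - 1) * z ^ 2) * r ^ 2
      \<le> max (absval ((w + z) * ?D)) (absval (of_nat m * w ^ (m - 1) * z ^ 2)) * r ^ 2"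
    by (intro mult_right_mono absval_add_le_max) auto
  also have "\<dots> \<le> absval z ^ 2 * r ^ Suc m"
    using 1 2 by (simp add: max_def)
  finally show ?case
    unfolding eq .
qed simp

text \<open>
  Series are indexed by an arbitrary set \<open>S\<close> with exponents \<open>e s\<close>: differentiation then keeps the
  index set and changes coefficients and exponents only.
\<close>

definition polydisc :: "'i set \<Rightarrow> ('i \<Rightarrow> 'a::nonarch_local_field) \<Rightarrow> ('i \<Rightarrow> 'a) \<Rightarrow> ('i \<Rightarrow> 'a) set" where
  "polydisc J a \<rho> = {y. \<forall>i\<in>J. absval (y i - a i) \<le> absval (\<rho> i)}"

definition series ::
    "'i set \<Rightarrow> ('i \<Rightarrow> 'a::nonarch_local_field) \<Rightarrow> 's set \<Rightarrow> ('s \<Rightarrow> 'a) \<Rightarrow> ('s \<Rightarrow> 'i \<Rightarrow> nat) \<Rightarrow> ('i \<Rightarrow> 'a) \<Rightarrow> 'a"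
  where "series J a S c e y = infsum (\<lambda>s. c s * (\<Prod>i\<in>J. (y i - a i) ^ e s i)) S"

definition converges_at_radii ::
    "'i set \<Rightarrow> ('i \<Rightarrow> 'a::nonarch_local_field) \<Rightarrow> 's set \<Rightarrow> ('s \<Rightarrow> 'a) \<Rightarrow> ('s \<Rightarrow> 'i \<Rightarrow> nat) \<Rightarrow> bool"
  where "converges_at_radii J \<rho> S c e \<longleftrightarrow> null_family (\<lambda>s. c s * (\<Prod>i\<in>J. \<rho> i ^ e s i)) S"

lemma monomial_le:
  assumes "y \<in> polydisc J a \<rho>"
  shows "absval (\<Prod>i\<in>J. (y i - a i) ^ f i) \<le> absval (\<Prod>i\<in>J. \<rho> i ^ f i :: 'a::nonarch_local_field)"
  unfolding absval_prod absval_power using assms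
  by (intro prod_mono) (auto simp: polydisc_def intro: power_mono)

lemma series_has_sum:
  assumes "converges_at_radii J \<rho> S c e" "y \<in> polydisc J a \<rho>"
  shows "((\<lambda>s. c s * (\<Prod>i\<in>J. (y i - a i) ^ e s i)) has_sum series J a S c e y) S"
  unfolding series_def
proof (rule null_family_has_sum, rule null_family_mono)
  show "null_family (\<lambda>s. c s * (\<Prod>i\<in>J. \<rho> i ^ e s i)) S"
    using assms by (simp add: converges_at_radii_def)
  show "absval (c s * (\<Prod>i\<in>J. (y i - a i) ^ e s i)) \<le> 1 * absval (c s * (\<Prod>i\<in>J. \<rho> i ^ e s i))" for s
    using monomial_le[OF assms(2)] by (simp add: absval_mult mult_left_mono)
qed simp

lemma converges_at_radii_bounded:
  assumes "converges_at_radii J \<rho> S c e"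
  obtains C where "0 < C" "\<And>s. s \<in> S \<Longrightarrow> absval (c s * (\<Prod>i\<in>J. \<rho> i ^ e s i)) \<le> C"
proof -
  let ?t = "\<lambda>s. absval (c s * (\<Prod>i\<in>J. \<rho> i ^ e s i))"
  let ?F = "{s\<in>S. 1 \<le> ?t s}"
  have F: "finite ?F"
    using assms by (simp add: converges_at_radii_def null_family_def)
  show ?thesis
  proof (rule that[of "Max (insert 1 (?t ` ?F))"])
    show "?t s \<le> Max (insert 1 (?t ` ?F))" if "s \<in> S" for s
    proof (cases "1 \<le> ?t s")
      case True
      then show ?thesis using F that by (intro Max_ge) auto
    next
      case False
      then have "?t s \<le> 1" by simp
      also have "1 \<le> Max (insert 1 (?t ` ?F))"
        using F by (intro Max_ge) auto
      finally show ?thesis .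
    qed
    have "1 \<le> Max (insert 1 (?t ` ?F))"
      using F by (intro Max_ge) auto
    then show "0 < Max (insert 1 (?t ` ?F))" by simp
  qed
qed

lemma series_bounded:
  assumes "converges_at_radii J \<rho> S c e"
  obtains C where "0 < C" "\<And>y. y \<in> polydisc J a \<rho> \<Longrightarrow> absval (series J a S c e y) \<le> C"
proof -
  obtain C where C: "0 < C" "\<And>s. s \<in> S \<Longrightarrow> absval (c s * (\<Prod>i\<in>J. \<rho> i ^ e s i)) \<le> C"
    using converges_at_radii_bounded[OF assms] by blast
  show ?thesis
  proof (rule that[OF C(1)])
    fix y assume y: "y \<in> polydisc J a \<rho>"
    show "absval (series J a S c e y) \<le> C"
    proof (rule has_sum_absval_le[OF series_has_sum[OF assms y]])
      fix s assume "s \<in> S"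
      have "absval (c s * (\<Prod>i\<in>J. (y i - a i) ^ e s i)) \<le> absval (c s * (\<Prod>i\<in>J. \<rho> i ^ e s i))"
        using monomial_le[OF y] by (simp add: absval_mult mult_left_mono)
      then show "absval (c s * (\<Prod>i\<in>J. (y i - a i) ^ e s i)) \<le> C"
        using C(2)[OF \<open>s \<in> S\<close>] by linarith
    qed (use C in simp)
  qed
qed

lemma monomial_split:
  assumes "finite J" "j \<in> J"
  shows "(\<Prod>i\<in>J. (y i) ^ f i) = y j ^ f j * (\<Prod>i\<in>J - {j}. (y i :: 'a::nonarch_local_field) ^ f i)"
  using assms by (simp add: prod.remove)

abbreviation "deriv_coeff j c e \<equiv> (\<lambda>s. of_nat (e s j) * c s)"
abbreviation "deriv_exp j e \<equiv> (\<lambda>s. (e s)(j := e s j - 1))"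

lemma converges_at_radii_deriv:
  fixes \<rho> :: "'i \<Rightarrow> 'a::nonarch_local_field"
  assumes "converges_at_radii J \<rho> S c e" "finite J" "j \<in> J" "\<rho> j \<noteq> 0"
  shows "converges_at_radii J \<rho> S (deriv_coeff j c e) (deriv_exp j e)"
  unfolding converges_at_radii_def
proof (rule null_family_mono)
  show "null_family (\<lambda>s. c s * (\<Prod>i\<in>J. \<rho> i ^ e s i)) S"
    using assms by (simp add: converges_at_radii_def)
  show "0 < 1 / absval (\<rho> j)"
    using assms by simp
  fix s
  let ?R = "\<Prod>i\<in>J - {j}. \<rho> i ^ e s i"
  have split: "(\<Prod>i\<in>J. \<rho> i ^ deriv_exp j e s i) = \<rho> j ^ (e s j - 1) * ?R"
    by (subst monomial_split[OF assms(2,3)]) (auto intro!: prod.cong)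
  show "absval (deriv_coeff j c e s * (\<Prod>i\<in>J. \<rho> i ^ deriv_exp j e s i))
      \<le> 1 / absval (\<rho> j) * absval (c s * (\<Prod>i\<in>J. \<rho> i ^ e s i))"
  proof (cases "e s j")
    case (Suc m)
    have "absval (deriv_coeff j c e s * (\<Prod>i\<in>J. \<rho> i ^ deriv_exp j e s i))
        = absval (of_nat (e s j) :: 'a) * (absval (c s) * absval (\<rho> j) ^ m * absval ?R)"
      unfolding split using Suc by (simp add: absval_mult absval_power mult_ac del: of_nat_Suc)
    also have "\<dots> \<le> 1 * (absval (c s) * absval (\<rho> j) ^ m * absval ?R)"
      by (intro mult_right_mono absval_of_nat_le_1) auto
    also have "\<dots> = 1 / absval (\<rho> j) * absval (c s * (\<Prod>i\<in>J. \<rho> i ^ e s i))"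
      unfolding monomial_split[OF assms(2,3), of \<rho>] using Suc assms(4)
      by (simp add: absval_mult absval_power)
    finally show ?thesis .
  qed simp
qed

text \<open>
  The estimate is that of each monomial, because an ultrametric sum is no larger than its largest
  term; the constant is a bound for the terms at the radii, divided by \<open>\<bar>\<rho> j\<bar>\<^sup>2\<close>.
\<close>

lemma series_taylor:
  fixes \<rho> :: "'i \<Rightarrow> 'a::nonarch_local_field"
  assumes conv: "converges_at_radii J \<rho> S c e" and J: "finite J" "j \<in> J" and \<rho>: "\<rho> j \<noteq> 0"
  obtains C where "0 \<le> C" "taylor_on (polydisc J a \<rho>) (absval (\<rho> j)) C j
    (series J a S c e) (series J a S (deriv_coeff j c e) (deriv_exp j e))"
proof -
  obtain B where B: "0 < B" "\<And>s. s \<in> S \<Longrightarrow> absval (c s * (\<Prod>i\<in>J. \<rho> i ^ e s i)) \<le> B"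
    using converges_at_radii_bounded[OF conv] by blast
  let ?r = "absval (\<rho> j)"
  have r: "0 < ?r" using \<rho> by simp
  show ?thesis
  proof (rule that[of "B / ?r ^ 2"])
    show "0 \<le> B / ?r ^ 2" using B by simp
    show "taylor_on (polydisc J a \<rho>) ?r (B / ?r ^ 2) j
      (series J a S c e) (series J a S (deriv_coeff j c e) (deriv_exp j e))"
      unfolding taylor_on_def
    proof (intro ballI allI impI)
      fix y :: "'i \<Rightarrow> 'a" and z :: 'a assume y: "y \<in> polydisc J a \<rho>" and z: "absval z \<le> ?r"
      let ?y = "y(j := y j + z)"
      have y': "?y \<in> polydisc J a \<rho>"
        using y z absval_add_le[of "y j - a j" ?r z]
        by (auto simp: polydisc_def algebra_simps)
      let ?m = "\<lambda>c e y s. c s * (\<Prod>i\<in>J. (y i - a i) ^ e s i)"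
      have sum: "((\<lambda>s. ?m c e ?y s - ?m c e y s - z * ?m (deriv_coeff j c e) (deriv_exp j e) y s) has_sum
          (series J a S c e ?y - series J a S c e y - z * series J a S (deriv_coeff j c e) (deriv_exp j e) y)) S"
        by (intro has_sum_diff_absval has_sum_cmult_absval series_has_sum[of _ \<rho>] conv y y'
            converges_at_radii_deriv assms)
      have "absval (series J a S c e ?y - series J a S c e y - z * series J a S (deriv_coeff j c e) (deriv_exp j e) y)
         \<le> B / ?r ^ 2 * absval z ^ 2"
      proof (rule has_sum_absval_le[OF sum])
        show "0 \<le> B / ?r ^ 2 * absval z ^ 2" using B by simp
        fix s assume s: "s \<in> S"
        let ?w = "y j - a j" and ?k = "e s j"
        let ?P = "\<Prod>i\<in>J - {j}. (y i - a i) ^ e s i"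
        let ?R = "\<Prod>i\<in>J - {j}. \<rho> i ^ e s i"
        let ?D = "(?w + z) ^ ?k - ?w ^ ?k - of_nat ?k * ?w ^ (?k - 1) * z"
        have 1: "(\<Prod>i\<in>J. (?y i - a i) ^ e s i) = (?w + z) ^ ?k * ?P"
          by (subst monomial_split[OF J, of "\<lambda>i. ?y i - a i"]) (auto intro!: prod.cong simp: algebra_simps)
        have 2: "(\<Prod>i\<in>J. (y i - a i) ^ e s i) = ?w ^ ?k * ?P"
          by (rule monomial_split[OF J, of "\<lambda>i. y i - a i"])
        have 3: "(\<Prod>i\<in>J. (y i - a i) ^ deriv_exp j e s i) = ?w ^ (?k - 1) * ?P"
          by (subst monomial_split[OF J, of "\<lambda>i. y i - a i"]) (auto intro!: prod.cong)
        have eq: "?m c e ?y s - ?m c e y s - z * ?m (deriv_coeff j c e) (deriv_exp j e) y s = c s * ?P * ?D"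
          unfolding 1 2 3 by (simp add: algebra_simps)
        have P: "absval ?P \<le> absval ?R"
          using y by (intro monomial_le) (auto simp: polydisc_def)
        have D: "absval ?D * ?r ^ 2 \<le> absval z ^ 2 * ?r ^ ?k"
          using y z J by (intro power_taylor_le) (auto simp: polydisc_def)
        have "absval (c s * ?P * ?D) * ?r ^ 2 = absval (c s) * (absval ?P * (absval ?D * ?r ^ 2))"
          by (simp add: absval_mult)
        also have "\<dots> \<le> absval (c s) * (absval ?R * (absval z ^ 2 * ?r ^ ?k))"
          by (rule mult_left_mono[OF mult_mono[OF P D]]) auto
        also have "\<dots> = absval (c s * (\<Prod>i\<in>J. \<rho> i ^ e s i)) * absval z ^ 2"
          unfolding monomial_split[OF J, of \<rho>] by (simp add: absval_mult absval_power)
        also have "\<dots> \<le> B * absval z ^ 2"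
          using B(2)[OF s] by (intro mult_right_mono) auto
        finally show "absval (?m c e ?y s - ?m c e y s - z * ?m (deriv_coeff j c e) (deriv_exp j e) y s)
            \<le> B / ?r ^ 2 * absval z ^ 2"
          unfolding eq using r by (simp add: field_simps)
      qed
      then show "absval (series J a S c e ?y - series J a S c e y
          - series J a S (deriv_coeff j c e) (deriv_exp j e) y * z) \<le> B / ?r ^ 2 * absval z ^ 2"
        by (simp add: mult.commute)
    qed
  qed
qed

text \<open>
  The domain of a power series need not be a polydisc around its centre \<open>a\<close>, and the point
  \<open>x\<close> may be far from \<open>a\<close>.  But the series converges at a point near \<open>x\<close> no coordinate of which
  agrees with that of \<open>a\<close> or is closer to it than that of \<open>x\<close>, hence on a polydisc
  around \<open>a\<close> of nonzero radii that contains \<open>x\<close>, and the same series serves near \<open>x\<close>.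
\<close>

lemma K_analytic_on_derivatives:
  fixes g :: "('i \<Rightarrow> 'a::nonarch_local_field) \<Rightarrow> 'a"
  assumes J: "finite J" and g: "K_analytic_on J X g" and x: "x \<in> X"
  obtains r where "0 < r" "kball J x r \<subseteq> X"
    "\<And>js. set js \<subseteq> J \<Longrightarrow> \<exists>C\<ge>0. max_lipschitz_on J (kball J x r) C (fold partial_deriv js g) \<and>
      (\<forall>j\<in>J. taylor_on (kball J x r) r C j (fold partial_deriv js g) (fold partial_deriv (js @ [j]) g))"
proof -
  obtain \<U> where \<U>: "X = \<Union>\<U>" "\<And>U. U \<in> \<U> \<Longrightarrow> openin (Ktop J) U \<and>
         (\<exists>a\<in>U. \<exists>c :: ('i \<Rightarrow> nat) \<Rightarrow> 'a. \<forall>x\<in>U.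
            ((\<lambda>\<alpha>. c \<alpha> * (\<Prod>i\<in>J. (x i - a i) ^ \<alpha> i)) has_sum g x) (J \<rightarrow>\<^sub>E UNIV))"
    using g unfolding K_analytic_on_def by blast
  then obtain U where U: "x \<in> U" "U \<in> \<U>"
    using x by blast
  obtain a c where a: "a \<in> U"
    and c: "\<And>x. x \<in> U \<Longrightarrow> ((\<lambda>\<alpha>. c \<alpha> * (\<Prod>i\<in>J. (x i - a i) ^ \<alpha> i)) has_sum g x) (J \<rightarrow>\<^sub>E UNIV)"
    using \<U>(2)[OF U(2)] by blast
  obtain r0 where r0: "0 < r0" "kball J x r0 \<subseteq> U"
    using \<U>(2)[OF U(2)] U(1) unfolding openin_Ktop_iff[OF J] by blast
  have xJ: "x \<in> Kspace J"
    using \<U>(2)[OF U(2)] U(1) unfolding openin_Ktop_iff[OF J] by blast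
  obtain t :: 'a where t: "t \<noteq> 0" "absval t \<le> r0"
    using absval_scale[where 'a='a, OF r0(1)] by metis
  \<comment> \<open>Moving by \<open>t\<close> the coordinates in which \<open>x\<close> agrees with \<open>a\<close> makes all radii \<open>\<rho>\<close> nonzero.\<close>
  define x' where "x' = (\<lambda>i\<in>J. if x i = a i then a i + t else x i)"
  define \<rho> where "\<rho> i = x' i - a i" for i
  have "x' \<in> kball J x r0"
    using t r0(1) by (auto simp: x'_def kball_def)
  then have "((\<lambda>\<alpha>. c \<alpha> * (\<Prod>i\<in>J. (x' i - a i) ^ \<alpha> i)) has_sum g x') (J \<rightarrow>\<^sub>E UNIV)"
    using c r0(2) by blast
  then have conv: "converges_at_radii J \<rho> (J \<rightarrow>\<^sub>E UNIV) c (\<lambda>s. s)"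
    using has_sum_imp_null_family unfolding converges_at_radii_def \<rho>_def by blast
  have \<rho>: "\<rho> i \<noteq> 0" "absval (x i - a i) \<le> absval (\<rho> i)" if "i \<in> J" for i
    using t that by (auto simp: \<rho>_def x'_def)
  define r where "r = Min (insert r0 ((\<lambda>i. absval (\<rho> i)) ` J))"
  have r: "0 < r" "r \<le> r0" "\<And>i. i \<in> J \<Longrightarrow> r \<le> absval (\<rho> i)"
    using J r0(1) \<rho>(1) by (auto simp: r_def)
  let ?B = "kball J x r"
  have BU: "?B \<subseteq> U"
    using kball_mono[OF r(2)] r0(2) by blast
  have BP: "?B \<subseteq> polydisc J a \<rho>"
  proof
    fix y assume y: "y \<in> ?B"
    have "absval (y i - a i) \<le> absval (\<rho> i)" if "i \<in> J" for i
    proof (rule absval_trans_le[OF _ \<rho>(2)[OF that]])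
      have "absval (y i - x i) \<le> r"
        using y that by (simp add: kball_def)
      then show "absval (y i - x i) \<le> absval (\<rho> i)"
        using r(3)[OF that] by linarith
    qed
    then show "y \<in> polydisc J a \<rho>"
      by (simp add: polydisc_def)
  qed
  let ?S = "J \<rightarrow>\<^sub>E (UNIV :: nat set)"
  let ?g = "\<lambda>js. fold partial_deriv js g"
  have taylor: "\<exists>C\<ge>0. taylor_on ?B r C j h (series J a ?S (deriv_coeff j c e) (deriv_exp j e))"
    if h: "converges_at_radii J \<rho> ?S c e" "\<forall>y\<in>?B. h y = series J a ?S c e y" "j \<in> J" for c e h j
  proof -
    obtain C where C: "0 \<le> C" "taylor_on (polydisc J a \<rho>) (absval (\<rho> j)) C j
      (series J a ?S c e) (series J a ?S (deriv_coeff j c e) (deriv_exp j e))"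
      using series_taylor[OF h(1) J h(3) \<rho>(1)[OF h(3)]] by blast
    have "taylor_on ?B r C j h (series J a ?S (deriv_coeff j c e) (deriv_exp j e))"
      unfolding taylor_on_def
    proof (intro ballI allI impI)
      fix y :: "'i \<Rightarrow> 'a" and z :: 'a assume yz: "y \<in> ?B" "absval z \<le> r"
      show "absval (h (y(j := y j + z)) - h y - series J a ?S (deriv_coeff j c e) (deriv_exp j e) y * z)
          \<le> C * absval z ^ 2"
        using C(2) h(2) yz BP r(3)[OF h(3)] kball_update[OF yz(1) h(3) yz(2)]
        by (auto simp: taylor_on_def)
    qed
    then show ?thesis using C(1) by blast
  qed
  have rep: "\<exists>c e. converges_at_radii J \<rho> ?S c e \<and> (\<forall>y\<in>?B. ?g js y = series J a ?S c e y)"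
    if "set js \<subseteq> J" for js
    using that
  proof (induction js rule: rev_induct)
    case Nil
    have "g y = series J a ?S c (\<lambda>s. s) y" if "y \<in> ?B" for y
      using has_sum_unique[OF c series_has_sum[OF conv]] that BU BP by blast
    then show ?case
      using conv by auto
  next
    case (snoc j js)
    then obtain c e where ce: "converges_at_radii J \<rho> ?S c e" "\<forall>y\<in>?B. ?g js y = series J a ?S c e y"
      by auto
    have j: "j \<in> J" using snoc by simp
    obtain C where "taylor_on ?B r C j (?g js) (series J a ?S (deriv_coeff j c e) (deriv_exp j e))"
      using taylor[OF ce j] by blast
    then have "?g (js @ [j]) y = series J a ?S (deriv_coeff j c e) (deriv_exp j e) y" if "y \<in> ?B" for y
      using taylor_on_partial_deriv r(1) that by fastforce
    then show ?case
      using converges_at_radii_deriv[OF ce(1) J j \<rho>(1)[OF j]] by blast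
  qed
  have taylor': "\<exists>C\<ge>0. taylor_on ?B r C j (?g js) (?g (js @ [j]))" if js: "set js \<subseteq> J" and j: "j \<in> J" for js j
  proof -
    obtain c e where ce: "converges_at_radii J \<rho> ?S c e" "\<forall>y\<in>?B. ?g js y = series J a ?S c e y"
      using rep[OF js] by blast
    obtain C where C: "C \<ge> 0" "taylor_on ?B r C j (?g js) (series J a ?S (deriv_coeff j c e) (deriv_exp j e))"
      using taylor[OF ce j] by blast
    then have "?g (js @ [j]) y = series J a ?S (deriv_coeff j c e) (deriv_exp j e) y" if "y \<in> ?B" for y
      using taylor_on_partial_deriv r(1) that by fastforce
    then show ?thesis
      using C unfolding taylor_on_def by (intro exI[of _ C]) auto
  qed
  have bounded: "\<exists>C\<ge>0. \<forall>y\<in>?B. absval (?g js y) \<le> C" if js: "set js \<subseteq> J" for js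
  proof -
    obtain c e where ce: "converges_at_radii J \<rho> ?S c e" "\<forall>y\<in>?B. ?g js y = series J a ?S c e y"
      using rep[OF js] by blast
    obtain C where "0 < C" "\<And>y. y \<in> polydisc J a \<rho> \<Longrightarrow> absval (series J a ?S c e y) \<le> C"
      using series_bounded[OF ce(1)] by blast
    then show ?thesis
      using BP ce(2) by (intro exI[of _ C]) auto
  qed
  have "\<exists>C\<ge>0. max_lipschitz_on J ?B C (?g js) \<and> (\<forall>j\<in>J. taylor_on ?B r C j (?g js) (?g (js @ [j])))"
    if js: "set js \<subseteq> J" for js
  proof -
    obtain C where C: "\<And>j. j \<in> J \<Longrightarrow> 0 \<le> C j \<and> taylor_on ?B r (C j) j (?g js) (?g (js @ [j]))"
      using taylor'[OF js] by metis
    obtain D where D: "\<And>j. j \<in> J \<Longrightarrow> 0 \<le> D j \<and> (\<forall>y\<in>?B. absval (?g (js @ [j]) y) \<le> D j)"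
    proof -
      have "\<exists>C. j \<in> J \<longrightarrow> 0 \<le> C \<and> (\<forall>y\<in>?B. absval (?g (js @ [j]) y) \<le> C)" for j
        using bounded[of "js @ [j]"] js by auto
      then show ?thesis using that by metis
    qed
    define L where "L = (\<Sum>j\<in>J. C j + D j + C j * r)"
    have L0: "0 \<le> L"
      using C D r(1) by (auto simp: L_def intro!: sum_nonneg)
    have L: "C j + D j + C j * r \<le> L" if "j \<in> J" for j
      unfolding L_def using C D r(1) J that
      by (intro member_le_sum) auto
    have CL: "C j \<le> L" "D j \<le> L" "C j * r \<le> L" if "j \<in> J" for j
      using L[OF that] C[OF that] D[OF that] r(1) mult_nonneg_nonneg[of "C j" r] by linarith+
    have "max_lipschitz_on J ?B L (?g js)"
    proof (rule max_lipschitz_on_coordinatewise[OF J _ L0])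
      fix j and y :: "'i \<Rightarrow> 'a" and z :: 'a assume j: "j \<in> J" and y: "y \<in> ?B" and z: "absval z \<le> r"
      let ?d = "?g js (y(j := y j + z)) - ?g js y"
      have "absval (?d - ?g (js @ [j]) y * z) \<le> C j * absval z ^ 2"
        using C[OF j] y z unfolding taylor_on_def by blast
      also have "\<dots> = C j * absval z * absval z"
        by (simp add: power2_eq_square)
      also have "\<dots> \<le> C j * r * absval z"
        using C[OF j] z by (intro mult_right_mono mult_left_mono) auto
      also have "\<dots> \<le> L * absval z"
        using CL[OF j] by (intro mult_right_mono) auto
      finally have 1: "absval (?d - ?g (js @ [j]) y * z) \<le> L * absval z" .
      have 2: "absval (?g (js @ [j]) y * z) \<le> L * absval z"
        unfolding absval_mult using D[OF j] y CL(2)[OF j] by (intro mult_right_mono) force+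
      show "absval ?d \<le> L * absval z"
        using absval_add_le[OF 1 2] by simp
    qed
    moreover have "taylor_on ?B r L j (?g js) (?g (js @ [j]))" if "j \<in> J" for j
      unfolding taylor_on_def
    proof (intro ballI allI impI)
      fix y :: "'i \<Rightarrow> 'a" and z :: 'a assume "y \<in> ?B" "absval z \<le> r"
      then have "absval (?g js (y(j := y j + z)) - ?g js y - ?g (js @ [j]) y * z) \<le> C j * absval z ^ 2"
        using C[OF that] unfolding taylor_on_def by blast
      also have "\<dots> \<le> L * absval z ^ 2"
        using CL(1)[OF that] by (intro mult_right_mono) auto
      finally show "absval (?g js (y(j := y j + z)) - ?g js y - ?g (js @ [j]) y * z) \<le> L * absval z ^ 2" .
    qed
    ultimately show ?thesis
      using L0 by blast
  qed
  moreover have "?B \<subseteq> X"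
    using BU U(2) \<U>(1) by blast
  ultimately show ?thesis
    using that[of r] r(1) by blast
qed

section \<open>Sublevel sets\<close>

text \<open>
  The function \<open>g\<close> has, in the directions \<open>js\<close> and up to a remainder of second order each time,
  successive derivatives, the last of which is bounded below on \<open>B\<close>.
\<close>

fun deriv_chain ::
    "'i set \<Rightarrow> ('i \<Rightarrow> 'a) set \<Rightarrow> real \<Rightarrow> real \<Rightarrow> real \<Rightarrow> 'i list \<Rightarrow>
     (('i \<Rightarrow> 'a::nonarch_local_field) \<Rightarrow> 'a) \<Rightarrow> bool" where
  "deriv_chain J B r C c [] g \<longleftrightarrow> max_lipschitz_on J B C g \<and> (\<forall>y\<in>B. c \<le> absval (g y))"
| "deriv_chain J B r C c (j # js) g \<longleftrightarrow>
     j \<in> J \<and> max_lipschitz_on J B C g \<and> (\<exists>g'. taylor_on B r C j g g' \<and> deriv_chain J B r C c js g')"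

lemma deriv_chain_lipschitz: "deriv_chain J B r C c js g \<Longrightarrow> max_lipschitz_on J B C g"
  by (cases js) auto

text \<open>Moving one coordinate is one of the translations under which Haar measure is invariant.\<close>

lemma translate_single:
  assumes "y \<in> Kspace I" "j \<in> I"
  shows "(\<lambda>i\<in>I. (\<lambda>i\<in>I. if i = j then z else 0) i + y i) = y(j := y j + (z :: 'a::nonarch_local_field))"
  by (rule PiE_ext[where k = I and s = "\<lambda>_. UNIV"])
    (use assms in \<open>auto simp: PiE_iff extensional_def\<close>)

context haar_space
begin

lemma sublevel_sets:
  assumes "max_lipschitz_on I (kball I x r) C g" "0 < r" "0 < \<epsilon>" "0 \<le> C"
  shows "{y \<in> kball I x r. absval (g y) \<le> \<epsilon>} \<in> sets H"
proof (rule openin_sets, unfold openin_Ktop_iff[OF finite_I], intro conjI ballI)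
  fix y assume y: "y \<in> {y \<in> kball I x r. absval (g y) \<le> \<epsilon>}"
  define e where "e = min r (\<epsilon> / (C + 1))"
  have e: "0 < e" "e \<le> r" "e \<le> \<epsilon> / (C + 1)"
    using assms by (auto simp: e_def)
  have "C * e \<le> (C + 1) * e"
    using e(1) by (intro mult_right_mono) auto
  also have "\<dots> \<le> \<epsilon>"
    using e(3) assms by (simp add: pos_le_divide_eq mult.commute)
  finally have Ce: "C * e \<le> \<epsilon>" .
  have sub: "kball I y e \<subseteq> kball I x r"
    using kball_mono[OF e(2), of I y] kball_recenter[of y I x r] y by simp
  have "absval (g z) \<le> \<epsilon>" if "z \<in> kball I y e" for z
  proof -
    have "absval (g z - g y) \<le> C * e"
      using assms(1) sub that y e(1) unfolding max_lipschitz_on_def by (auto simp: kball_def)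
    then have "absval (g z - g y) \<le> \<epsilon>"
      using Ce by linarith
    then show ?thesis
      using absval_add_le[of "g z - g y" \<epsilon> "g y"] y by simp
  qed
  then show "\<exists>e>0. kball I y e \<subseteq> {y \<in> kball I x r. absval (g y) \<le> \<epsilon>}"
    using e(1) sub by blast
qed (auto simp: kball_def)

text \<open>
  A set that contains no two points whose difference is a multiple of the basis vector \<open>j\<close> of
  length between \<open>\<sigma>\<close> and \<open>\<rho>\<close> is thin: its translates by the \<open>\<sigma>\<close>-separated multiples
  of length at most \<open>\<rho>\<close> are disjoint.
\<close>

lemma measure_le_of_disjoint_translates:
  assumes r: "0 < r" and E: "E \<in> sets H" "E \<subseteq> kball I x r" and j: "j \<in> I"
    and \<rho>: "0 < \<rho>" "\<rho> \<le> r" and \<sigma>: "0 < \<sigma>"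
    and sep: "\<And>y z. y \<in> E \<Longrightarrow> y(j := y j + z) \<in> E \<Longrightarrow> absval z \<le> \<rho> \<Longrightarrow> absval z \<le> \<sigma>"
  shows "measure H E \<le> measure H (kball I x r) * residue_card TYPE('a) ^ 2 * (\<sigma> / \<rho>)"
proof -
  let ?q = "residue_card TYPE('a)" and ?B = "kball I x r"
  have q: "2 \<le> ?q" by (rule residue_card_ge_2)
  obtain Z :: "'a set" where Z: "finite Z" "\<And>z. z \<in> Z \<Longrightarrow> absval z \<le> \<rho>"
    "\<And>z w. z \<in> Z \<Longrightarrow> w \<in> Z \<Longrightarrow> z \<noteq> w \<Longrightarrow> \<sigma> < absval (z - w)"
    "\<rho> / (\<sigma> * ?q ^ 2) \<le> real (card Z)"
    using absval_separated_set[where 'a='a, OF \<rho>(1) \<sigma>] by metis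
  let ?a = "\<lambda>z. \<lambda>i\<in>I. if i = j then z else 0"
  let ?T = "\<lambda>z. (\<lambda>y. \<lambda>i\<in>I. ?a z i + y i) ` E"
  have EK: "E \<subseteq> Kspace I"
    using E(2) kball_subset_Kspace by blast
  have T: "?T z = (\<lambda>y. y(j := y j + z)) ` E" for z
    using EK j by (intro image_cong refl translate_single) auto
  have TB: "?T z \<subseteq> ?B" if "z \<in> Z" for z
    unfolding T using kball_update[of _ I x r j z] E(2) j Z(2)[OF that] \<rho>(2) by fastforce
  have aK: "?a z \<in> Kspace I" for z
    by simp
  have Tsets: "?T z \<in> sets H" for z
    by (rule translate_image_sets[OF aK E(1)])
  have disj: "disjoint_family_on ?T Z"
    unfolding disjoint_family_on_def
  proof (intro ballI impI, rule ccontr)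
    fix z w assume zw: "z \<in> Z" "w \<in> Z" "z \<noteq> w" and "?T z \<inter> ?T w \<noteq> {}"
    then obtain y y' where y: "y \<in> E" "y' \<in> E" "y(j := y j + z) = y'(j := y' j + w)"
      unfolding T by blast
    have "y i = y' i" if "i \<noteq> j" for i
      using fun_cong[OF y(3), of i] that by simp
    moreover have "y j + z = y' j + w"
      using fun_cong[OF y(3), of j] by simp
    ultimately have "y(j := y j + (z - w)) = y'"
      by (auto simp: fun_eq_iff algebra_simps)
    moreover have "absval (z - w) \<le> \<rho>"
      using zw Z(2) by (intro absval_diff_le) auto
    ultimately have "absval (z - w) \<le> \<sigma>"
      using sep[OF y(1)] y(2) by blast
    then show False
      using Z(3)[OF zw] by simp
  qed
  have eT: "emeasure H (?T z) = emeasure H E" for z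
    by (rule emeasure_translate[OF aK E(1)])
  have fin: "emeasure H E < \<infinity>"
    using emeasure_mono[OF E(2) kball_sets[OF r]] emeasure_kball_finite[OF r, of x] by order
  have "of_nat (card Z) * emeasure H E = (\<Sum>z\<in>Z. emeasure H (?T z))"
    unfolding eT by simp
  also have "\<dots> = emeasure H (\<Union>z\<in>Z. ?T z)"
    using Tsets disj Z(1) by (intro sum_emeasure) auto
  also have "\<dots> \<le> emeasure H ?B"
    using TB by (intro emeasure_mono kball_sets r) blast
  finally have "enn2real (of_nat (card Z) * emeasure H E) \<le> enn2real (emeasure H ?B)"
    using emeasure_kball_finite[OF r, of x] by (intro enn2real_mono) auto
  then have le: "real (card Z) * measure H E \<le> measure H ?B"
    by (simp add: enn2real_mult measure_def)
  have "\<rho> / (\<sigma> * ?q ^ 2) * measure H E \<le> real (card Z) * measure H E"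
    using Z(4) by (intro mult_right_mono) auto
  with le have "\<rho> / (\<sigma> * ?q ^ 2) * measure H E \<le> measure H ?B"
    by linarith
  then have "\<rho> * measure H E \<le> measure H ?B * (\<sigma> * ?q ^ 2)"
    using \<sigma> q by (simp add: pos_divide_le_eq)
  then show ?thesis
    using \<rho> by (simp add: pos_le_divide_eq mult_ac)
qed

text \<open>
  If \<open>g\<close> has a derivative \<open>g'\<close> with \<open>\<eta> < \<bar>g'\<bar>\<close>, then on a segment shorter than a constant times
  \<open>\<eta>\<close> the linear term dominates the remainder, \<open>g\<close> scales distances by \<open>\<bar>g'\<bar>\<close>, and
  \<open>\<bar>g\<bar> \<le> \<epsilon>\<close> holds on a portion \<open>\<epsilon> / \<eta>\<^sup>2\<close> of it only.  Where \<open>\<bar>g'\<bar> \<le> \<eta>\<close>, induction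
  applies to \<open>g'\<close>; the choice \<open>\<eta> = \<epsilon>\<^bsup>1/3\<^esup>\<close> makes both contributions powers of \<open>\<epsilon>\<close>.
\<close>

lemma sublevel_estimate:
  assumes r: "0 < r" and C: "0 \<le> C" and c: "0 < c"
  shows "\<exists>A\<ge>0. \<forall>g \<epsilon>. deriv_chain I (kball I x r) r C c js g \<longrightarrow> 0 < \<epsilon> \<longrightarrow> \<epsilon> \<le> 1 \<longrightarrow>
    measure H {y \<in> kball I x r. absval (g y) \<le> \<epsilon>} \<le> A * \<epsilon> powr ((1 / 3) ^ length js)"
proof (induction js)
  case Nil
  let ?B = "kball I x r"
  show ?case
  proof (intro exI[of _ "measure H ?B / c"] conjI allI impI)
    fix g and \<epsilon> :: real
    assume g: "deriv_chain I ?B r C c [] g" and \<epsilon>: "0 < \<epsilon>"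
    show "measure H {y \<in> ?B. absval (g y) \<le> \<epsilon>} \<le> measure H ?B / c * \<epsilon> powr ((1 / 3) ^ length [])"
    proof (cases "\<epsilon> < c")
      case True
      then have empty: "{y \<in> ?B. absval (g y) \<le> \<epsilon>} = {}"
        using g by force
      show ?thesis
        using c \<epsilon> unfolding empty by simp
    next
      case False
      have "measure H {y \<in> ?B. absval (g y) \<le> \<epsilon>} \<le> measure H ?B"
        using g \<epsilon> r C by (intro measure_mono_fmeasurable fmeasurable_kball sublevel_sets) auto
      also have "\<dots> \<le> measure H ?B / c * \<epsilon>"
        using False c mult_left_mono[of c \<epsilon> "measure H ?B"] by (simp add: field_simps)
      finally show ?thesis
        using \<epsilon> by simp
    qed
  qed (use c in simp)
next
  case (Cons j js)
  let ?B = "kball I x r" and ?q = "residue_card TYPE('a)"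
  let ?\<delta> = "(1 / 3 :: real) ^ length js"
  obtain A where A: "0 \<le> A" "\<And>g \<epsilon>. deriv_chain I ?B r C c js g \<Longrightarrow> 0 < \<epsilon> \<Longrightarrow> \<epsilon> \<le> 1 \<Longrightarrow>
    measure H {y \<in> ?B. absval (g y) \<le> \<epsilon>} \<le> A * \<epsilon> powr ?\<delta>"
    using Cons by blast
  \<comment> \<open>For \<open>\<rho> = \<kappa> \<eta>\<close> and \<open>0 < \<bar>z\<bar> \<le> \<rho>\<close> the remainder \<open>C \<bar>z\<bar>\<^sup>2\<close> is less than \<open>\<eta> \<bar>z\<bar>\<close>.\<close>
  define \<kappa> where "\<kappa> = min r (1 / (C + 1))"
  have \<kappa>: "0 < \<kappa>" "\<kappa> \<le> r" "\<kappa> \<le> 1 / (C + 1)"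
    using r C by (auto simp: \<kappa>_def)
  have "C * \<kappa> < (C + 1) * \<kappa>"
    using \<kappa>(1) by (simp add: distrib_right)
  also have "\<dots> \<le> 1"
    using \<kappa>(3) C by (simp add: pos_le_divide_eq mult.commute)
  finally have C\<kappa>: "C * \<kappa> < 1" .
  let ?K = "measure H ?B * ?q ^ 2 / \<kappa>"
  show ?case
  proof (intro exI[of _ "A + ?K"] conjI allI impI)
    show "0 \<le> A + ?K"
      using A(1) \<kappa>(1) by simp
    fix g and \<epsilon> :: real
    assume g: "deriv_chain I ?B r C c (j # js) g" and \<epsilon>: "0 < \<epsilon>" "\<epsilon> \<le> 1"
    then obtain g' where g': "taylor_on ?B r C j g g'" "deriv_chain I ?B r C c js g'" and j: "j \<in> I"
      by auto
    define \<eta> where "\<eta> = \<epsilon> powr (1 / 3)"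
    define \<sigma> where "\<sigma> = \<epsilon> powr (2 / 3)"
    have \<eta>: "0 < \<eta>" "\<eta> \<le> 1"
      using \<epsilon> by (auto simp: \<eta>_def intro: powr_le1)
    have \<sigma>: "0 < \<sigma>" "\<sigma> * \<eta> = \<epsilon>" "\<sigma> / \<eta> = \<eta>"
      using \<epsilon> by (auto simp: \<sigma>_def \<eta>_def simp flip: powr_add powr_diff)
    define \<rho> where "\<rho> = \<kappa> * \<eta>"
    have \<rho>: "0 < \<rho>" "\<rho> \<le> r"
      using \<kappa> \<eta> mult_mono[of \<kappa> r \<eta> 1] by (auto simp: \<rho>_def)
    let ?E = "{y \<in> ?B. absval (g y) \<le> \<epsilon>}" and ?E1 = "{y \<in> ?B. absval (g' y) \<le> \<eta>}"
    have E: "?E \<in> sets H" "?E1 \<in> sets H"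
      using g deriv_chain_lipschitz[OF g'(2)] r C \<epsilon> \<eta> by (auto intro!: sublevel_sets)
    have "measure H (?E - ?E1) \<le> measure H ?B * ?q ^ 2 * (\<sigma> / \<rho>)"
    proof (rule measure_le_of_disjoint_translates[OF r _ _ j \<rho> \<sigma>(1)])
      fix y z assume y: "y \<in> ?E - ?E1" and yz: "y(j := y j + z) \<in> ?E - ?E1" and z: "absval z \<le> \<rho>"
      let ?d = "g (y(j := y j + z)) - g y"
      have gy: "\<eta> \<le> absval (g' y)"
        using y by auto
      show "absval z \<le> \<sigma>"
      proof (cases "z = 0")
        case False
        have "absval (?d - g' y * z) \<le> C * absval z ^ 2"
          using g'(1) y z \<rho> unfolding taylor_on_def by auto
        also have "\<dots> = C * absval z * absval z"
          by (simp add: power2_eq_square)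
        also have "\<dots> \<le> C * \<rho> * absval z"
          using z C by (intro mult_right_mono mult_left_mono) auto
        also have "\<dots> = C * \<kappa> * (\<eta> * absval z)"
          by (simp add: \<rho>_def)
        also have "\<dots> < 1 * (\<eta> * absval z)"
          using C\<kappa> \<eta> False by (intro mult_strict_right_mono) auto
        also have "1 * (\<eta> * absval z) \<le> absval (g' y * z)"
          using gy by (simp add: absval_mult mult_right_mono)
        finally have "absval ?d = absval (g' y * z)"
          by (rule absval_eq_of_dominant)
        moreover have "absval ?d \<le> \<epsilon>"
          using y yz by (intro absval_diff_le) auto
        moreover have "\<eta> * absval z \<le> absval (g' y * z)"
          using gy by (simp add: absval_mult mult_right_mono)
        ultimately have "\<eta> * absval z \<le> \<eta> * \<sigma>"
          using \<sigma>(2) by (simp add: mult.commute)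
        then show ?thesis
          using \<eta>(1) by simp
      qed (use \<sigma> in simp)
    qed (use E in auto)
    also have "\<dots> = ?K * \<eta>"
      using \<sigma>(3) \<kappa>(1) \<eta>(1) by (simp add: \<rho>_def field_simps)
    also have "\<dots> \<le> ?K * \<epsilon> powr (?\<delta> / 3)"
    proof (rule mult_left_mono)
      have "?\<delta> \<le> 1"
        by (simp add: power_le_one)
      then show "\<eta> \<le> \<epsilon> powr (?\<delta> / 3)"
        unfolding \<eta>_def using \<epsilon> by (intro powr_mono') auto
    qed (use \<kappa> in simp)
    finally have 1: "measure H (?E - ?E1) \<le> ?K * \<epsilon> powr (?\<delta> / 3)" .
    have 2: "measure H ?E1 \<le> A * \<epsilon> powr (?\<delta> / 3)"
      using A(2)[OF g'(2) \<eta>] \<epsilon> by (simp add: \<eta>_def powr_powr mult.commute)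
    have fm: "?E1 \<in> fmeasurable H" "?E - ?E1 \<in> fmeasurable H"
      using E by (auto intro!: fmeasurableI2[OF fmeasurable_kball[OF r]])
    have "measure H ?E \<le> measure H (?E1 \<union> (?E - ?E1))"
      using E fm by (intro measure_mono_fmeasurable fmeasurable.Un) auto
    also have "\<dots> \<le> measure H ?E1 + measure H (?E - ?E1)"
      using fm by (intro measure_Un_le) auto
    finally show "measure H ?E \<le> (A + ?K) * \<epsilon> powr ((1 / 3) ^ length (j # js))"
      using 1 2 by (simp add: algebra_simps)
  qed
qed

end

section \<open>Characters and oscillatory integrals\<close>

locale unramified_character =
  fixes \<psi> :: "'a::nonarch_local_field \<Rightarrow> complex"
  assumes character: "additive_character \<psi>"
    and trivial_on_ideal: "\<And>x. absval x < 1 \<Longrightarrow> \<psi> x = 1"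
    and nontrivial: "\<exists>x. absval x \<le> 1 \<and> \<psi> x \<noteq> 1"
begin

lemma psi_add: "\<psi> (x + y) = \<psi> x * \<psi> y"
  using character by (simp add: additive_character_def)

lemma psi_zero [simp]: "\<psi> 0 = 1"
  by (rule trivial_on_ideal) simp

lemma psi_cong: "absval (x - y) < 1 \<Longrightarrow> \<psi> x = \<psi> y"
  using psi_add[of "x - y" y] trivial_on_ideal by simp

lemma psi_of_nat_mult: "\<psi> (of_nat m * x) = \<psi> x ^ m"
  by (induction m) (simp_all add: psi_add algebra_simps)

text \<open>
  Some positive integer \<open>m\<close> has norm less than 1 in \<open>K\<close>, because the residue field is
  finite; so a power of \<open>m\<close> multiplies \<open>x\<close> into the maximal ideal and \<open>\<psi> x\<close> is a root of unity.
\<close>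

lemma norm_psi [simp]: "norm (\<psi> x) = 1"
proof -
  obtain Z :: "'a set" where Z: "finite Z" "\<And>x. absval x \<le> 1 \<Longrightarrow> \<exists>z\<in>Z. absval (x - z) \<le> 1 / 2"
    using absval_finite_net[where 'a='a, of "1 / 2" 1] by (metis half_gt_zero zero_less_one)
  have "\<forall>i::nat. \<exists>z\<in>Z. absval (of_nat i - z) \<le> 1 / 2"
    using Z(2) absval_of_nat_le_1 by blast
  then obtain f where f: "\<And>i::nat. f i \<in> Z" "\<And>i. absval (of_nat i - f i) \<le> 1 / 2"
    by metis
  have "\<not> inj f"
    using Z(1) f(1) finite_imageD[of f UNIV] finite_subset[of "range f" Z] by auto
  then obtain i j where "f i = f j" "i \<noteq> j"
    by (auto simp: inj_def)
  then obtain i j where ij: "f i = f j" "i < j"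
    by (metis linorder_neqE_nat)
  define m where "m = j - i"
  have "absval (of_nat j - of_nat i :: 'a) \<le> 1 / 2"
  proof (rule absval_trans_le)
    show "absval (of_nat j - f j) \<le> 1 / 2"
      by (rule f(2))
    show "absval (f j - of_nat i) \<le> 1 / 2"
      using f(2)[of i] unfolding ij(1) by (subst absval_minus_commute)
  qed
  then have m: "0 < m" "absval (of_nat m :: 'a) \<le> 1 / 2"
    using ij(2) by (simp_all add: m_def of_nat_diff)
  obtain e where e: "absval x < 2 ^ e"
    using real_arch_pow[of 2 "absval x"] by auto
  have "absval (of_nat (m ^ e) * x) = absval (of_nat m :: 'a) ^ e * absval x"
    by (simp add: absval_mult absval_power)
  also have "\<dots> \<le> (1 / 2) ^ e * absval x"
    using m(2) by (intro mult_right_mono power_mono) auto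
  also have "\<dots> < 1"
    using e by (simp add: power_divide)
  finally have "\<psi> (of_nat (m ^ e) * x) = 1"
    by (rule trivial_on_ideal)
  then have "\<psi> x ^ (m ^ e) = 1"
    unfolding psi_of_nat_mult .
  then have "norm (\<psi> x) ^ (m ^ e) = 1"
    by (metis norm_one norm_power)
  then have *: "norm (\<psi> x) ^ (m ^ e) = 1 ^ (m ^ e)"
    by (simp only: power_one)
  show ?thesis
    by (rule power_eq_imp_eq_base[OF *]) (use m(1) in simp_all)
qed

lemma cnj_psi: "cnj (\<psi> x) = \<psi> (- x)"
proof -
  have "\<psi> x * \<psi> (- x) = 1"
    using psi_add[of x "- x"] by simp
  moreover have "\<psi> x * cnj (\<psi> x) = 1"
    using complex_norm_square[of "\<psi> x"] by simp
  moreover have "\<psi> x \<noteq> 0"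
    using norm_psi[of x] by force
  ultimately show ?thesis by (metis mult_left_cancel)
qed

end

lemma norm_set_integral_le:
  fixes F :: "'b \<Rightarrow> complex"
  assumes "A \<in> fmeasurable M" "\<And>x. x \<in> A \<Longrightarrow> norm (F x) \<le> C" "0 \<le> C"
  shows "norm (LINT x:A|M. F x) \<le> C * measure M A"
proof -
  have "norm (LINT x:A|M. F x) \<le> (LINT x|M. norm (indicator A x *\<^sub>R F x))"
    unfolding set_lebesgue_integral_def by (rule integral_norm_bound)
  also have "\<dots> \<le> (LINT x|M. indicator A x * C)"
  proof (rule integral_mono')
    show "integrable M (\<lambda>x. indicator A x * C)"
      using assms(1) by (intro integrable_mult_left integrable_real_indicator) (auto simp: fmeasurable_def)
  qed (use assms in \<open>auto simp: indicator_def\<close>)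
  also have "\<dots> = C * measure M A"
    using assms(1) sets.sets_into_space[of A M] by (auto simp: fmeasurable_def Int_absorb2)
  finally show ?thesis .
qed

locale oscillatory = haar_space I H + unramified_character \<psi>
  for I :: "'i set" and H :: "('i \<Rightarrow> 'a::nonarch_local_field) measure" and \<psi> :: "'a \<Rightarrow> complex"
begin

lemma oscillating_measurable:
  assumes "max_lipschitz_on I (kball I x r) C \<phi>" "0 < r" "0 \<le> C"
  shows "(\<lambda>y. if y \<in> kball I x r then \<psi> (l * \<phi> y) else 0) \<in> borel_measurable H"
proof (rule locally_constant_measurable)
  fix y :: "'i \<Rightarrow> 'a" assume "y \<in> Kspace I"
  define e where "e = min r (1 / ((absval l + 1) * (C + 1)))"
  have e: "0 < e" "e \<le> r" "e \<le> 1 / ((absval l + 1) * (C + 1))"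
    using assms absval_ge_0[of l] by (auto simp: e_def intro!: mult_pos_pos add_nonneg_pos)
  have "absval l * (C * e) < 1"
  proof -
    have "0 < (absval l + 1) * (C + 1)"
      using assms absval_ge_0[of l] by (intro mult_pos_pos) linarith+
    then have "((absval l + 1) * (C + 1)) * e \<le> 1"
      using e(3) by (simp only: pos_le_divide_eq mult.commute[of e])
    moreover have "(absval l + 1) * (C + 1) = absval l * C + (absval l + C + 1)"
      by (simp add: algebra_simps)
    then have "absval l * C < (absval l + 1) * (C + 1)"
      using assms(3) absval_ge_0[of l] by linarith
    then have "absval l * C * e < ((absval l + 1) * (C + 1)) * e"
      using e(1) by (intro mult_strict_right_mono)
    ultimately show ?thesis by (simp add: mult_ac)
  qed
  have in_iff: "z \<in> kball I x r \<longleftrightarrow> y \<in> kball I x r" if "z \<in> kball I y e" for z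
    using that kball_mono[OF e(2), of I y] kball_recenter[of z I y r] kball_recenter[of y I x r]
      kball_recenter[of z I x r] center_in_kball[of y I r] center_in_kball[of z I r] \<open>y \<in> Kspace I\<close> assms(2)
      kball_subset_Kspace[of I y e]
    by (metis less_eq_real_def subsetD)
  have "\<psi> (l * \<phi> z) = \<psi> (l * \<phi> y)" if "z \<in> kball I y e" "y \<in> kball I x r" for z
  proof (rule psi_cong)
    have "absval (\<phi> z - \<phi> y) \<le> C * e"
      using assms(1) in_iff[OF that(1)] that e(1) unfolding max_lipschitz_on_def by (auto simp: kball_def)
    then have "absval l * absval (\<phi> z - \<phi> y) \<le> absval l * (C * e)"
      by (intro mult_left_mono) auto
    then show "absval (l * \<phi> z - l * \<phi> y) < 1"
      using \<open>absval l * (C * e) < 1\<close> by (simp flip: right_diff_distrib absval_mult)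
  qed
  then show "\<exists>e>0. \<forall>z\<in>kball I y e. (if z \<in> kball I x r then \<psi> (l * \<phi> z) else 0)
      = (if y \<in> kball I x r then \<psi> (l * \<phi> y) else 0)"
    using e(1) in_iff by (intro exI[of _ e]) auto
qed

text \<open>
  On a ball so small that the phase is linear modulo the maximal ideal and on which its derivative is
  not too small, some translation multiplies the integrand by a constant other than 1.
\<close>

lemma oscillatory_integral_zero:
  assumes lip: "max_lipschitz_on I (kball I x r) C \<phi>" "max_lipschitz_on I (kball I x r) C g"
    and taylor: "taylor_on (kball I x r) r C j \<phi> g" and j: "j \<in> I"
    and \<rho>: "0 < \<rho>" "\<rho> \<le> r" and C: "0 \<le> C" and small: "absval l * (C * \<rho> ^ 2) < 1"
    and a: "a \<in> kball I x r" and l: "l \<noteq> 0" and large: "1 \<le> absval l * absval (g a) * \<rho>"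
  shows "(LINT y:kball I a \<rho>|H. \<psi> (l * \<phi> y)) = 0"
proof -
  let ?B = "kball I x r" and ?b = "kball I a \<rho>"
  let ?F = "\<lambda>y. if y \<in> ?B then \<psi> (l * \<phi> y) else 0"
  have bB: "?b \<subseteq> ?B"
    using kball_mono[OF \<rho>(2), of I a] kball_recenter[OF a] by simp
  have ga: "g a \<noteq> 0"
    using large by auto
  \<comment> \<open>The translation \<open>z\<close> changes the phase by \<open>l g(a) z = u\<close> modulo the maximal ideal.\<close>
  obtain u where u: "absval u \<le> 1" "\<psi> u \<noteq> 1"
    using nontrivial by blast
  define z where "z = u / (l * g a)"
  have "absval z \<le> 1 / (absval l * absval (g a))"
    using u(1) by (simp add: z_def absval_divide absval_mult divide_right_mono)
  also have "\<dots> \<le> \<rho>"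
    using large l ga by (simp add: pos_divide_le_eq mult_ac)
  finally have z: "absval z \<le> \<rho>" .
  have shift: "?F (y(j := y j + z)) = \<psi> u * ?F y" if y: "y \<in> ?b" for y
  proof -
    let ?y = "y(j := y j + z)"
    have yB: "y \<in> ?B" "?y \<in> ?B"
      using y bB kball_update[OF y j z] by auto
    have "absval (l * (\<phi> ?y - \<phi> y - g y * z)) < 1"
    proof -
      have "absval (\<phi> ?y - \<phi> y - g y * z) \<le> C * absval z ^ 2"
        using taylor yB(1) z \<rho>(2) unfolding taylor_on_def by auto
      also have "\<dots> \<le> C * \<rho> ^ 2"
        using z C by (intro mult_left_mono power_mono) auto
      finally have "absval l * absval (\<phi> ?y - \<phi> y - g y * z) \<le> absval l * (C * \<rho> ^ 2)"
        by (rule mult_left_mono) simp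
      then show ?thesis
        unfolding absval_mult using small by linarith
    qed
    moreover have "absval (l * ((g y - g a) * z)) < 1"
    proof -
      have "absval (g y - g a) \<le> C * \<rho>"
        using lip(2) yB(1) a y \<rho>(1) unfolding max_lipschitz_on_def by (auto simp: kball_def)
      then have "absval (g y - g a) * absval z \<le> C * \<rho> * \<rho>"
        using z C \<rho>(1) by (intro mult_mono) auto
      then have "absval l * (absval (g y - g a) * absval z) \<le> absval l * (C * \<rho> ^ 2)"
        by (intro mult_left_mono) (auto simp: power2_eq_square mult_ac)
      then show ?thesis
        unfolding absval_mult using small by linarith
    qed
    ultimately have "absval (l * (\<phi> ?y - \<phi> y - g y * z) + l * ((g y - g a) * z)) < 1"
      by (rule absval_add_less)
    moreover have "l * (\<phi> ?y - \<phi> y - g y * z) + l * ((g y - g a) * z) = l * \<phi> ?y - (l * (g a * z) + l * \<phi> y)"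
      by (simp add: algebra_simps)
    moreover have "l * (g a * z) = u"
      using l ga by (simp add: z_def)
    ultimately have "\<psi> (l * \<phi> ?y) = \<psi> (u + l * \<phi> y)"
      by (intro psi_cong) simp
    then show ?thesis
      using yB by (simp add: psi_add)
  qed
  let ?t = "\<lambda>i\<in>I. if i = j then z else 0"
  have "(LINT y:?b|H. \<psi> (l * \<phi> y)) = (LINT y:?b|H. ?F y)"
    using bB by (intro set_lebesgue_integral_cong kball_sets \<rho>) auto
  also have "\<dots> = (LINT y:?b|H. ?F (\<lambda>i\<in>I. ?t i + y i))"
  proof (rule integral_kball_translate[symmetric])
    show "absval (?t i) \<le> \<rho>" if "i \<in> I" for i
      using z \<rho>(1) that by auto
  qed (use oscillating_measurable lip(1) \<rho> C in auto)
  also have "\<dots> = (LINT y:?b|H. \<psi> u * ?F y)"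
  proof (intro set_lebesgue_integral_cong kball_sets \<rho> allI impI)
    fix y assume y: "y \<in> ?b"
    then have "(\<lambda>i\<in>I. ?t i + y i) = y(j := y j + z)"
      using kball_subset_Kspace by (intro translate_single j) blast
    then show "?F (\<lambda>i\<in>I. ?t i + y i) = \<psi> u * ?F y"
      unfolding shift[OF y, symmetric] by (simp only:)
  qed
  also have "\<dots> = \<psi> u * (LINT y:?b|H. ?F y)"
    by simp
  also have "(LINT y:?b|H. ?F y) = (LINT y:?b|H. \<psi> (l * \<phi> y))"
    using bB by (intro set_lebesgue_integral_cong kball_sets \<rho>) auto
  finally have "(1 - \<psi> u) * (LINT y:?b|H. \<psi> (l * \<phi> y)) = 0"
    by (simp add: algebra_simps)
  then show ?thesis
    using u(2) by simp
qed

text \<open>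
  At the scale \<open>\<rho> \<approx> \<bar>l\<bar>\<^bsup>-1/2\<^esup>\<close> the quadratic remainder of \<open>l \<phi>\<close> lies in the maximal ideal, and
  the balls on which \<open>\<bar>g\<bar> > \<eta> \<approx> \<bar>l\<bar>\<^bsup>-1/2\<^esup>\<close> contribute nothing: the integral is bounded by the
  measure of the set where \<open>\<bar>g\<bar> \<le> \<eta>\<close>.
\<close>

lemma oscillatory_integral_le:
  assumes r: "0 < r" and C: "0 \<le> C" and A: "0 \<le> A" and \<delta>: "0 < \<delta>"
  shows "\<exists>K\<ge>0. \<forall>\<phi> g j l. max_lipschitz_on I (kball I x r) C \<phi> \<longrightarrow> max_lipschitz_on I (kball I x r) C g \<longrightarrow>
    taylor_on (kball I x r) r C j \<phi> g \<longrightarrow> j \<in> I \<longrightarrow>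
    (\<forall>\<epsilon>. 0 < \<epsilon> \<longrightarrow> \<epsilon> \<le> 1 \<longrightarrow> measure H {y \<in> kball I x r. absval (g y) \<le> \<epsilon>} \<le> A * \<epsilon> powr \<delta>) \<longrightarrow>
    1 \<le> absval l \<longrightarrow> norm (LINT y:kball I x r|H. \<psi> (l * \<phi> y)) \<le> K * absval l powr (- \<delta> / 2)"
proof -
  let ?B = "kball I x r"
  \<comment> \<open>For \<open>\<rho> = \<kappa> \<bar>l\<bar>\<^bsup>-1/2\<^esup>\<close> the quadratic remainder \<open>\<bar>l\<bar> C \<rho>\<^sup>2 = C \<kappa>\<^sup>2\<close> is less than 1.\<close>
  define \<kappa> where "\<kappa> = min (min r 1) (1 / (C + 1))"
  have \<kappa>: "0 < \<kappa>" "\<kappa> \<le> r" "\<kappa> \<le> 1" "\<kappa> \<le> 1 / (C + 1)"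
    using r C by (auto simp: \<kappa>_def)
  have "C * \<kappa> < (C + 1) * \<kappa>"
    using \<kappa>(1) by (simp add: distrib_right)
  also have "\<dots> \<le> 1"
    using \<kappa>(4) C by (simp add: pos_le_divide_eq mult.commute)
  finally have C\<kappa>: "C * \<kappa> < 1" .
  have C\<kappa>2: "C * \<kappa> ^ 2 < 1"
    using C\<kappa> C \<kappa> mult_left_mono[of \<kappa> 1 "C * \<kappa>"] by (simp add: power2_eq_square mult_ac)
  define K where "K = (A + measure H ?B) * \<kappa> powr (- \<delta>)"
  show ?thesis
  proof (intro exI[of _ K] conjI allI impI)
    show "0 \<le> K"
      using A by (simp add: K_def)
    fix \<phi> g :: "('i \<Rightarrow> 'a) \<Rightarrow> 'a" and j and l :: 'a
    assume lip: "max_lipschitz_on I ?B C \<phi>" "max_lipschitz_on I ?B C g"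
      and taylor: "taylor_on ?B r C j \<phi> g" and j: "j \<in> I"
      and sub: "\<forall>\<epsilon>. 0 < \<epsilon> \<longrightarrow> \<epsilon> \<le> 1 \<longrightarrow> measure H {y \<in> ?B. absval (g y) \<le> \<epsilon>} \<le> A * \<epsilon> powr \<delta>"
      and l: "1 \<le> absval l"
    let ?L = "absval l"
    have l0: "l \<noteq> 0"
      using l by auto
    define s where "s = ?L powr (- 1 / 2)"
    have s: "0 < s" "s \<le> 1" "?L * s ^ 2 = 1"
    proof -
      show "0 < s" using l0 by (simp add: s_def)
      show "s \<le> 1" using l l0 powr_mono[of "-1/2" 0 ?L] by (simp add: s_def)
      have "s ^ 2 = ?L powr (- 1)"
        using l0 unfolding s_def power2_eq_square by (simp flip: powr_add)
      then show "?L * s ^ 2 = 1" using l0 by (simp add: powr_minus)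
    qed
    define \<rho> where "\<rho> = \<kappa> * s"
    define \<eta> where "\<eta> = s / \<kappa>"
    have \<rho>: "0 < \<rho>" "\<rho> \<le> r" "\<rho> \<le> \<eta>" "?L * \<eta> * \<rho> = 1" "?L * (C * \<rho> ^ 2) < 1" and \<eta>: "0 < \<eta>"
    proof -
      show "0 < \<rho>" "0 < \<eta>" using \<kappa> s by (auto simp: \<rho>_def \<eta>_def)
      show "\<rho> \<le> r" using \<kappa> s mult_mono[of \<kappa> r s 1] by (simp add: \<rho>_def)
      show "?L * \<eta> * \<rho> = 1" using s(3) \<kappa>(1) by (simp add: \<rho>_def \<eta>_def power2_eq_square mult_ac)
      have "\<kappa> * s \<le> 1 * s" "s * \<kappa> \<le> s * 1"
        using \<kappa> s by (auto intro!: mult_right_mono mult_left_mono)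
      then show "\<rho> \<le> \<eta>" using \<kappa>(1) s mult_mono[of "\<kappa> * s" s \<kappa> 1] by (simp add: \<rho>_def \<eta>_def pos_le_divide_eq)
      have "?L * (C * \<rho> ^ 2) = C * \<kappa> ^ 2 * (?L * s ^ 2)"
        by (simp add: \<rho>_def power_mult_distrib)
      also have "\<dots> < 1" unfolding s(3) using C\<kappa>2 by simp
      finally show "?L * (C * \<rho> ^ 2) < 1" .
    qed
    have C\<rho>: "C * \<rho> \<le> \<eta>"
    proof -
      have "C * \<rho> = C * \<kappa> * s" by (simp add: \<rho>_def)
      also have "\<dots> \<le> 1 * s" using C\<kappa> s by (intro mult_right_mono) auto
      also have "\<dots> \<le> \<eta>" using \<kappa> s mult_left_mono[of \<kappa> 1 s] by (simp add: \<eta>_def pos_le_divide_eq)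
      finally show ?thesis .
    qed
    have \<eta>_powr: "\<eta> powr \<delta> = \<kappa> powr (- \<delta>) * ?L powr (- \<delta> / 2)"
    proof -
      have "\<eta> powr \<delta> = s powr \<delta> / \<kappa> powr \<delta>"
        unfolding \<eta>_def using \<kappa> s by (simp only: powr_divide)
      moreover have "s powr \<delta> = ?L powr (- \<delta> / 2)"
      proof -
        have "- 1 / 2 * \<delta> = - \<delta> / 2" by (rule mult.commute[THEN trans]) simp
        then show ?thesis unfolding s_def powr_powr by (rule arg_cong)
      qed
      ultimately have "\<eta> powr \<delta> = ?L powr (- \<delta> / 2) / \<kappa> powr \<delta>"
        by (simp only:)
      then show ?thesis
        unfolding powr_minus_divide[of \<kappa>] by (simp only: times_divide_eq_left mult_1_left)
    qed
    show "norm (LINT y:?B|H. \<psi> (l * \<phi> y)) \<le> K * ?L powr (- \<delta> / 2)"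
    proof (cases "\<eta> \<le> 1")
      case False
      have "norm (LINT y:?B|H. \<psi> (l * \<phi> y)) \<le> 1 * measure H ?B"
        by (intro norm_set_integral_le fmeasurable_kball r) auto
      also have "\<dots> \<le> measure H ?B * \<eta> powr \<delta>"
        using False \<delta> ge_one_powr_ge_zero[of \<eta> \<delta>] mult_left_mono[of 1 "\<eta> powr \<delta>" "measure H ?B"] by simp
      also have "\<dots> \<le> (A + measure H ?B) * \<eta> powr \<delta>"
        using A by (intro mult_right_mono) auto
      finally show ?thesis
        by (simp add: K_def \<eta>_powr mult_ac)
    next
      case True
      let ?F = "\<lambda>y. if y \<in> ?B then \<psi> (l * \<phi> y) else 0"
      let ?E = "{y \<in> ?B. absval (g y) \<le> \<eta>}"
      obtain S where S: "finite S" "S \<subseteq> ?B" "disjoint_family_on (\<lambda>a. kball I a \<rho>) S"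
        "(\<Union>a\<in>S. kball I a \<rho>) = ?B"
        using kball_partition[OF finite_I \<rho>(1,2)] by blast
      let ?int = "\<lambda>a. LINT y:kball I a \<rho>|H. \<psi> (l * \<phi> y)"
      have sub_B: "kball I a \<rho> \<subseteq> ?B" if "a \<in> S" for a
        using S(4) that by blast
      have "(LINT y:?B|H. \<psi> (l * \<phi> y)) = (LINT y:?B|H. ?F y)"
        by (intro set_lebesgue_integral_cong kball_sets r) auto
      also have "\<dots> = (\<Sum>a\<in>S. LINT y:kball I a \<rho>|H. ?F y)"
      proof -
        have "(LINT y:(\<Union>a\<in>S. kball I a \<rho>)|H. ?F y) = (\<Sum>a\<in>S. LINT y:kball I a \<rho>|H. ?F y)"
          using S(1,3) \<rho>(1) oscillating_measurable[OF lip(1) r C, of l]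
          by (intro set_integral_finite_Union set_integrable_kball[where C = 1]) auto
        then show ?thesis
          unfolding S(4) .
      qed
      also have "\<dots> = (\<Sum>a\<in>S. ?int a)"
        using sub_B by (intro sum.cong refl set_lebesgue_integral_cong kball_sets \<rho>) auto
      also have "\<dots> = (\<Sum>a | a \<in> S \<and> absval (g a) \<le> \<eta>. ?int a)"
      proof (rule sum.mono_neutral_right[OF S(1)])
        show "\<forall>a\<in>S - {a \<in> S. absval (g a) \<le> \<eta>}. ?int a = 0"
        proof
          fix a assume a: "a \<in> S - {a \<in> S. absval (g a) \<le> \<eta>}"
          have "?L * \<eta> * \<rho> \<le> ?L * absval (g a) * \<rho>"
            using a \<rho>(1) by (intro mult_right_mono mult_left_mono) auto
          then show "?int a = 0"
            using a S(2) \<rho> l0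
            by (intro oscillatory_integral_zero[OF lip taylor j \<rho>(1,2) C \<rho>(5)]) auto
        qed
      qed auto
      finally have "norm (LINT y:?B|H. \<psi> (l * \<phi> y)) \<le> (\<Sum>a | a \<in> S \<and> absval (g a) \<le> \<eta>. norm (?int a))"
        by (simp add: norm_sum)
      also have "\<dots> \<le> (\<Sum>a | a \<in> S \<and> absval (g a) \<le> \<eta>. measure H (kball I a \<rho>))"
      proof (rule sum_mono)
        fix a
        show "norm (?int a) \<le> measure H (kball I a \<rho>)"
          using norm_set_integral_le[OF fmeasurable_kball[OF \<rho>(1), of a], of "\<lambda>y. \<psi> (l * \<phi> y)" 1] by simp
      qed
      also have "\<dots> = measure H (\<Union>a\<in>{a \<in> S. absval (g a) \<le> \<eta>}. kball I a \<rho>)"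
        using S(1) disjoint_family_on_mono[OF _ S(3)] \<rho>(1) emeasure_kball_finite[OF \<rho>(1)]
        by (intro measure_finite_Union[symmetric]) (auto simp: less_top)
      also have "\<dots> \<le> measure H ?E"
      proof (rule measure_mono_fmeasurable)
        show "(\<Union>a\<in>{a \<in> S. absval (g a) \<le> \<eta>}. kball I a \<rho>) \<subseteq> ?E"
        proof clarify
          fix a y assume a: "a \<in> S" "absval (g a) \<le> \<eta>" and y: "y \<in> kball I a \<rho>"
          have yB: "y \<in> ?B" using sub_B[OF a(1)] y by blast
          moreover have "absval (g y - g a) \<le> C * \<rho>"
            using lip(2) yB a S(2) y \<rho>(1) unfolding max_lipschitz_on_def by (auto simp: kball_def)
          then have "absval (g y - g a) \<le> \<eta>"
            using C\<rho> by linarith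
          then show "y \<in> ?B \<and> absval (g y) \<le> \<eta>"
            using absval_add_le[of "g y - g a" \<eta> "g a"] a(2) yB by simp
        qed
        show "(\<Union>a\<in>{a \<in> S. absval (g a) \<le> \<eta>}. kball I a \<rho>) \<in> sets H"
          using S(1) \<rho>(1) by auto
        show "?E \<in> fmeasurable H"
          using sublevel_sets[OF lip(2) r \<eta> C] by (intro fmeasurableI2[OF fmeasurable_kball[OF r]]) auto
      qed
      also have "\<dots> \<le> A * \<eta> powr \<delta>"
        using sub \<eta> True by blast
      also have "\<dots> \<le> (A + measure H ?B) * \<eta> powr \<delta>"
        by (intro mult_right_mono) auto
      finally show ?thesis
        by (simp add: K_def \<eta>_powr mult_ac)
    qed
  qed
qed

end

section \<open>Decay near a point of finite type\<close>

lemma max_norm_le_iff: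
  "finite I \<Longrightarrow> 0 \<le> e \<Longrightarrow> max_norm I x \<le> e \<longleftrightarrow> (\<forall>i\<in>I. absval (x i) \<le> e)"
  by (auto simp: max_norm_def)

lemma absval_le_max_norm: "finite I \<Longrightarrow> i \<in> I \<Longrightarrow> absval (x i) \<le> max_norm I x"
  by (auto simp: max_norm_def)

lemma max_norm_nonneg: "finite I \<Longrightarrow> 0 \<le> max_norm I x"
  by (auto simp: max_norm_def intro: Max_ge)

lemma max_norm_attained:
  assumes "finite I" "0 < max_norm I x"
  obtains i where "i \<in> I" "absval (x i) = max_norm I x"
proof -
  have "max_norm I x \<in> insert 0 ((\<lambda>i. absval (x i)) ` I)"
    unfolding max_norm_def using assms(1) by (intro Max_in) auto
  then show ?thesis
    using assms(2) that by auto
qed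

lemma taylor_on_mono:
  fixes g :: "('i \<Rightarrow> 'a::nonarch_local_field) \<Rightarrow> 'a"
  assumes "taylor_on B r C j g g'" "B' \<subseteq> B" "r' \<le> r" "C \<le> C'"
  shows "taylor_on B' r' C' j g g'"
  unfolding taylor_on_def
proof (intro ballI allI impI)
  fix y :: "'i \<Rightarrow> 'a" and z :: 'a assume "y \<in> B'" "absval z \<le> r'"
  then have "absval (g (y(j := y j + z)) - g y - g' y * z) \<le> C * absval z ^ 2"
    using assms unfolding taylor_on_def by (meson order_trans subsetD)
  also have "\<dots> \<le> C' * absval z ^ 2"
    using assms(4) by (intro mult_right_mono) auto
  finally show "absval (g (y(j := y j + z)) - g y - g' y * z) \<le> C' * absval z ^ 2" .
qed

lemma max_lipschitz_on_mono:
  assumes "max_lipschitz_on J B C g" "B' \<subseteq> B" "C \<le> C'"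
  shows "max_lipschitz_on J B' C' g"
  unfolding max_lipschitz_on_def
proof (intro ballI allI impI)
  fix y y' and e :: real assume "y \<in> B'" "y' \<in> B'" "0 \<le> e" "\<forall>i\<in>J. absval (y i - y' i) \<le> e"
  then have "absval (g y - g y') \<le> C * e"
    using assms unfolding max_lipschitz_on_def by blast
  also have "\<dots> \<le> C' * e"
    using assms(3) \<open>0 \<le> e\<close> by (intro mult_right_mono) auto
  finally show "absval (g y - g y') \<le> C' * e" .
qed

lemma absval_combination_le:
  assumes "\<And>i. i \<in> A \<Longrightarrow> absval (v i) \<le> 1" "\<And>i. i \<in> A \<Longrightarrow> absval (t i) \<le> C" "0 \<le> C"
  shows "absval (\<Sum>i\<in>A. v i * t i :: 'a::nonarch_local_field) \<le> C"
proof (rule absval_sum_le[OF assms(3)])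
  fix i assume "i \<in> A"
  then have "absval (v i) * absval (t i) \<le> 1 * C"
    using assms by (intro mult_mono) auto
  then show "absval (v i * t i) \<le> C"
    by (simp add: absval_mult)
qed

lemma taylor_on_combination:
  fixes g :: "'s \<Rightarrow> ('i \<Rightarrow> 'a::nonarch_local_field) \<Rightarrow> 'a"
  assumes "\<And>i. i \<in> A \<Longrightarrow> absval (v i) \<le> 1" "\<And>i. i \<in> A \<Longrightarrow> taylor_on B r C j (g i) (g' i)" "0 \<le> C"
  shows "taylor_on B r C j (\<lambda>y. \<Sum>i\<in>A. v i * g i y) (\<lambda>y. \<Sum>i\<in>A. v i * g' i y)"
  unfolding taylor_on_def
proof (intro ballI allI impI)
  fix y :: "'i \<Rightarrow> 'a" and z :: 'a assume yz: "y \<in> B" "absval z \<le> r"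
  have "absval (\<Sum>i\<in>A. v i * (g i (y(j := y j + z)) - g i y - g' i y * z)) \<le> C * absval z ^ 2"
    using assms yz by (intro absval_combination_le) (auto simp: taylor_on_def)
  also have "(\<Sum>i\<in>A. v i * (g i (y(j := y j + z)) - g i y - g' i y * z)) =
      (\<Sum>i\<in>A. v i * g i (y(j := y j + z))) - (\<Sum>i\<in>A. v i * g i y) - (\<Sum>i\<in>A. v i * g' i y) * z"
    by (simp add: sum_subtractf sum.distrib sum_distrib_left sum_distrib_right algebra_simps)
  finally show "absval ((\<Sum>i\<in>A. v i * g i (y(j := y j + z))) - (\<Sum>i\<in>A. v i * g i y)
      - (\<Sum>i\<in>A. v i * g' i y) * z) \<le> C * absval z ^ 2" .
qed

lemma max_lipschitz_on_combination:
  assumes "\<And>i. i \<in> A \<Longrightarrow> absval (v i) \<le> 1" "\<And>i. i \<in> A \<Longrightarrow> max_lipschitz_on J B C (g i)" "0 \<le> C"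
  shows "max_lipschitz_on J B C (\<lambda>y. \<Sum>i\<in>A. v i * g i y)"
  unfolding max_lipschitz_on_def
proof (intro ballI allI impI)
  fix y y' and e :: real assume y: "y \<in> B" "y' \<in> B" "0 \<le> e" "\<forall>i\<in>J. absval (y i - y' i) \<le> e"
  have "absval (\<Sum>i\<in>A. v i * (g i y - g i y')) \<le> C * e"
    using assms y by (intro absval_combination_le) (auto simp: max_lipschitz_on_def)
  then show "absval ((\<Sum>i\<in>A. v i * g i y) - (\<Sum>i\<in>A. v i * g i y')) \<le> C * e"
    by (simp add: sum_subtractf algebra_simps)
qed

text \<open>
  The linear forms have no common zero on the unit sphere, which is compact; so the largest of them is
  bounded below there.
\<close>

lemma linear_forms_bounded_below:
  fixes F :: "'s \<Rightarrow> 'i \<Rightarrow> 'a::nonarch_local_field"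
  assumes I: "finite I"
    and F: "\<And>v. v \<in> Kspace I \<Longrightarrow> \<exists>i\<in>I. v i \<noteq> 0 \<Longrightarrow> \<exists>s\<in>S. (\<Sum>i\<in>I. v i * F s i) \<noteq> 0"
  obtains c where "0 < c" "\<And>v. v \<in> Kspace I \<Longrightarrow> \<forall>i\<in>I. absval (v i) \<le> 1 \<Longrightarrow> \<exists>i\<in>I. absval (v i) = 1 \<Longrightarrow>
    \<exists>s\<in>S. c < absval (\<Sum>i\<in>I. v i * F s i)"
proof -
  let ?L = "\<lambda>v s. \<Sum>i\<in>I. v i * F s i"
  let ?B = "kball I (\<lambda>i\<in>I. 0 :: 'a) 1"
  have "\<exists>e t. 0 < e \<and> 0 < t \<and>
      (\<forall>w\<in>kball I v e. (\<exists>i\<in>I. absval (w i) = 1) \<longrightarrow> (\<exists>s\<in>S. t < absval (?L w s)))"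
    if v: "v \<in> ?B" for v
  proof (cases "\<exists>i\<in>I. v i \<noteq> 0")
    case True
    then obtain s where s: "s \<in> S" "?L v s \<noteq> 0"
      using F[of v] v by (auto simp: kball_def)
    let ?t = "absval (?L v s)"
    have t: "0 < ?t" using s(2) by simp
    define D where "D = 1 + (\<Sum>i\<in>I. absval (F s i))"
    have D: "0 < D" "\<And>i. i \<in> I \<Longrightarrow> absval (F s i) \<le> D"
    proof -
      have "0 \<le> (\<Sum>i\<in>I. absval (F s i))" by (intro sum_nonneg) auto
      then show "0 < D" by (simp add: D_def)
      fix i assume "i \<in> I"
      then have "absval (F s i) \<le> (\<Sum>i\<in>I. absval (F s i))"
        using I by (intro member_le_sum) auto
      then show "absval (F s i) \<le> D" by (simp add: D_def)
    qed
    have "?t / 2 < absval (?L w s)" if w: "w \<in> kball I v (?t / (2 * D))" for w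
    proof -
      have "absval (\<Sum>i\<in>I. (w i - v i) * F s i) \<le> ?t / 2"
      proof (rule absval_sum_le)
        fix i assume i: "i \<in> I"
        have "absval (w i - v i) * absval (F s i) \<le> ?t / (2 * D) * D"
          using w i D t by (intro mult_mono) (auto simp: kball_def)
        then show "absval ((w i - v i) * F s i) \<le> ?t / 2"
          using D(1) by (simp add: absval_mult)
      qed simp
      also have "(\<Sum>i\<in>I. (w i - v i) * F s i) = ?L w s - ?L v s"
        by (simp add: sum_subtractf algebra_simps)
      finally have "absval (?L w s - ?L v s) < ?t"
        using t by linarith
      then have "absval (?L w s) = ?t"
        by (rule absval_eq_of_dominant)
      then show ?thesis
        using t by linarith
    qed
    then show ?thesis
      using t D(1) s(1) by (intro exI[of _ "?t / (2 * D)"] exI[of _ "?t / 2"]) auto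
  next
    case False
    have "absval (w i) \<le> 1 / 2" if "w \<in> kball I v (1 / 2)" "i \<in> I" for w i
      using that False by (auto simp: kball_def)
    then show ?thesis
      by (intro exI[of _ "1 / 2"] exI[of _ 1]) fastforce
  qed
  then have "\<forall>v\<in>?B. \<exists>et. 0 < fst et \<and> 0 < snd et \<and>
      (\<forall>w\<in>kball I v (fst et). (\<exists>i\<in>I. absval (w i) = 1) \<longrightarrow> (\<exists>s\<in>S. snd et < absval (?L w s)))"
    by simp
  from bchoice[OF this] obtain et where et: "\<And>v. v \<in> ?B \<Longrightarrow> 0 < fst (et v) \<and> 0 < snd (et v) \<and>
      (\<forall>w\<in>kball I v (fst (et v)). (\<exists>i\<in>I. absval (w i) = 1) \<longrightarrow> (\<exists>s\<in>S. snd (et v) < absval (?L w s)))"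
    by blast
  obtain T where T: "finite T" "T \<subseteq> ?B" "?B \<subseteq> (\<Union>v\<in>T. kball I v (fst (et v)))"
    by (rule compactin_finite_kball_cover[OF I compactin_kball]) (use et in blast)
  define c where "c = Min (insert 1 ((\<lambda>v. snd (et v)) ` T))"
  have c: "0 < c" "\<And>v. v \<in> T \<Longrightarrow> c \<le> snd (et v)"
    using T(1,2) et by (auto simp: c_def)
  show ?thesis
  proof (rule that[OF c(1)])
    fix w :: "'i \<Rightarrow> 'a"
    assume w: "w \<in> Kspace I" "\<forall>i\<in>I. absval (w i) \<le> 1" "\<exists>i\<in>I. absval (w i) = 1"
    then have "w \<in> ?B"
      by (auto simp: kball_def)
    then obtain v where v: "v \<in> T" "w \<in> kball I v (fst (et v))"
      using T(3) by blast
    then obtain s where "s \<in> S" "snd (et v) < absval (?L w s)"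
      using et[OF subsetD[OF T(2) v(1)]] w(3) by blast
    then show "\<exists>s\<in>S. c < absval (?L w s)"
      using c(2)[OF v(1)] by (intro bexI[of _ s]) auto
  qed
qed

context oscillatory
begin

text \<open>
  The phase of a frequency \<open>x\<close> is \<open>l (v \<cdot> f)\<close> with \<open>l\<close> a coordinate of \<open>x\<close> of maximal norm and
  \<open>v = x / l\<close> on the unit sphere.  By compactness all constants are uniform in \<open>v\<close>.
\<close>

lemma decay_near_point_of_finite_type:
  fixes f :: "('i \<Rightarrow> 'a) \<Rightarrow> nat \<Rightarrow> 'a"
  assumes an: "\<And>i. i < n \<Longrightarrow> K_analytic_on I X (\<lambda>y. f y i)" and y0: "y0 \<in> X" and r0: "0 < r0"
    and type: "\<And>v. v \<in> Kspace {..<n} \<Longrightarrow> \<exists>i<n. v i \<noteq> 0 \<Longrightarrow>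
      \<exists>js. set js \<subseteq> I \<and> js \<noteq> [] \<and> length js \<le> k \<and>
        (\<Sum>i<n. v i * fold partial_deriv js (\<lambda>y. f y i) y0) \<noteq> 0"
  shows "\<exists>r K. 0 < r \<and> r \<le> r0 \<and> 0 \<le> K \<and>
    (\<forall>x. 1 \<le> max_norm {..<n} x \<longrightarrow>
      norm (LINT y:kball I y0 r|H. \<psi> (\<Sum>i<n. x i * f y i)) \<le> K * max_norm {..<n} x powr (- ((1 / 3) ^ k) / 2))"
proof (cases "n = 0")
  case True
  then show ?thesis
    using r0 by (intro exI[of _ r0] exI[of _ 0]) (auto simp: max_norm_def)
next
  case False
  \<comment> \<open>The iterated partial derivatives of the coordinate functions, on a ball common to all of them.\<close>
  define F where "F js i = fold partial_deriv js (\<lambda>y. f y i)" for js i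
  define P where "P = {js. set js \<subseteq> I \<and> length js \<le> k}"
  have P: "finite P"
    unfolding P_def using finite_lists_length_le[OF finite_I] .
  have "\<exists>r>0. \<forall>js. set js \<subseteq> I \<longrightarrow> (\<exists>C\<ge>0. max_lipschitz_on I (kball I y0 r) C (F js i) \<and>
      (\<forall>j\<in>I. taylor_on (kball I y0 r) r C j (F js i) (F (js @ [j]) i)))" if i: "i < n" for i
    unfolding F_def
    by (rule K_analytic_on_derivatives[OF finite_I an[OF i] y0]) blast
  then obtain R where R: "\<And>i. i < n \<Longrightarrow> 0 < R i" and
    "\<And>i js. i < n \<Longrightarrow> set js \<subseteq> I \<Longrightarrow> \<exists>C\<ge>0. max_lipschitz_on I (kball I y0 (R i)) C (F js i) \<and>
      (\<forall>j\<in>I. taylor_on (kball I y0 (R i)) (R i) C j (F js i) (F (js @ [j]) i))"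
    by metis
  then obtain C where C: "\<And>i js. i < n \<Longrightarrow> set js \<subseteq> I \<Longrightarrow> 0 \<le> C i js"
    "\<And>i js. i < n \<Longrightarrow> set js \<subseteq> I \<Longrightarrow> max_lipschitz_on I (kball I y0 (R i)) (C i js) (F js i)"
    "\<And>i js j. i < n \<Longrightarrow> set js \<subseteq> I \<Longrightarrow> j \<in> I \<Longrightarrow>
      taylor_on (kball I y0 (R i)) (R i) (C i js) j (F js i) (F (js @ [j]) i)"
    by metis
  define C0 where "C0 = (\<Sum>p\<in>{..<n} \<times> P. C (fst p) (snd p))"
  have C0: "0 \<le> C0" "\<And>i js. i < n \<Longrightarrow> js \<in> P \<Longrightarrow> C i js \<le> C0"
  proof -
    show "0 \<le> C0"
      unfolding C0_def using C(1) by (intro sum_nonneg) (auto simp: P_def)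
    fix i js assume "i < n" "js \<in> P"
    then show "C i js \<le> C0"
      unfolding C0_def using C(1) P member_le_sum[of "(i, js)" "{..<n} \<times> P" "\<lambda>p. C (fst p) (snd p)"]
      by (auto simp: P_def)
  qed
  obtain c where c: "0 < c" "\<And>v. v \<in> Kspace {..<n} \<Longrightarrow> \<forall>i\<in>{..<n}. absval (v i) \<le> 1 \<Longrightarrow>
      \<exists>i\<in>{..<n}. absval (v i) = 1 \<Longrightarrow> \<exists>js\<in>P - {[]}. c < absval (\<Sum>i<n. v i * F js i y0)"
  proof (rule linear_forms_bounded_below[of "{..<n}" "P - {[]}" "\<lambda>js i. F js i y0"])
    show "\<exists>js\<in>P - {[]}. (\<Sum>i<n. v i * F js i y0) \<noteq> 0"
      if "v \<in> Kspace {..<n}" "\<exists>i\<in>{..<n}. v i \<noteq> 0" for v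
      using type[OF that(1)] that(2) unfolding F_def P_def by blast
  qed (simp, blast)
  define r where "r = Min (insert (min r0 (c / (C0 + 1))) (R ` {..<n}))"
  have r: "0 < r" "r \<le> r0" "r \<le> c / (C0 + 1)" "\<And>i. i < n \<Longrightarrow> r \<le> R i"
  proof -
    have "r \<le> min r0 (c / (C0 + 1))"
      unfolding r_def by (intro Min_le) auto
    then show "r \<le> r0" "r \<le> c / (C0 + 1)"
      by simp_all
  qed (use r0 c(1) C0(1) R in \<open>auto simp: r_def\<close>)
  have "C0 * r < (C0 + 1) * r"
    using r(1) by (simp add: distrib_right)
  also have "\<dots> \<le> c"
    using r(3) C0(1) by (simp add: pos_le_divide_eq mult.commute)
  finally have C0r: "C0 * r < c" .
  let ?B = "kball I y0 r"
  have y0B: "y0 \<in> ?B"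
  proof -
    have "openin (Ktop I) X"
      using an[of 0] False unfolding K_analytic_on_def by blast
    then show ?thesis
      using y0 r(1) openin_Ktop_iff[OF finite_I, of X] by (intro center_in_kball) auto
  qed
  have sub: "?B \<subseteq> kball I y0 (R i)" if "i < n" for i
    using kball_mono[OF r(4)[OF that]] .
  let ?\<Phi> = "\<lambda>v js y. \<Sum>i<n. v i * F js i y"
  have lip: "max_lipschitz_on I ?B C0 (?\<Phi> v js)" if "\<And>i. i < n \<Longrightarrow> absval (v i) \<le> 1" "js \<in> P" for v js
    using that C0 sub by (intro max_lipschitz_on_combination max_lipschitz_on_mono[OF C(2)]) (auto simp: P_def)
  have taylor: "taylor_on ?B r C0 j (?\<Phi> v js) (?\<Phi> v (js @ [j]))"
    if "\<And>i. i < n \<Longrightarrow> absval (v i) \<le> 1" "js \<in> P" "j \<in> I" for v js j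
    using that C0 sub r(4) by (intro taylor_on_combination taylor_on_mono[OF C(3)]) (auto simp: P_def)
  have chain: "deriv_chain I ?B r C0 c js (?\<Phi> v js1)"
    if v1: "\<And>i. i < n \<Longrightarrow> absval (v i) \<le> 1" and "js1 @ js \<in> P" "c < absval (?\<Phi> v (js1 @ js) y0)" for v js1 js
    using that(2-)
  proof (induction js arbitrary: js1)
    case Nil
    have "c \<le> absval (?\<Phi> v js1 y)" if y: "y \<in> ?B" for y
    proof -
      have "absval (?\<Phi> v js1 y - ?\<Phi> v js1 y0) \<le> C0 * r"
        using lip[where js = js1 and v = v, OF v1] Nil y y0B r(1)
        unfolding max_lipschitz_on_def by (auto simp: kball_def)
      then have "absval (?\<Phi> v js1 y - ?\<Phi> v js1 y0) < absval (?\<Phi> v js1 y0)"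
        using C0r Nil by simp
      then have "absval (?\<Phi> v js1 y) = absval (?\<Phi> v js1 y0)"
        by (rule absval_eq_of_dominant)
      then show ?thesis
        using Nil by simp
    qed
    then show ?case
      using lip[where js = js1 and v = v, OF v1] Nil by simp
  next
    case (Cons j js)
    have "deriv_chain I ?B r C0 c js (?\<Phi> v (js1 @ [j]))"
      using Cons.prems by (intro Cons.IH) auto
    moreover have j: "j \<in> I" and js1: "js1 \<in> P"
      using Cons.prems by (auto simp: P_def)
    moreover have "max_lipschitz_on I ?B C0 (?\<Phi> v js1)"
      by (rule lip[OF v1 js1])
    moreover have "taylor_on ?B r C0 j (?\<Phi> v js1) (?\<Phi> v (js1 @ [j]))"
      by (rule taylor[OF v1 js1 j])
    ultimately show ?case
      unfolding deriv_chain.simps by blast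
  qed
  have "\<exists>A. \<forall>js. 0 \<le> A js \<and> (\<forall>g \<epsilon>. deriv_chain I ?B r C0 c js g \<longrightarrow> 0 < \<epsilon> \<longrightarrow> \<epsilon> \<le> 1 \<longrightarrow>
    measure H {y \<in> ?B. absval (g y) \<le> \<epsilon>} \<le> A js * \<epsilon> powr ((1 / 3) ^ length js))"
    by (rule choice) (intro allI sublevel_estimate r(1) C0(1) c(1))
  then obtain A where A: "\<And>js. 0 \<le> A js" "\<And>js g \<epsilon>. deriv_chain I ?B r C0 c js g \<Longrightarrow> 0 < \<epsilon> \<Longrightarrow> \<epsilon> \<le> 1 \<Longrightarrow>
    measure H {y \<in> ?B. absval (g y) \<le> \<epsilon>} \<le> A js * \<epsilon> powr ((1 / 3) ^ length js)"
    by blast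
  let ?\<delta> = "(1 / 3 :: real) ^ k"
  define A0 where "A0 = (\<Sum>js\<in>P. A js)"
  have A0: "0 \<le> A0" "\<And>js. js \<in> P \<Longrightarrow> A js \<le> A0"
    unfolding A0_def using A(1) P by (auto intro: sum_nonneg member_le_sum)
  obtain K where K: "0 \<le> K" "\<And>\<phi> g j l. max_lipschitz_on I ?B C0 \<phi> \<Longrightarrow> max_lipschitz_on I ?B C0 g \<Longrightarrow>
    taylor_on ?B r C0 j \<phi> g \<Longrightarrow> j \<in> I \<Longrightarrow>
    (\<forall>\<epsilon>. 0 < \<epsilon> \<longrightarrow> \<epsilon> \<le> 1 \<longrightarrow> measure H {y \<in> ?B. absval (g y) \<le> \<epsilon>} \<le> A0 * \<epsilon> powr ?\<delta>) \<Longrightarrow>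
    1 \<le> absval l \<Longrightarrow> norm (LINT y:?B|H. \<psi> (l * \<phi> y)) \<le> K * absval l powr (- ?\<delta> / 2)"
  proof -
    have "0 < ?\<delta>" by simp
    from oscillatory_integral_le[OF r(1) C0(1) A0(1) this, of y0] that show ?thesis
      by blast
  qed
  have decay: "norm (LINT y:?B|H. \<psi> (\<Sum>i<n. x i * f y i)) \<le> K * max_norm {..<n} x powr (- ?\<delta> / 2)"
    if x: "1 \<le> max_norm {..<n} x" for x
  proof -
    obtain i0 where i0: "i0 < n" "absval (x i0) = max_norm {..<n} x"
      using max_norm_attained[of "{..<n}" x] x by auto
    define l where "l = x i0"
    have l: "1 \<le> absval l" "l \<noteq> 0" "absval l = max_norm {..<n} x"
      using x i0(2) by (auto simp: l_def)
    define v where "v = (\<lambda>i\<in>{..<n}. x i / l)"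
    have v1: "absval (v i) \<le> 1" if "i < n" for i
    proof -
      have "absval (x i) \<le> absval l"
        using absval_le_max_norm[of "{..<n}" i x] that l(3) by simp
      then show ?thesis
        using that l(1,2) by (simp add: v_def absval_divide divide_le_eq_1)
    qed
    have "v \<in> Kspace {..<n}" "absval (v i0) = 1"
      using i0(1) l by (auto simp: v_def l_def)
    then obtain js' where js': "js' \<in> P" "js' \<noteq> []" "c < absval (?\<Phi> v js' y0)"
      using c(2)[of v] v1 i0(1) by blast
    then obtain j js where js: "js' = j # js"
      by (cases js') auto
    have jI: "j \<in> I" "[j] \<in> P" "[] \<in> P" "js \<in> P"
      using js'(1) by (auto simp: js P_def)
    have ch: "deriv_chain I ?B r C0 c js (?\<Phi> v [j])"
      using js' v1 by (intro chain) (auto simp: js)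
    have "norm (LINT y:?B|H. \<psi> (l * ?\<Phi> v [] y)) \<le> K * absval l powr (- ?\<delta> / 2)"
    proof (rule K(2)[OF _ _ _ jI(1) _ l(1)])
      show "max_lipschitz_on I ?B C0 (?\<Phi> v [])" "max_lipschitz_on I ?B C0 (?\<Phi> v [j])"
        using v1 jI by (auto intro!: lip)
      show "taylor_on ?B r C0 j (?\<Phi> v []) (?\<Phi> v [j])"
        using taylor[of v "[]" j] v1 jI by simp
      show "\<forall>\<epsilon>. 0 < \<epsilon> \<longrightarrow> \<epsilon> \<le> 1 \<longrightarrow> measure H {y \<in> ?B. absval (?\<Phi> v [j] y) \<le> \<epsilon>} \<le> A0 * \<epsilon> powr ?\<delta>"
      proof (intro allI impI)
        fix \<epsilon> :: real assume \<epsilon>: "0 < \<epsilon>" "\<epsilon> \<le> 1"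
        have "measure H {y \<in> ?B. absval (?\<Phi> v [j] y) \<le> \<epsilon>} \<le> A js * \<epsilon> powr ((1 / 3) ^ length js)"
          using A(2)[OF ch \<epsilon>] .
        also have "\<dots> \<le> A0 * \<epsilon> powr ?\<delta>"
        proof (intro mult_mono A0)
          have "?\<delta> \<le> (1 / 3) ^ length js"
            using js'(1) by (intro power_decreasing) (auto simp: js P_def)
          then show "\<epsilon> powr ((1 / 3) ^ length js) \<le> \<epsilon> powr ?\<delta>"
            using \<epsilon> by (intro powr_mono') auto
        qed (use jI in auto)
        finally show "measure H {y \<in> ?B. absval (?\<Phi> v [j] y) \<le> \<epsilon>} \<le> A0 * \<epsilon> powr ?\<delta>" .
      qed
    qed
    moreover have "l * ?\<Phi> v [] y = (\<Sum>i<n. x i * f y i)" for y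
      using l(2) by (auto simp: v_def F_def sum_distrib_left intro!: sum.cong)
    ultimately show ?thesis
      by (simp add: l(3))
  qed
  then show ?thesis
    using r(1,2) K(1) by blast
qed

end

section \<open>Decay of the Fourier transform of the measure on a manifold\<close>

lemma multi_deriv_eq_fold:
  fixes g :: "(nat \<Rightarrow> 'a::nonarch_local_field) \<Rightarrow> 'a"
  assumes "finite J"
  obtains js where "set js \<subseteq> J" "length js = (\<Sum>j\<in>J. \<alpha> j)"
    "\<And>g :: (nat \<Rightarrow> 'a) \<Rightarrow> 'a. multi_deriv J \<alpha> g = fold partial_deriv js g"
proof -
  have rep: "fold f (replicate m j) g = (f j ^^ m) g" for f :: "nat \<Rightarrow> 'b \<Rightarrow> 'b" and m j g
    by (induction m arbitrary: g) (simp_all add: funpow_swap1)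
  have fold_concat: "fold (\<lambda>j. f j ^^ \<alpha> j) L g = fold f (concat (map (\<lambda>j. replicate (\<alpha> j) j) L)) g"
    for f :: "nat \<Rightarrow> 'b \<Rightarrow> 'b" and L g
    by (induction L arbitrary: g) (simp_all add: rep)
  show ?thesis
  proof (rule that[of "concat (map (\<lambda>j. replicate (\<alpha> j) j) (sorted_list_of_set J))"])
    have "length (concat (map (\<lambda>j. replicate (\<alpha> j) j) (sorted_list_of_set J))) =
        sum_list (map \<alpha> (sorted_list_of_set J))"
      by (simp add: length_concat comp_def)
    also have "\<dots> = (\<Sum>j\<in>J. \<alpha> j)"
      using assms by (simp add: sum_list_distinct_conv_sum_set)
    finally show "length (concat (map (\<lambda>j. replicate (\<alpha> j) j) (sorted_list_of_set J))) = (\<Sum>j\<in>J. \<alpha> j)" .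
  qed (use assms in \<open>auto simp: multi_deriv_def fold_concat\<close>)
qed

lemma openin_subtopology_Ktop_iff:
  fixes M :: "('i \<Rightarrow> 'a::nonarch_local_field) set"
  assumes I: "finite I" and M: "M \<subseteq> Kspace I"
  shows "openin (subtopology (Ktop I) M) U \<longleftrightarrow> U \<subseteq> M \<and> (\<forall>x\<in>U. \<exists>e>0. M \<inter> kball I x e \<subseteq> U)"
proof
  assume "openin (subtopology (Ktop I) M) U"
  then obtain T where T: "openin (Ktop I) T" "U = T \<inter> M"
    unfolding openin_subtopology by blast
  then show "U \<subseteq> M \<and> (\<forall>x\<in>U. \<exists>e>0. M \<inter> kball I x e \<subseteq> U)"
    unfolding openin_Ktop_iff[OF I] by blast
next
  assume U: "U \<subseteq> M \<and> (\<forall>x\<in>U. \<exists>e>0. M \<inter> kball I x e \<subseteq> U)"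
  then obtain e where e: "\<And>x. x \<in> U \<Longrightarrow> 0 < e x \<and> M \<inter> kball I x (e x) \<subseteq> U"
    by metis
  let ?T = "\<Union>x\<in>U. kball I x (e x)"
  have "x \<in> kball I x (e x)" if "x \<in> U" for x
    using that U M e[OF that] by (intro center_in_kball) auto
  then have "U = ?T \<inter> M"
    using U e by blast
  moreover have "openin (Ktop I) ?T"
    using e openin_kball[OF I] by (intro openin_Union) auto
  ultimately show "openin (subtopology (Ktop I) M) U"
    unfolding openin_subtopology by blast
qed

lemma absval_dot_le:
  assumes "finite I" "0 \<le> e" "\<And>i. i \<in> I \<Longrightarrow> absval (t i :: 'a::nonarch_local_field) \<le> e"
  shows "absval (\<Sum>i\<in>I. x i * t i) \<le> max_norm I x * e"
proof (rule absval_sum_le)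
  show "0 \<le> max_norm I x * e"
    using assms by (intro mult_nonneg_nonneg max_norm_nonneg)
  fix i assume "i \<in> I"
  then show "absval (x i * t i) \<le> max_norm I x * e"
    unfolding absval_mult using assms by (intro mult_mono absval_le_max_norm max_norm_nonneg) auto
qed

lemma kball_iff_max_norm:
  "finite I \<Longrightarrow> 0 \<le> e \<Longrightarrow> y \<in> kball I x e \<longleftrightarrow> y \<in> Kspace I \<and> max_norm I (\<lambda>i. y i - x i) \<le> e"
  by (simp add: kball_def max_norm_le_iff)

lemma (in unramified_character) psi_dot_cong:
  assumes "finite I" "0 \<le> e" "\<And>i. i \<in> I \<Longrightarrow> absval (\<xi> i - \<eta> i) \<le> e" "max_norm I x * e < 1"
  shows "\<psi> (\<Sum>i\<in>I. x i * \<xi> i) = \<psi> (\<Sum>i\<in>I. x i * \<eta> i)"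
proof (rule psi_cong)
  have "absval (\<Sum>i\<in>I. x i * (\<xi> i - \<eta> i)) \<le> max_norm I x * e"
    using assms by (intro absval_dot_le)
  then show "absval ((\<Sum>i\<in>I. x i * \<xi> i) - (\<Sum>i\<in>I. x i * \<eta> i)) < 1"
    using assms(4) by (simp add: sum_subtractf algebra_simps)
qed

lemma (in unramified_character) psi_dot_measurable:
  fixes \<mu> :: "('i \<Rightarrow> 'a) measure"
  assumes I: "finite I" and M: "M \<subseteq> Kspace I"
    and \<mu>: "space \<mu> = M" "sets \<mu> = borel_sets (subtopology (Ktop I) M)"
  shows "(\<lambda>\<xi>. \<psi> (\<Sum>i\<in>I. x i * \<xi> i)) \<in> borel_measurable \<mu>"
proof (rule measurable_if_preimages_open[OF _ \<mu>(2)])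
  show "space \<mu> = topspace (subtopology (Ktop I) M)"
    using \<mu>(1) M by auto
  fix S
  let ?e = "1 / (max_norm I x + 1)"
  have e: "0 < ?e" "max_norm I x * ?e < 1"
    using max_norm_nonneg[OF I, of x] by (auto simp: divide_simps)
  show "openin (subtopology (Ktop I) M) {\<xi> \<in> topspace (subtopology (Ktop I) M). \<psi> (\<Sum>i\<in>I. x i * \<xi> i) \<in> S}"
    unfolding openin_subtopology_Ktop_iff[OF I M]
  proof (intro conjI ballI)
    fix \<xi> assume \<xi>: "\<xi> \<in> {\<xi> \<in> topspace (subtopology (Ktop I) M). \<psi> (\<Sum>i\<in>I. x i * \<xi> i) \<in> S}"
    have "\<psi> (\<Sum>i\<in>I. x i * \<eta> i) = \<psi> (\<Sum>i\<in>I. x i * \<xi> i)" if "\<eta> \<in> kball I \<xi> ?e" for \<eta>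
      using that e I by (intro psi_dot_cong[of I ?e]) (auto simp: kball_def)
    then show "\<exists>e>0. M \<inter> kball I \<xi> e \<subseteq> {\<xi> \<in> topspace (subtopology (Ktop I) M). \<psi> (\<Sum>i\<in>I. x i * \<xi> i) \<in> S}"
      using \<xi> e(1) M by (intro exI[of _ ?e]) auto
  qed auto
qed

text \<open>
  For \<open>\<bar>x\<bar> < 1\<close> the integral is bounded by the measure of \<open>V\<close>, so only large frequencies need a
  condition.
\<close>

definition decaying ::
    "('a::nonarch_local_field \<Rightarrow> complex) \<Rightarrow> nat \<Rightarrow> real \<Rightarrow> (nat \<Rightarrow> 'a) measure \<Rightarrow> (nat \<Rightarrow> 'a) set \<Rightarrow> bool"
  where "decaying \<psi> n \<delta> \<mu> V \<longleftrightarrow> V \<in> fmeasurable \<mu> \<and>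
    (\<exists>K\<ge>0. \<forall>x. 1 \<le> max_norm {..<n} x \<longrightarrow>
      norm (LINT \<xi>:V|\<mu>. \<psi> (\<Sum>i<n. x i * \<xi> i)) \<le> K * max_norm {..<n} x powr (- \<delta>))"

text \<open>
  An isometric chart maps the intersection of \<open>M\<close> with a small ball of \<open>K\<^sup>n\<close> onto a ball, and the
  induced measure to Haar measure; the Fourier integral becomes an oscillatory integral over that ball.
\<close>

lemma decaying_ball_in_manifold:
  fixes haar :: "nat set \<Rightarrow> (nat \<Rightarrow> 'a::nonarch_local_field) measure"
    and M :: "(nat \<Rightarrow> 'a) set"
  assumes \<psi>: "unramified_character \<psi>" and haar: "normalized_haar J (haar J)"
    and M: "M \<subseteq> Kspace {..<n}"
    and \<mu>: "space \<mu> = M" "sets \<mu> = borel_sets (subtopology (Ktop {..<n}) M)"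
    and chart: "analytic_chart n d M U J f"
    and iso: "\<And>x y. x \<in> U \<Longrightarrow> y \<in> U \<Longrightarrow> max_norm J (\<lambda>i. x i - y i) = max_norm {..<n} (\<lambda>i. x i - y i)"
    and meas: "\<And>A. A \<in> sets \<mu> \<Longrightarrow> A \<subseteq> U \<Longrightarrow> emeasure \<mu> A = emeasure (haar J) ((\<lambda>x. restrict x J) ` A)"
    and x0: "x0 \<in> U" "x0 \<in> M0" and M0: "openin (subtopology (Ktop {..<n}) M) M0"
    and type: "type_at_le n d M x0 k"
  shows "\<exists>r>0. M \<inter> kball {..<n} x0 r \<subseteq> M0 \<and>
    decaying \<psi> n ((1 / 3) ^ k / 2) \<mu> (M \<inter> kball {..<n} x0 r)"
proof -
  let ?p = "\<lambda>x :: nat \<Rightarrow> 'a. restrict x J"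
  have J: "J \<subseteq> {..<n}" "finite J"
    using chart finite_subset by (auto simp: analytic_chart_def)
  interpret oscillatory J "haar J" \<psi>
    using \<psi> haar J(2) by (simp add: oscillatory_def haar_space_def)
  have UM: "openin (subtopology (Ktop {..<n}) M) (U \<inter> M0)"
    using chart M0 by (auto simp: analytic_chart_def)
  then have U_sub: "U \<inter> M0 \<subseteq> M"
    using openin_subtopology_Ktop_iff[OF _ M] by auto
  have U_M: "U \<subseteq> M"
    using chart openin_subtopology_Ktop_iff[OF _ M, of U] by (auto simp: analytic_chart_def)
  have fp: "f (?p x) = x" if "x \<in> U" for x
    using chart that by (auto simp: analytic_chart_def)
  obtain ra where ra: "0 < ra" "M \<inter> kball {..<n} x0 ra \<subseteq> U \<inter> M0"
    using UM x0 unfolding openin_subtopology_Ktop_iff[OF finite_lessThan M] by blast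
  obtain rb where rb: "0 < rb" "kball J (?p x0) rb \<subseteq> ?p ` U"
    using chart x0 unfolding analytic_chart_def openin_Ktop_iff[OF J(2)] by blast
  have type': "\<exists>js. set js \<subseteq> J \<and> js \<noteq> [] \<and> length js \<le> k \<and>
        (\<Sum>i<n. v i * fold partial_deriv js (\<lambda>y. f y i) (?p x0)) \<noteq> 0"
    if v: "v \<in> Kspace {..<n}" "\<exists>i<n. v i \<noteq> 0" for v
  proof -
    obtain \<alpha> where \<alpha>: "0 < (\<Sum>j\<in>J. \<alpha> j)" "(\<Sum>j\<in>J. \<alpha> j) \<le> k"
      "(\<Sum>i<n. v i * multi_deriv J \<alpha> (\<lambda>y. f y i) (?p x0)) \<noteq> 0"
      using type chart x0(1) v unfolding type_at_le_def by blast
    obtain js where "set js \<subseteq> J" "length js = (\<Sum>j\<in>J. \<alpha> j)"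
      "\<And>g :: (nat \<Rightarrow> 'a) \<Rightarrow> 'a. multi_deriv J \<alpha> g = fold partial_deriv js g"
      by (rule multi_deriv_eq_fold[OF J(2), of \<alpha>]) blast
    then show ?thesis
      using \<alpha> by (intro exI[of _ js]) auto
  qed
  have "\<exists>r K. 0 < r \<and> r \<le> min ra rb \<and> 0 \<le> K \<and>
    (\<forall>x. 1 \<le> max_norm {..<n} x \<longrightarrow>
      norm (LINT y:kball J (?p x0) r|haar J. \<psi> (\<Sum>i<n. x i * f y i)) \<le> K * max_norm {..<n} x powr (- ((1 / 3) ^ k) / 2))"
  proof (rule decay_near_point_of_finite_type[OF _ _ _ type'])
    show "K_analytic_on J (?p ` U) (\<lambda>y. f y i)" if "i < n" for i
      using chart that by (auto simp: analytic_chart_def)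
  qed (use x0 ra rb in auto)
  then obtain r K where r: "0 < r" "r \<le> ra" "r \<le> rb" "0 \<le> K"
    and K: "\<And>x. 1 \<le> max_norm {..<n} x \<Longrightarrow>
      norm (LINT y:kball J (?p x0) r|haar J. \<psi> (\<Sum>i<n. x i * f y i)) \<le> K * max_norm {..<n} x powr (- ((1 / 3) ^ k) / 2)"
    by auto
  let ?B = "kball J (?p x0) r" and ?V = "M \<inter> kball {..<n} x0 r"
  have VU: "?V \<subseteq> U" "?V \<subseteq> M0"
    using ra(2) kball_mono[OF r(2), of "{..<n}" x0] by auto
  have BU: "?B \<subseteq> ?p ` U"
    using rb(2) kball_mono[OF r(3), of J "?p x0"] by auto
  have pV: "?p ` ?V = ?B"
  proof (intro equalityI subsetI)
    fix y assume y: "y \<in> ?B"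
    then obtain \<xi> where \<xi>: "\<xi> \<in> U" "y = ?p \<xi>"
      using BU by blast
    have "max_norm J (\<lambda>i. \<xi> i - x0 i) \<le> r"
      using y \<xi>(2) r(1) J(2) by (simp add: max_norm_le_iff kball_def)
    then have "max_norm {..<n} (\<lambda>i. \<xi> i - x0 i) \<le> r"
      using iso[OF \<xi>(1) x0(1)] by simp
    then have "\<xi> \<in> ?V"
      using \<xi>(1) U_M M r(1) by (auto simp: kball_iff_max_norm)
    then show "y \<in> ?p ` ?V"
      using \<xi>(2) by blast
  qed (use J in \<open>auto simp: kball_def\<close>)
  have V_open: "openin (subtopology (Ktop {..<n}) M) ?V"
    using openin_kball[of "{..<n}" r x0] r(1) by (auto simp: openin_subtopology)
  then have V_sets: "?V \<in> sets \<mu>"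
    unfolding \<mu>(2) borel_sets_def by (intro sigma_sets.Basic) simp
  have "emeasure \<mu> ?V = emeasure (haar J) ?B"
    using meas[OF V_sets VU(1)] pV by simp
  then have V_fm: "?V \<in> fmeasurable \<mu>"
    using V_sets emeasure_kball_finite[OF r(1), of "?p x0"] by (intro fmeasurableI) auto
  have p_meas: "?p \<in> measurable \<mu> (haar J)"
    unfolding sets_H borel_sets_def
  proof (rule measurable_sigma_sets[where \<Omega> = "Kspace J" and A = "{W. openin (Ktop J) W}"])
    show "sets (haar J) = sigma_sets (Kspace J) {W. openin (Ktop J) W}"
      by (simp add: sets_H borel_sets_def)
    show "{W :: (nat \<Rightarrow> 'a) set. openin (Ktop J) W} \<subseteq> Pow (Kspace J)"
      using openin_subset by fastforce
    show "?p \<in> space \<mu> \<rightarrow> Kspace J"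
      by auto
    fix W :: "(nat \<Rightarrow> 'a) set" assume "W \<in> {W. openin (Ktop J) W}"
    then have W: "openin (Ktop J) W" by simp
    have "openin (subtopology (Ktop {..<n}) M) (?p -` W \<inter> space \<mu>)"
      unfolding openin_subtopology_Ktop_iff[OF finite_lessThan M]
    proof (intro conjI ballI)
      fix \<xi> assume \<xi>: "\<xi> \<in> ?p -` W \<inter> space \<mu>"
      then obtain e where e: "0 < e" "kball J (?p \<xi>) e \<subseteq> W"
        using W unfolding openin_Ktop_iff[OF J(2)] by auto
      have "?p \<eta> \<in> kball J (?p \<xi>) e" if "\<eta> \<in> kball {..<n} \<xi> e" for \<eta>
        using that J(1) by (auto simp: kball_def)
      then have "M \<inter> kball {..<n} \<xi> e \<subseteq> ?p -` W \<inter> space \<mu>"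
        using e(2) \<mu>(1) by blast
      then show "\<exists>e>0. M \<inter> kball {..<n} \<xi> e \<subseteq> ?p -` W \<inter> space \<mu>"
        using e(1) by blast
    qed (use \<mu>(1) in auto)
    then show "?p -` W \<inter> space \<mu> \<in> sets \<mu>"
      unfolding \<mu>(2) borel_sets_def by (intro sigma_sets.Basic) simp
  qed
  have p_meas': "?p \<in> measurable (restrict_space \<mu> ?V) (restrict_space (haar J) ?B)"
    using p_meas pV by (intro measurable_restrict_space3) auto
  have spV: "space (restrict_space \<mu> ?V) = ?V"
    using \<mu>(1) by (auto simp: space_restrict_space)
  have BS: "?B \<inter> space (haar J) \<in> sets (haar J)" and VS: "?V \<inter> space \<mu> \<in> sets \<mu>"
    using kball_sets[OF r(1), of "?p x0"] V_sets by (auto intro: sets.Int)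
  \<comment> \<open>The projection carries \<open>\<mu>\<close> on the ball in \<open>M\<close> to Haar measure on the ball in \<open>K\<^sup>J\<close>.\<close>
  have distr: "distr (restrict_space \<mu> ?V) (restrict_space (haar J) ?B) ?p = restrict_space (haar J) ?B"
  proof (rule measure_eqI)
    fix A assume "A \<in> sets (distr (restrict_space \<mu> ?V) (restrict_space (haar J) ?B) ?p)"
    then have A: "A \<in> sets (restrict_space (haar J) ?B)"
      by simp
    then have A': "A \<subseteq> ?B" "A \<in> sets (haar J)"
      using sets_restrict_space_iff[OF BS, of A] by blast+
    let ?A = "?p -` A \<inter> space (restrict_space \<mu> ?V)"
    have A0: "?A \<in> sets (restrict_space \<mu> ?V)"
      using measurable_sets[OF p_meas' A] .
    then have A0': "?A \<subseteq> ?V" "?A \<in> sets \<mu>"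
      using sets_restrict_space_iff[OF VS, of ?A] by blast+
    have "?p ` ?A = A"
    proof (intro equalityI subsetI)
      fix y assume y: "y \<in> A"
      then have "y \<in> ?p ` ?V"
        using A'(1) unfolding pV by (rule rev_subsetD)
      then obtain \<xi> where "\<xi> \<in> ?V" "y = ?p \<xi>"
        by (rule imageE)
      then show "y \<in> ?p ` ?A"
        unfolding spV using y by (intro image_eqI[of _ _ \<xi>]) simp_all
    qed (elim imageE, simp)
    then have "emeasure \<mu> ?A = emeasure (haar J) A"
      using meas[OF A0'(2) subset_trans[OF A0'(1) VU(1)]] by simp
    moreover have "emeasure (restrict_space \<mu> ?V) ?A = emeasure \<mu> ?A"
      by (rule emeasure_restrict_space[OF VS A0'(1)])
    moreover have "emeasure (restrict_space (haar J) ?B) A = emeasure (haar J) A"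
      by (rule emeasure_restrict_space[OF BS A'(1)])
    ultimately show "emeasure (distr (restrict_space \<mu> ?V) (restrict_space (haar J) ?B) ?p) A
        = emeasure (restrict_space (haar J) ?B) A"
      using emeasure_distr[OF p_meas' A] by simp
  qed simp
  have transfer: "(LINT \<xi>:?V|\<mu>. \<psi> (\<Sum>i<n. x i * \<xi> i)) = (LINT y:?B|haar J. \<psi> (\<Sum>i<n. x i * f y i))" for x
  proof -
    let ?F = "\<lambda>y. \<psi> (\<Sum>i<n. x i * f y i)" and ?C = "max_norm {..<n} x"
    let ?F' = "\<lambda>y. if y \<in> ?B then \<psi> (1 * (\<Sum>i<n. x i * f y i)) else 0"
    \<comment> \<open>The inverse \<open>f\<close> of the isometric projection preserves distances.\<close>
    have lip: "max_lipschitz_on J ?B ?C (\<lambda>y. \<Sum>i<n. x i * f y i)"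
      unfolding max_lipschitz_on_def
    proof (intro ballI allI impI)
      fix y y' and e :: real
      assume y: "y \<in> ?B" "y' \<in> ?B" and e: "0 \<le> e" "\<forall>i\<in>J. absval (y i - y' i) \<le> e"
      obtain \<xi> \<xi>' where \<xi>: "\<xi> \<in> U" "y = ?p \<xi>" "\<xi>' \<in> U" "y' = ?p \<xi>'"
        using y BU by blast
      have "max_norm J (\<lambda>i. \<xi> i - \<xi>' i) \<le> e"
        using e \<xi> J(2) by (simp add: max_norm_le_iff)
      then have "\<forall>i<n. absval (\<xi> i - \<xi>' i) \<le> e"
        using iso[OF \<xi>(1,3)] e(1) max_norm_le_iff[of "{..<n}" e "\<lambda>i. \<xi> i - \<xi>' i"] by auto
      then have "absval (\<Sum>i<n. x i * (\<xi> i - \<xi>' i)) \<le> ?C * e"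
        using e(1) by (intro absval_dot_le) auto
      then show "absval ((\<Sum>i<n. x i * f y i) - (\<Sum>i<n. x i * f y' i)) \<le> ?C * e"
        using \<xi> fp by (simp add: sum_subtractf algebra_simps)
    qed
    have F': "?F' \<in> borel_measurable (haar J)"
      by (rule oscillating_measurable[OF lip r(1)]) (simp add: max_norm_nonneg)
    have "(LINT y:?B|haar J. ?F y) = (LINT y:?B|haar J. ?F' y)"
      by (intro set_lebesgue_integral_cong kball_sets r(1)) auto
    also have "\<dots> = integral\<^sup>L (restrict_space (haar J) ?B) ?F'"
      unfolding set_lebesgue_integral_def using BS
      by (intro integral_restrict_space[symmetric]) auto
    also have "\<dots> = integral\<^sup>L (distr (restrict_space \<mu> ?V) (restrict_space (haar J) ?B) ?p) ?F'"
      by (simp only: distr)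
    also have "\<dots> = integral\<^sup>L (restrict_space \<mu> ?V) (\<lambda>\<xi>. ?F' (?p \<xi>))"
      by (intro integral_distr p_meas' measurable_restrict_space1 F')
    also have "\<dots> = (LINT \<xi>:?V|\<mu>. ?F' (?p \<xi>))"
      unfolding set_lebesgue_integral_def by (rule integral_restrict_space[OF VS])
    also have "\<dots> = (LINT \<xi>:?V|\<mu>. \<psi> (\<Sum>i<n. x i * \<xi> i))"
    proof (intro set_lebesgue_integral_cong V_sets allI impI)
      fix \<xi> assume \<xi>: "\<xi> \<in> ?V"
      then have "?p \<xi> \<in> ?B" "f (?p \<xi>) = \<xi>"
        using pV fp VU(1) by blast+
      then show "?F' (?p \<xi>) = \<psi> (\<Sum>i<n. x i * \<xi> i)"
        by simp
    qed
    finally show ?thesis ..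
  qed
  have "decaying \<psi> n ((1 / 3) ^ k / 2) \<mu> ?V"
    unfolding decaying_def transfer using V_fm K r(4) by (intro conjI exI[of _ K]) auto
  then show ?thesis
    using r(1) VU(2) by blast
qed

text \<open>
  In the finite cover of \<open>M0\<close> by balls, the maximal balls are pairwise disjoint and still cover, so
  their Fourier integrals add up to that of \<open>M0\<close>.
\<close>

lemma decaying_compact_open:
  fixes \<mu> :: "(nat \<Rightarrow> 'a::nonarch_local_field) measure"
  assumes \<psi>: "unramified_character \<psi>" and M: "M \<subseteq> Kspace {..<n}"
    and \<mu>: "space \<mu> = M" "sets \<mu> = borel_sets (subtopology (Ktop {..<n}) M)"
    and M0: "compactin (Ktop {..<n}) M0" "M0 \<subseteq> M"
    and balls: "\<And>x0. x0 \<in> M0 \<Longrightarrow> \<exists>r>0. M \<inter> kball {..<n} x0 r \<subseteq> M0 \<and> decaying \<psi> n \<delta> \<mu> (M \<inter> kball {..<n} x0 r)"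
  shows "decaying \<psi> n \<delta> \<mu> M0"
proof -
  interpret unramified_character \<psi> by (rule \<psi>)
  obtain r where r: "\<And>x0. x0 \<in> M0 \<Longrightarrow> 0 < r x0 \<and> M \<inter> kball {..<n} x0 (r x0) \<subseteq> M0 \<and>
      decaying \<psi> n \<delta> \<mu> (M \<inter> kball {..<n} x0 (r x0))"
    using balls by metis
  let ?b = "\<lambda>x0. kball {..<n} x0 (r x0)"
  obtain T where T: "finite T" "T \<subseteq> M0" "M0 \<subseteq> (\<Union>x0\<in>T. ?b x0)"
    by (rule compactin_finite_kball_cover[OF finite_lessThan M0(1)]) (use r in blast)
  define \<V> where "\<V> = (\<lambda>x0. M \<inter> ?b x0) ` T"
  define \<V>' where "\<V>' = {V \<in> \<V>. \<forall>W\<in>\<V>. V \<subseteq> W \<longrightarrow> V = W}"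
  have fin: "finite \<V>" "finite \<V>'"
    using T(1) by (auto simp: \<V>_def \<V>'_def)
  have nested: "V \<subseteq> W \<or> W \<subseteq> V \<or> V \<inter> W = {}" if "V \<in> \<V>" "W \<in> \<V>" for V W
  proof -
    obtain x y where xy: "V = M \<inter> ?b x" "W = M \<inter> ?b y"
      using \<open>V \<in> \<V>\<close> \<open>W \<in> \<V>\<close> unfolding \<V>_def by blast
    show ?thesis
      using linear[of "r x" "r y"] kball_nested_or_disjoint[of "r x" "r y" "{..<n}" x y]
        kball_nested_or_disjoint[of "r y" "r x" "{..<n}" y x] unfolding xy by blast
  qed
  have disj: "disjoint_family_on (\<lambda>V. V) \<V>'"
    unfolding disjoint_family_on_def
  proof (intro ballI impI)
    fix V W assume VW: "V \<in> \<V>'" "W \<in> \<V>'" "V \<noteq> W"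
    then have "V \<in> \<V>" "W \<in> \<V>" "\<not> V \<subseteq> W" "\<not> W \<subseteq> V"
      by (auto simp: \<V>'_def)
    then show "V \<inter> W = {}"
      using nested by blast
  qed
  have union: "\<Union>\<V>' = M0"
  proof (intro equalityI subsetI)
    fix x assume "x \<in> \<Union>\<V>'"
    then show "x \<in> M0"
      using r T(2) unfolding \<V>'_def \<V>_def by blast
  next
    fix x assume x: "x \<in> M0"
    then have "x \<in> \<Union> (?b ` T)"
      using T(3) by (rule rev_subsetD)
    then obtain t where t: "t \<in> T" "x \<in> ?b t"
      by (elim UN_E)
    define V where "V = M \<inter> ?b t"
    have V: "V \<in> \<V>" "x \<in> V"
      using t x M0(2) by (auto simp: V_def \<V>_def)
    obtain W where W: "W \<in> \<V>" "V \<subseteq> W" "\<forall>W'\<in>\<V>. W \<subseteq> W' \<longrightarrow> W = W'"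
      using finite_has_maximal2[OF fin(1) V(1)] by blast
    then show "x \<in> \<Union>\<V>'"
      using V(2) unfolding \<V>'_def by blast
  qed
  have dec: "decaying \<psi> n \<delta> \<mu> V" if "V \<in> \<V>'" for V
    using that r T(2) unfolding \<V>'_def \<V>_def by blast
  then have fm: "V \<in> fmeasurable \<mu>" if "V \<in> \<V>'" for V
    using that by (simp add: decaying_def)
  have "\<forall>V. \<exists>K. V \<in> \<V>' \<longrightarrow> 0 \<le> K \<and> (\<forall>x. 1 \<le> max_norm {..<n} x \<longrightarrow>
      norm (LINT \<xi>:V|\<mu>. \<psi> (\<Sum>i<n. x i * \<xi> i)) \<le> K * max_norm {..<n} x powr (- \<delta>))"
    using dec unfolding decaying_def by blast
  then have "\<exists>K. \<forall>V. V \<in> \<V>' \<longrightarrow> 0 \<le> K V \<and> (\<forall>x. 1 \<le> max_norm {..<n} x \<longrightarrow>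
      norm (LINT \<xi>:V|\<mu>. \<psi> (\<Sum>i<n. x i * \<xi> i)) \<le> K V * max_norm {..<n} x powr (- \<delta>))"
    by (rule choice)
  then obtain K where K: "\<And>V. V \<in> \<V>' \<Longrightarrow> 0 \<le> K V \<and> (\<forall>x. 1 \<le> max_norm {..<n} x \<longrightarrow>
      norm (LINT \<xi>:V|\<mu>. \<psi> (\<Sum>i<n. x i * \<xi> i)) \<le> K V * max_norm {..<n} x powr (- \<delta>))"
    by blast
  have "norm (LINT \<xi>:M0|\<mu>. \<psi> (\<Sum>i<n. x i * \<xi> i)) \<le> (\<Sum>V\<in>\<V>'. K V) * max_norm {..<n} x powr (- \<delta>)"
    if x: "1 \<le> max_norm {..<n} x" for x
  proof -
    let ?G = "\<lambda>\<xi>. \<psi> (\<Sum>i<n. x i * \<xi> i)"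
    have G: "?G \<in> borel_measurable \<mu>"
      by (rule psi_dot_measurable[OF finite_lessThan M \<mu>])
    have int: "set_integrable \<mu> V ?G" if "V \<in> \<V>'" for V
      unfolding set_integrable_def using fm[OF that] G
      by (intro integrableI_bounded_set_indicator[where B = 1]) (auto simp: fmeasurable_def)
    have "(LINT \<xi>:(\<Union>V\<in>\<V>'. V)|\<mu>. ?G \<xi>) = (\<Sum>V\<in>\<V>'. LINT \<xi>:V|\<mu>. ?G \<xi>)"
      using fin(2) disj int fm by (intro set_integral_finite_Union) auto
    then have "norm (LINT \<xi>:M0|\<mu>. ?G \<xi>) \<le> (\<Sum>V\<in>\<V>'. norm (LINT \<xi>:V|\<mu>. ?G \<xi>))"
      using union by (simp add: norm_sum)
    also have "\<dots> \<le> (\<Sum>V\<in>\<V>'. K V * max_norm {..<n} x powr (- \<delta>))"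
      using K x by (intro sum_mono) blast
    finally show ?thesis
      by (simp add: sum_distrib_right)
  qed
  moreover have "M0 \<in> fmeasurable \<mu>"
    unfolding union[symmetric] using fin(2) fm fmeasurable.finite_Union[of \<V>' \<mu>] by blast
  moreover have "0 \<le> (\<Sum>V\<in>\<V>'. K V)"
    using K by (intro sum_nonneg) blast
  ultimately show ?thesis
    unfolding decaying_def by blast
qed

section \<open>A discrete form of Young's inequality\<close>

text \<open>
  The product on the left is a weighted geometric mean of the three terms on the right.
\<close>

lemma young_three_terms:
  fixes u v h p :: real
  assumes p: "1 < p" "p \<le> 2" and nn: "0 \<le> u" "0 \<le> v" "0 \<le> h"
  defines "r \<equiv> p / (2 * (p - 1))"
  shows "u * v * h \<le> u powr p * v powr p + u powr p * h powr r + v powr p * h powr r"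
proof (cases "u = 0 \<or> v = 0 \<or> h = 0")
  case True
  then show ?thesis
    using nn by (auto intro!: add_nonneg_nonneg)
next
  case False
  then have pos: "0 < u" "0 < v" "0 < h"
    using nn by auto
  define X Y Z where "X = u powr p * v powr p" and "Y = u powr p * h powr r" and "Z = v powr p * h powr r"
  \<comment> \<open>The weights \<open>\<theta>, \<phi>, \<phi>\<close> give \<open>u\<close>, \<open>v\<close> and \<open>h\<close> the total exponent 1 each.\<close>
  define \<phi> \<theta> where "\<phi> = (p - 1) / p" and "\<theta> = (2 - p) / p"
  have \<phi>: "0 \<le> \<phi>" "0 \<le> \<theta>" "\<theta> + \<phi> + \<phi> = 1"
    using p by (auto simp: \<phi>_def \<theta>_def field_simps)
  have e: "p * \<theta> + p * \<phi> = 1" "r * \<phi> + r * \<phi> = 1"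
  proof -
    show "p * \<theta> + p * \<phi> = 1"
      using p by (simp add: \<phi>_def \<theta>_def)
    have "r * \<phi> = 1 / 2"
      using p unfolding r_def \<phi>_def by (simp add: divide_simps)
    then show "r * \<phi> + r * \<phi> = 1"
      by linarith
  qed
  have XYZ: "0 < X" "0 < Y" "0 < Z"
    using pos by (auto simp: X_def Y_def Z_def)
  let ?m = "max X (max Y Z)"
  have "X powr \<theta> * Y powr \<phi> * Z powr \<phi> =
      (u powr (p * \<theta>) * u powr (p * \<phi>)) * (v powr (p * \<theta>) * v powr (p * \<phi>)) * (h powr (r * \<phi>) * h powr (r * \<phi>))"
    using pos by (simp add: X_def Y_def Z_def powr_mult powr_powr mult_ac)
  also have "\<dots> = u * v * h"
    using pos e by (simp flip: powr_add)
  finally have "u * v * h = X powr \<theta> * Y powr \<phi> * Z powr \<phi>" ..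
  also have "\<dots> \<le> ?m powr \<theta> * ?m powr \<phi> * ?m powr \<phi>"
    using XYZ \<phi> by (intro mult_mono powr_mono2) auto
  also have "\<dots> = ?m"
    using XYZ \<phi>(3) by (simp flip: powr_add add: less_max_iff_disj)
  also have "\<dots> \<le> X + Y + Z"
    using XYZ by auto
  finally show ?thesis
    by (simp add: X_def Y_def Z_def)
qed

lemma discrete_young:
  fixes u :: "'s \<Rightarrow> real" and h :: "'s \<Rightarrow> 's \<Rightarrow> real"
  assumes S: "finite S" and w: "0 \<le> w" and p: "1 < p" "p \<le> 2"
    and u: "\<And>a. a \<in> S \<Longrightarrow> 0 \<le> u a" and h: "\<And>a b. a \<in> S \<Longrightarrow> b \<in> S \<Longrightarrow> 0 \<le> h a b"
    and B: "\<And>a. a \<in> S \<Longrightarrow> w * (\<Sum>b\<in>S. h a b powr (p / (2 * (p - 1)))) \<le> B"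
      "\<And>b. b \<in> S \<Longrightarrow> w * (\<Sum>a\<in>S. h a b powr (p / (2 * (p - 1)))) \<le> B"
  shows "w ^ 2 * (\<Sum>a\<in>S. \<Sum>b\<in>S. u a * u b * h a b)
      \<le> (1 + 2 * B) * (w * (\<Sum>a\<in>S. u a powr p)) powr (2 / p)"
proof (cases "w * (\<Sum>a\<in>S. u a powr p) = 0")
  case True
  then have "w = 0 \<or> (\<forall>a\<in>S. u a = 0)"
    using S by (auto simp: sum_nonneg_eq_0_iff)
  then have Z: "w ^ 2 * (\<Sum>a\<in>S. \<Sum>b\<in>S. u a * u b * h a b) = 0"
    by auto
  show ?thesis
    unfolding Z True by simp
next
  case False
  define T where "T = w * (\<Sum>a\<in>S. u a powr p)"
  have T: "0 < T"
    using False w unfolding T_def by (intro order_neq_le_trans mult_nonneg_nonneg sum_nonneg) auto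
  define N where "N = T powr (1 / p)"
  have N: "0 < N" "N powr p = T" "N ^ 2 = T powr (2 / p)"
    using T p by (auto simp: N_def powr_powr power2_eq_square simp flip: powr_add)
  define v where "v a = u a / N" for a
  have v: "0 \<le> v a" "u a = N * v a" if "a \<in> S" for a
    using u[OF that] N by (auto simp: v_def)
  let ?r = "p / (2 * (p - 1))"
  have vp: "w * (\<Sum>a\<in>S. v a powr p) = 1"
  proof -
    have "v a powr p = u a powr p / T" if "a \<in> S" for a
      unfolding v_def using u[OF that] N by (simp add: powr_divide)
    then have "w * (\<Sum>a\<in>S. v a powr p) = T / T"
      by (simp add: T_def sum_divide_distrib[symmetric])
    then show ?thesis using T by simp
  qed
  have B0: "0 \<le> B"
  proof -
    have "S \<noteq> {}" using False by auto
    then obtain a where a: "a \<in> S" by blast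
    have "0 \<le> w * (\<Sum>b\<in>S. h a b powr ?r)"
      using w by (intro mult_nonneg_nonneg sum_nonneg) auto
    then show ?thesis using B(1)[OF a] by linarith
  qed
  have "w ^ 2 * (\<Sum>a\<in>S. \<Sum>b\<in>S. v a * v b * h a b)
      \<le> w ^ 2 * (\<Sum>a\<in>S. \<Sum>b\<in>S. v a powr p * v b powr p + v a powr p * h a b powr ?r + v b powr p * h a b powr ?r)"
    using v h p by (intro mult_left_mono sum_mono young_three_terms) auto
  also have "\<dots> = (w * (\<Sum>a\<in>S. v a powr p)) * (w * (\<Sum>b\<in>S. v b powr p))
      + w * (\<Sum>a\<in>S. v a powr p * (w * (\<Sum>b\<in>S. h a b powr ?r)))
      + w * (\<Sum>b\<in>S. v b powr p * (w * (\<Sum>a\<in>S. h a b powr ?r)))"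
  proof -
    have "(\<Sum>a\<in>S. \<Sum>b\<in>S. v b powr p * h a b powr ?r) = (\<Sum>b\<in>S. \<Sum>a\<in>S. v b powr p * h a b powr ?r)"
      by (rule sum.swap)
    then show ?thesis
      by (simp add: sum.distrib sum_product sum_distrib_left power2_eq_square algebra_simps)
  qed
  also have "\<dots> \<le> 1 * 1 + w * (\<Sum>a\<in>S. v a powr p * B) + w * (\<Sum>b\<in>S. v b powr p * B)"
    unfolding vp using w B by (intro add_mono order_refl mult_left_mono sum_mono) auto
  also have "\<dots> = 1 + 2 * B * (w * (\<Sum>a\<in>S. v a powr p))"
    by (simp add: sum_distrib_right[symmetric])
  finally have le: "w ^ 2 * (\<Sum>a\<in>S. \<Sum>b\<in>S. v a * v b * h a b) \<le> 1 + 2 * B"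
    unfolding vp by simp
  have "(\<Sum>a\<in>S. \<Sum>b\<in>S. u a * u b * h a b) = (\<Sum>a\<in>S. \<Sum>b\<in>S. N ^ 2 * (v a * v b * h a b))"
    using v by (intro sum.cong refl) (simp add: power2_eq_square)
  also have "\<dots> = N ^ 2 * (\<Sum>a\<in>S. \<Sum>b\<in>S. v a * v b * h a b)"
    by (simp add: sum_distrib_left)
  finally have "w ^ 2 * (\<Sum>a\<in>S. \<Sum>b\<in>S. u a * u b * h a b) = N ^ 2 * (w ^ 2 * (\<Sum>a\<in>S. \<Sum>b\<in>S. v a * v b * h a b))"
    by simp
  also have "\<dots> \<le> N ^ 2 * (1 + 2 * B)"
    using le by (intro mult_left_mono) auto
  finally show ?thesis
    using N(3) unfolding T_def by (simp add: mult.commute)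
qed

section \<open>Restriction\<close>

lemma compactin_bounded:
  fixes C :: "('i \<Rightarrow> 'a::nonarch_local_field) set"
  assumes I: "finite I" and C: "compactin (Ktop I) C"
  obtains R where "1 \<le> R" "C \<subseteq> kball I (\<lambda>i\<in>I. 0) R"
proof -
  obtain T where T: "finite T" "T \<subseteq> C" "C \<subseteq> (\<Union>x\<in>T. kball I x 1)"
    by (rule compactin_finite_kball_cover[OF I C, of "\<lambda>_. 1"]) auto
  define R where "R = Max (insert 1 (max_norm I ` T))"
  have R: "1 \<le> R" "\<And>x. x \<in> T \<Longrightarrow> max_norm I x \<le> R"
    using T(1) by (auto simp: R_def)
  have "absval (y i) \<le> R" if "x \<in> T" "y \<in> kball I x 1" "i \<in> I" for x y i
  proof -
    have "absval (y i - x i) \<le> 1"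
      using that(2,3) by (simp add: kball_def)
    then have "absval (y i - x i) \<le> R" "absval (x i) \<le> R"
      using R(1) R(2)[OF that(1)] absval_le_max_norm[OF I that(3), of x] by linarith+
    then show ?thesis
      using absval_add_le[of "y i - x i" R "x i"] by simp
  qed
  then have "kball I x 1 \<subseteq> kball I (\<lambda>i\<in>I. 0) R" if "x \<in> T" for x
    using that by (simp add: kball_def subset_iff)
  then have "C \<subseteq> kball I (\<lambda>i\<in>I. 0) R"
    using T(3) by (meson UN_least order_trans)
  then show ?thesis
    by (rule that[OF R(1)])
qed

lemma schwartz_bruhat_uniform:
  fixes f :: "(nat \<Rightarrow> 'a::nonarch_local_field) \<Rightarrow> complex"
  assumes "schwartz_bruhat n f"
  obtains s R where "0 < s" "1 \<le> R"
    "\<And>x y. x \<in> Kspace {..<n} \<Longrightarrow> y \<in> kball {..<n} x s \<Longrightarrow> f y = f x"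
    "\<And>x. x \<in> Kspace {..<n} \<Longrightarrow> f x \<noteq> 0 \<Longrightarrow> x \<in> kball {..<n} (\<lambda>i\<in>{..<n}. 0) R"
proof -
  let ?I = "{..<n}"
  obtain C where C: "compactin (Ktop ?I) C" "\<And>x. x \<in> Kspace ?I \<Longrightarrow> x \<notin> C \<Longrightarrow> f x = 0"
    using assms unfolding schwartz_bruhat_def by blast
  have CK: "C \<subseteq> Kspace ?I"
    using compactin_subset_topspace[OF C(1)] by auto
  have "\<exists>e. x \<in> C \<longrightarrow> 0 < e \<and> (\<forall>y\<in>kball ?I x e. f y = f x)" for x
  proof (cases "x \<in> C")
    case True
    then obtain U where U: "openin (Ktop ?I) U" "x \<in> U" "\<forall>y\<in>U. f y = f x"
      using assms CK unfolding schwartz_bruhat_def by blast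
    then obtain e where "0 < e" "kball ?I x e \<subseteq> U"
      unfolding openin_Ktop_iff[OF finite_lessThan] by blast
    then show ?thesis
      using U(3) by blast
  qed simp
  then obtain e where e: "\<And>x. x \<in> C \<Longrightarrow> 0 < e x" "\<And>x y. x \<in> C \<Longrightarrow> y \<in> kball ?I x (e x) \<Longrightarrow> f y = f x"
    by metis
  let ?b = "\<lambda>x. kball ?I x (e x)"
  obtain T where T: "finite T" "T \<subseteq> C" "C \<subseteq> (\<Union>x\<in>T. ?b x)"
    by (rule compactin_finite_kball_cover[OF finite_lessThan C(1)]) (use e(1) in blast)
  define s where "s = Min (insert 1 (e ` T))"
  have s: "0 < s" "\<And>t. t \<in> T \<Longrightarrow> s \<le> e t"
    using T e(1) by (auto simp: s_def)
  have const_C: "f y = f x" if x: "x \<in> C" and y: "y \<in> kball ?I x s" for x y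
  proof -
    obtain t where t: "t \<in> T" "x \<in> ?b t"
      using x T(3) by blast
    have "kball ?I x s \<subseteq> ?b t"
      using kball_mono[OF s(2)[OF t(1)], of ?I x] kball_recenter[OF t(2)] by simp
    then have "f y = f t" "f x = f t"
      using e(2)[of t] t y T(2) by blast+
    then show ?thesis by simp
  qed
  have const: "f y = f x" if x: "x \<in> Kspace ?I" and y: "y \<in> kball ?I x s" for x y
  proof (cases "x \<in> C \<or> y \<in> C")
    case True
    have "x \<in> kball ?I y s"
      using kball_recenter[OF y] center_in_kball[OF x, of s] s(1) by simp
    then show ?thesis
      using True const_C[of x y] const_C[of y x] y by auto
  next
    case False
    then show ?thesis
      using C(2)[of x] C(2)[of y] x y by (simp add: kball_def)
  qed
  obtain R where R: "1 \<le> R" "C \<subseteq> kball ?I (\<lambda>i\<in>?I. 0) R"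
    using compactin_bounded[OF finite_lessThan C(1)] by blast
  show ?thesis
    using that[OF s(1) R(1) const] R(2) C(2) by blast
qed

context haar_space
begin

text \<open>
  A Riemann sum for \<open>\<integral> max(1, \<bar>x - b\<bar>)\<^bsup>-t\<^esup> dx\<close>, split at the radii \<open>q\<^bsup>i\<^esup>\<close>: a ball of radius
  \<open>q\<^bsup>i\<^esup>\<close> has measure at most \<open>q\<^bsup>i n\<^esup>\<close>, with \<open>n\<close> the dimension, and \<open>t\<close> exceeds \<open>n\<close> by at least 1.
\<close>

lemma discrete_radial_sum_le:
  assumes S: "finite S" "S \<subseteq> Kspace I" "disjoint_family_on (\<lambda>a. kball I a s) S" and s: "0 < s" "s \<le> 1"
    and t: "real (card I) + 1 \<le> t" and b: "b \<in> Kspace I"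
  shows "measure H (kball I b s) * (\<Sum>a\<in>S. max 1 (max_norm I (\<lambda>i. a i - b i)) powr (- t))
    \<le> 2 * residue_card TYPE('a) powr t"
proof -
  let ?q = "residue_card TYPE('a)" and ?d = "\<lambda>a. max_norm I (\<lambda>i. a i - b i)"
  let ?w = "measure H (kball I b s)"
  have q: "2 \<le> ?q" by (rule residue_card_ge_2)
  obtain L where L: "\<And>a. a \<in> S \<Longrightarrow> ?d a \<le> ?q ^ L"
  proof -
    obtain L where L: "Max (insert 0 (?d ` S)) < ?q ^ L"
      using real_arch_pow[of ?q "Max (insert 0 (?d ` S))"] q by auto
    have "?d a \<le> ?q ^ L" if "a \<in> S" for a
    proof -
      have "?d a \<le> Max (insert 0 (?d ` S))"
        using S(1) that by (intro Max_ge) auto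
      then show ?thesis using L by linarith
    qed
    then show ?thesis by (rule that)
  qed
  have count: "?w * real (card {a \<in> S. ?d a \<le> ?q ^ i}) \<le> (?q ^ i) ^ card I" for i
  proof -
    let ?S = "{a \<in> S. ?d a \<le> ?q ^ i}"
    have q1: "1 \<le> ?q ^ i" using q by simp
    have "?w * real (card ?S) = (\<Sum>a\<in>?S. ?w)"
      by simp
    also have "\<dots> = (\<Sum>a\<in>?S. measure H (kball I a s))"
      by (rule sum.cong[OF refl]) (rule measure_kball_cong[OF s(1)])
    also have "\<dots> = measure H (\<Union>a\<in>?S. kball I a s)"
      using S(1) disjoint_family_on_mono[OF _ S(3), of ?S] s(1) emeasure_kball_finite[OF s(1)]
      by (intro measure_finite_Union[symmetric]) (auto simp: less_top)
    also have "\<dots> \<le> measure H (kball I b (?q ^ i))"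
    proof (rule measure_mono_fmeasurable)
      show "(\<Union>a\<in>?S. kball I a s) \<subseteq> kball I b (?q ^ i)"
      proof (rule UN_least)
        fix a assume a: "a \<in> ?S"
        then have "a \<in> kball I b (?q ^ i)"
          using S(2) finite_I q1 by (auto simp: kball_iff_max_norm)
        then have "kball I a (?q ^ i) = kball I b (?q ^ i)"
          by (rule kball_recenter)
        then show "kball I a s \<subseteq> kball I b (?q ^ i)"
          using kball_mono[of s "?q ^ i" I a] s(2) q1 by simp
      qed
      show "(\<Union>a\<in>?S. kball I a s) \<in> sets H"
        using S(1) s(1) by auto
      show "kball I b (?q ^ i) \<in> fmeasurable H"
        using q by (intro fmeasurable_kball) simp
    qed
    also have "\<dots> \<le> (?q ^ i) ^ card I"
      by (rule measure_kball_le)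
    finally show ?thesis .
  qed
  have shell: "max 1 (?d a) powr (- t) \<le> (\<Sum>i\<le>L. ?q powr t * (?q ^ i) powr (- t) * of_bool (?d a \<le> ?q ^ i))"
    if a: "a \<in> S" for a
  proof -
    define i where "i = (LEAST i. ?d a \<le> ?q ^ i)"
    have i: "?d a \<le> ?q ^ i" "i \<le> L"
      using LeastI[of "\<lambda>i. ?d a \<le> ?q ^ i" L] Least_le[of "\<lambda>i. ?d a \<le> ?q ^ i" L] L[OF a]
      unfolding i_def by auto
    have t0: "0 \<le> t" using t by linarith
    have "max 1 (?d a) powr (- t) \<le> ?q powr t * (?q ^ i) powr (- t)"
    proof (cases i)
      case 0
      have "max 1 (?d a) powr (- t) \<le> 1"
        using t0 powr_mono[of "- t" 0 "max 1 (?d a)"] by (auto simp: max_def split: if_splits)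
      also have "1 \<le> ?q powr t"
        using q t0 by (intro ge_one_powr_ge_zero) auto
      finally show ?thesis using 0 by simp
    next
      case (Suc l)
      have "\<not> ?d a \<le> ?q ^ l"
        using not_less_Least[of l "\<lambda>i. ?d a \<le> ?q ^ i"] Suc by (simp add: i_def)
      then have "max 1 (?d a) powr (- t) \<le> (?q ^ l) powr (- t)"
        using q t0 by (intro powr_mono2') auto
      also have "\<dots> = ?q powr t * (?q ^ i) powr (- t)"
        using q Suc by (simp add: powr_mult powr_minus)
      finally show ?thesis .
    qed
    also have "\<dots> = ?q powr t * (?q ^ i) powr (- t) * of_bool (?d a \<le> ?q ^ i)"
      using i(1) by simp
    also have "\<dots> \<le> (\<Sum>i\<le>L. ?q powr t * (?q ^ i) powr (- t) * of_bool (?d a \<le> ?q ^ i))"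
      using i(2) by (intro member_le_sum) auto
    finally show ?thesis .
  qed
  have "?w * (\<Sum>a\<in>S. max 1 (?d a) powr (- t))
      \<le> ?w * (\<Sum>a\<in>S. \<Sum>i\<le>L. ?q powr t * (?q ^ i) powr (- t) * of_bool (?d a \<le> ?q ^ i))"
    using shell by (intro mult_left_mono sum_mono) auto
  also have "\<dots> = ?w * (\<Sum>i\<le>L. \<Sum>a\<in>S. ?q powr t * (?q ^ i) powr (- t) * of_bool (?d a \<le> ?q ^ i))"
    by (subst sum.swap) (rule refl)
  also have "\<dots> = (\<Sum>i\<le>L. ?q powr t * (?q ^ i) powr (- t) * (?w * real (card {a \<in> S. ?d a \<le> ?q ^ i})))"
  proof -
    have card: "(\<Sum>a\<in>S. c * of_bool (?d a \<le> ?q ^ i)) = c * real (card {a \<in> S. ?d a \<le> ?q ^ i})" for c i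
      using S(1) by (simp add: sum_distrib_left[symmetric] of_bool_def sum.If_cases Int_def)
    show ?thesis
      unfolding card by (simp add: sum_distrib_left mult_ac)
  qed
  also have "\<dots> \<le> (\<Sum>i\<le>L. ?q powr t * (1 / 2) ^ i)"
  proof (rule sum_mono)
    fix i
    have "(?q ^ i) powr (- t) * (?w * real (card {a \<in> S. ?d a \<le> ?q ^ i})) \<le> (?q ^ i) powr (- t) * (?q ^ i) ^ card I"
      using count by (intro mult_left_mono) auto
    also have "\<dots> = (?q ^ i) powr (real (card I) - t)"
      using q by (simp add: powr_realpow[symmetric] powr_add[symmetric] del: of_nat_power)
    also have "\<dots> \<le> (?q ^ i) powr (- 1)"
      using q t by (intro powr_mono) auto
    also have "\<dots> = (1 / ?q) ^ i"
      using q by (simp add: powr_minus divide_inverse power_inverse)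
    also have "\<dots> \<le> (1 / 2) ^ i"
      using q by (intro power_mono) (auto intro: divide_left_mono)
    finally have "?q powr t * ((?q ^ i) powr (- t) * (?w * real (card {a \<in> S. ?d a \<le> ?q ^ i}))) \<le> ?q powr t * (1 / 2) ^ i"
      by (rule mult_left_mono) simp
    then show "?q powr t * (?q ^ i) powr (- t) * (?w * real (card {a \<in> S. ?d a \<le> ?q ^ i})) \<le> ?q powr t * (1 / 2) ^ i"
      by (simp add: mult.assoc)
  qed
  also have "\<dots> = ?q powr t * (\<Sum>i\<le>L. (1 / 2) ^ i)"
    by (simp add: sum_distrib_left)
  also have "\<dots> \<le> ?q powr t * 2"
  proof (rule mult_left_mono)
    have "(\<Sum>i\<le>L. (1 / 2 :: real) ^ i) = 2 - (1 / 2) ^ L"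
      by (induction L) (simp_all add: field_simps)
    then show "(\<Sum>i\<le>L. (1 / 2 :: real) ^ i) \<le> 2" by simp
  qed simp
  finally show ?thesis
    by (simp only: mult.commute)
qed

end

text \<open>
  A Schwartz-Bruhat function, also when multiplied by \<open>x \<mapsto> \<psi> (x \<cdot> \<xi>)\<close> with \<open>\<xi>\<close> in a bounded
  set, is constant on the balls of some radius \<open>s\<close>.  Its integral over \<open>K\<^sup>n\<close> is then a finite sum,
  which commutes with integration over \<open>M0\<close>.
\<close>

lemma (in haar_space) integral_step_function:
  fixes F :: "('i \<Rightarrow> 'a) \<Rightarrow> 'c::{banach, second_countable_topology}"
  assumes S: "finite S" "S \<subseteq> Kspace I" "disjoint_family_on (\<lambda>a. kball I a s) S" "(\<Union>a\<in>S. kball I a s) = B"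
    and s: "0 < s" and F: "\<And>a x. a \<in> S \<Longrightarrow> x \<in> kball I a s \<Longrightarrow> F x = F a"
    and supp: "\<And>x. x \<in> Kspace I \<Longrightarrow> x \<notin> B \<Longrightarrow> F x = 0"
  shows "integral\<^sup>L H F = measure H (kball I b s) *\<^sub>R (\<Sum>a\<in>S. F a)"
proof -
  have "integral\<^sup>L H F = (LINT x:B|H. F x)"
    unfolding set_lebesgue_integral_def
  proof (rule Bochner_Integration.integral_cong[OF refl])
    fix x assume "x \<in> space H"
    then show "F x = indicat_real B x *\<^sub>R F x"
      using supp[of x] by (cases "x \<in> B") (simp_all add: space_H)
  qed
  also have "\<dots> = (\<Sum>a\<in>S. measure H (kball I a s) *\<^sub>R F a)"
    unfolding S(4)[symmetric] by (rule integral_kball_partition[OF S(1,3) s F])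
  also have "\<dots> = (\<Sum>a\<in>S. measure H (kball I b s) *\<^sub>R F a)"
    using measure_kball_cong[OF s] by (intro sum.cong refl arg_cong2[where f = scaleR])
  finally show ?thesis
    by (simp add: scaleR_sum_right)
qed

text \<open>
  This is the \<open>T T\<^sup>*\<close> argument: the square of the norm of the restriction of the Fourier transform
  of \<open>f\<close> is a quadratic form in \<open>f\<close> with the Fourier transform of the measure on \<open>M0\<close> as its kernel.
\<close>

lemma restriction_quadratic_form:
  fixes \<mu> :: "(nat \<Rightarrow> 'a::nonarch_local_field) measure" and u :: "(nat \<Rightarrow> 'a) \<Rightarrow> complex"
  assumes \<psi>: "unramified_character \<psi>" and M: "M \<subseteq> Kspace {..<n}"
    and \<mu>: "space \<mu> = M" "sets \<mu> = borel_sets (subtopology (Ktop {..<n}) M)"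
    and M0: "M0 \<in> fmeasurable \<mu>" and S: "finite S"
  shows "(LINT \<xi>:M0|\<mu>. norm (\<Sum>a\<in>S. \<psi> (\<Sum>i<n. a i * \<xi> i) * u a) ^ 2)
    \<le> (\<Sum>a\<in>S. \<Sum>b\<in>S. norm (u a) * norm (u b) * norm (LINT \<xi>:M0|\<mu>. \<psi> (\<Sum>i<n. (a i - b i) * \<xi> i)))"
proof -
  interpret unramified_character \<psi> by (rule \<psi>)
  let ?e = "\<lambda>x \<xi>. \<psi> (\<Sum>i<n. x i * \<xi> i)"
  let ?d = "\<lambda>a b i. a i - b i"
  have int: "integrable \<mu> (\<lambda>\<xi>. indicator M0 \<xi> *\<^sub>R (c * ?e x \<xi>))" for c x
  proof -
    have "set_integrable \<mu> M0 (?e x)"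
      unfolding set_integrable_def using M0 psi_dot_measurable[OF finite_lessThan M \<mu>]
      by (intro integrableI_bounded_set_indicator[where B = 1]) (auto simp: fmeasurable_def)
    then have "set_integrable \<mu> M0 (\<lambda>\<xi>. c * ?e x \<xi>)"
      by simp
    then show ?thesis
      by (simp add: set_integrable_def)
  qed
  have pair: "?e a \<xi> * cnj (?e b \<xi>) = ?e (?d a b) \<xi>" for a b \<xi>
    by (simp add: cnj_psi sum_subtractf left_diff_distrib flip: psi_add)
  have sq: "complex_of_real (norm (\<Sum>a\<in>S. ?e a \<xi> * u a) ^ 2)
      = (\<Sum>a\<in>S. \<Sum>b\<in>S. (u a * cnj (u b)) * ?e (?d a b) \<xi>)" for \<xi>
  proof -
    have "complex_of_real (norm (\<Sum>a\<in>S. ?e a \<xi> * u a) ^ 2)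
        = (\<Sum>a\<in>S. ?e a \<xi> * u a) * (\<Sum>b\<in>S. cnj (?e b \<xi> * u b))"
      by (simp only: complex_norm_square cnj_sum)
    also have "\<dots> = (\<Sum>a\<in>S. \<Sum>b\<in>S. (u a * cnj (u b)) * (?e a \<xi> * cnj (?e b \<xi>)))"
      by (simp add: sum_product mult_ac)
    finally show ?thesis
      by (simp only: pair)
  qed
  have "complex_of_real (LINT \<xi>:M0|\<mu>. norm (\<Sum>a\<in>S. ?e a \<xi> * u a) ^ 2)
      = (LINT \<xi>:M0|\<mu>. complex_of_real (norm (\<Sum>a\<in>S. ?e a \<xi> * u a) ^ 2))"
    by (rule set_integral_complex_of_real[symmetric])
  also have "\<dots> = (LINT \<xi>|\<mu>. (\<Sum>a\<in>S. \<Sum>b\<in>S. indicator M0 \<xi> *\<^sub>R ((u a * cnj (u b)) * ?e (?d a b) \<xi>)))"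
    unfolding set_lebesgue_integral_def sq by (simp add: scaleR_sum_right)
  also have "\<dots> = (\<Sum>a\<in>S. \<Sum>b\<in>S. LINT \<xi>:M0|\<mu>. (u a * cnj (u b)) * ?e (?d a b) \<xi>)"
    unfolding set_lebesgue_integral_def
    by (simp only: Bochner_Integration.integral_sum Bochner_Integration.integrable_sum int)
  also have "\<dots> = (\<Sum>a\<in>S. \<Sum>b\<in>S. (u a * cnj (u b)) * (LINT \<xi>:M0|\<mu>. ?e (?d a b) \<xi>))"
    by simp
  finally have eq: "complex_of_real (LINT \<xi>:M0|\<mu>. norm (\<Sum>a\<in>S. ?e a \<xi> * u a) ^ 2)
      = (\<Sum>a\<in>S. \<Sum>b\<in>S. (u a * cnj (u b)) * (LINT \<xi>:M0|\<mu>. ?e (?d a b) \<xi>))" .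
  have "(LINT \<xi>:M0|\<mu>. norm (\<Sum>a\<in>S. ?e a \<xi> * u a) ^ 2)
      \<le> norm (complex_of_real (LINT \<xi>:M0|\<mu>. norm (\<Sum>a\<in>S. ?e a \<xi> * u a) ^ 2))"
    by simp
  also have "\<dots> \<le> (\<Sum>a\<in>S. \<Sum>b\<in>S. norm ((u a * cnj (u b)) * (LINT \<xi>:M0|\<mu>. ?e (?d a b) \<xi>)))"
    unfolding eq by (intro order_trans[OF norm_sum] sum_mono norm_sum)
  finally show ?thesis
    by (simp add: norm_mult)
qed

text \<open>
  In the quadratic form the kernel is at most \<open>K max(1, \<bar>x\<bar>)\<^bsup>-\<delta>\<^esup>\<close>.  By Young's inequality the form is
  bounded on \<open>L\<^sup>p\<close> when the kernel lies in \<open>L\<^sup>r\<close> with \<open>2 r\<close> the exponent conjugate to \<open>p\<close>, and for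
  \<open>p\<close> close to 1 this \<open>r\<close> is so large that \<open>\<delta> r > n\<close>.
\<close>

lemma restriction_of_decaying:
  fixes haar :: "nat set \<Rightarrow> (nat \<Rightarrow> 'a::nonarch_local_field) measure"
  assumes \<psi>: "unramified_character \<psi>" and haar: "normalized_haar {..<n} (haar {..<n})"
    and M: "M \<subseteq> Kspace {..<n}"
    and \<mu>: "space \<mu> = M" "sets \<mu> = borel_sets (subtopology (Ktop {..<n}) M)"
    and M0: "compactin (Ktop {..<n}) M0" "decaying \<psi> n \<delta> \<mu> M0"
    and \<delta>: "0 < \<delta>" "\<delta> \<le> 1" and p: "1 \<le> p" "p \<le> 1 + \<delta> / (2 * (real n + 1))"
  shows "\<exists>A. \<forall>f. schwartz_bruhat n f \<longrightarrow>
    (LINT \<xi>:M0|\<mu>. norm (fourier haar \<psi> n f \<xi>) powr 2) powr (1 / 2) \<le> A * Lp_norm (haar {..<n}) p f"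
proof -
  let ?I = "{..<n}" and ?q = "residue_card TYPE('a)"
  interpret unramified_character \<psi> by (rule \<psi>)
  interpret haar_space ?I "haar ?I"
    using haar by (simp add: haar_space_def)
  let ?h = "\<lambda>x. LINT \<xi>:M0|\<mu>. \<psi> (\<Sum>i<n. x i * \<xi> i)"
  have M0_fm: "M0 \<in> fmeasurable \<mu>"
    using M0(2) by (simp add: decaying_def)
  obtain K0 where K0: "0 \<le> K0" "\<And>x. 1 \<le> max_norm ?I x \<Longrightarrow> norm (?h x) \<le> K0 * max_norm ?I x powr (- \<delta>)"
    using M0(2) by (auto simp: decaying_def)
  define K where "K = K0 + measure \<mu> M0"
  have K: "0 \<le> K" "\<And>x. norm (?h x) \<le> K * max 1 (max_norm ?I x) powr (- \<delta>)"
  proof -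
    show "0 \<le> K" using K0(1) by (simp add: K_def)
    fix x
    show "norm (?h x) \<le> K * max 1 (max_norm ?I x) powr (- \<delta>)"
    proof (cases "1 \<le> max_norm ?I x")
      case True
      have "norm (?h x) \<le> K0 * max_norm ?I x powr (- \<delta>)"
        by (rule K0(2)[OF True])
      also have "\<dots> \<le> K * max_norm ?I x powr (- \<delta>)"
        by (intro mult_right_mono) (simp_all add: K_def)
      finally show ?thesis using True by simp
    next
      case False
      have "norm (?h x) \<le> 1 * measure \<mu> M0"
        by (intro norm_set_integral_le M0_fm) auto
      then show ?thesis using False K0(1) by (simp add: K_def)
    qed
  qed
  obtain R0 where R0: "1 \<le> R0" "M0 \<subseteq> kball ?I (\<lambda>i\<in>?I. 0 :: 'a) R0"
    using compactin_bounded[OF finite_lessThan M0(1)] by blast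
  define r where "r = p / (2 * (p - 1))"
  define B where "B = K powr r * (2 * ?q powr (\<delta> * r))"
  have p2: "p \<le> 2"
  proof -
    have "\<delta> / (2 * (real n + 1)) \<le> 1"
      using \<delta> by (simp add: divide_le_eq_1)
    then show ?thesis using p(2) by linarith
  qed
  \<comment> \<open>The exponent of the kernel in Young's inequality exceeds the one for which it is summable.\<close>
  have \<delta>r: "real (card ?I) + 1 \<le> \<delta> * r" if "1 < p"
  proof -
    have "(p - 1) * (2 * (real n + 1)) \<le> \<delta>"
      using p(2) by (simp add: pos_le_divide_eq[symmetric])
    also have "\<dots> \<le> \<delta> * p"
      using \<delta> p(1) by simp
    finally have "(real n + 1) * (2 * (p - 1)) \<le> \<delta> * p"
      by (simp only: mult_ac)
    then have "real n + 1 \<le> \<delta> * p / (2 * (p - 1))"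
      using that by (subst pos_le_divide_eq) simp_all
    then show ?thesis
      by (simp add: r_def)
  qed
  define A2 where "A2 = (if p = 1 then K else 1 + 2 * B)"
  have A2: "0 \<le> A2"
    using K(1) by (simp add: A2_def B_def)
  have "(LINT \<xi>:M0|\<mu>. norm (fourier haar \<psi> n f \<xi>) powr 2) powr (1 / 2) \<le> sqrt A2 * Lp_norm (haar ?I) p f"
    if f: "schwartz_bruhat n f" for f
  proof -
    obtain s0 R where s0: "0 < s0" and R: "1 \<le> R"
      and const: "\<And>x y. x \<in> Kspace ?I \<Longrightarrow> y \<in> kball ?I x s0 \<Longrightarrow> f y = f x"
      and supp: "\<And>x. x \<in> Kspace ?I \<Longrightarrow> f x \<noteq> 0 \<Longrightarrow> x \<in> kball ?I (\<lambda>i\<in>?I. 0 :: 'a) R"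
      using schwartz_bruhat_uniform[OF f] by blast
    let ?B = "kball ?I (\<lambda>i\<in>?I. 0 :: 'a) R"
    \<comment> \<open>So small that \<open>\<psi> (x \<cdot> \<xi>)\<close> is constant in \<open>x\<close> on balls of radius \<open>s\<close>, for \<open>\<xi>\<close> in \<open>M0\<close>.\<close>
    define s where "s = min (min s0 1) (1 / (R0 + 1))"
    have s: "0 < s" "s \<le> s0" "s \<le> 1" "s \<le> R" "R0 * s < 1"
    proof -
      show "0 < s" "s \<le> s0" "s \<le> 1" using s0 R0(1) by (auto simp: s_def)
      then show "s \<le> R" using R by linarith
      have "R0 * s \<le> R0 * (1 / (R0 + 1))"
        using R0(1) by (intro mult_left_mono) (simp_all add: s_def)
      also have "\<dots> < 1"
        using R0(1) by (simp add: divide_simps)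
      finally show "R0 * s < 1" .
    qed
    obtain S where S: "finite S" "S \<subseteq> ?B" "disjoint_family_on (\<lambda>a. kball ?I a s) S"
        "(\<Union>a\<in>S. kball ?I a s) = ?B"
      by (rule kball_partition[where x = "\<lambda>i\<in>?I. 0 :: 'a", OF finite_lessThan s(1,4)])
    have SK: "S \<subseteq> Kspace ?I"
      using S(2) kball_subset_Kspace by blast
    define w where "w = measure (haar ?I) (kball ?I (\<lambda>i\<in>?I. 0 :: 'a) s)"
    have w: "0 \<le> w" by (simp add: w_def)
    have fconst: "f x = f a" if "a \<in> S" "x \<in> kball ?I a s" for a x
      using const[OF subsetD[OF SK that(1)] subsetD[OF kball_mono[OF s(2)] that(2)]] .
    have fsupp: "f x = 0" if "x \<in> Kspace ?I" "x \<notin> ?B" for x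
      using supp that by blast
    have four: "fourier haar \<psi> n f \<xi> = (\<Sum>a\<in>S. \<psi> (\<Sum>i<n. a i * \<xi> i) * (w *\<^sub>R f a))" if "\<xi> \<in> M0" for \<xi>
    proof -
      have \<xi>: "max_norm ?I \<xi> \<le> R0"
        using R0 that by (auto simp: kball_def max_norm_le_iff)
      have "\<psi> (\<Sum>i<n. x i * \<xi> i) = \<psi> (\<Sum>i<n. a i * \<xi> i)" if "x \<in> kball ?I a s" for x a
      proof -
        have "max_norm ?I \<xi> * s \<le> R0 * s"
          using \<xi> s(1) by (intro mult_right_mono) auto
        then have "max_norm ?I \<xi> * s < 1"
          using s(5) by linarith
        then have "\<psi> (\<Sum>i\<in>?I. \<xi> i * x i) = \<psi> (\<Sum>i\<in>?I. \<xi> i * a i)"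
          using that s(1) by (intro psi_dot_cong[of ?I s]) (auto simp: kball_def)
        then show ?thesis
          by (simp add: mult.commute)
      qed
      then have "fourier haar \<psi> n f \<xi> = w *\<^sub>R (\<Sum>a\<in>S. \<psi> (\<Sum>i<n. a i * \<xi> i) * f a)"
        unfolding fourier_def w_def using fconst fsupp
        by (intro integral_step_function[OF S(1) SK S(3,4) s(1)]) auto
      then show ?thesis
        by (simp add: scaleR_sum_right)
    qed
    define T where "T = w * (\<Sum>a\<in>S. norm (f a) powr p)"
    have T: "0 \<le> T"
      using w by (auto simp: T_def intro!: mult_nonneg_nonneg sum_nonneg)
    have "(LINT x|haar ?I. norm (f x) powr p) = w *\<^sub>R (\<Sum>a\<in>S. norm (f a) powr p)"
      unfolding w_def using fconst fsupp
      by (intro integral_step_function[OF S(1) SK S(3,4) s(1)]) auto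
    then have Lp: "Lp_norm (haar ?I) p f = T powr (1 / p)"
      by (simp add: Lp_norm_def T_def)
    define Q where "Q = (LINT \<xi>:M0|\<mu>. norm (fourier haar \<psi> n f \<xi>) powr 2)"
    have Q0: "0 \<le> Q"
      unfolding Q_def set_lebesgue_integral_def by (intro Bochner_Integration.integral_nonneg) simp
    let ?d = "\<lambda>a b i. a i - b i"
    have "Q = (LINT \<xi>:M0|\<mu>. norm (\<Sum>a\<in>S. \<psi> (\<Sum>i<n. a i * \<xi> i) * (w *\<^sub>R f a)) ^ 2)"
      unfolding Q_def using M0_fm four by (intro set_lebesgue_integral_cong) auto
    also have "\<dots> \<le> (\<Sum>a\<in>S. \<Sum>b\<in>S. norm (w *\<^sub>R f a) * norm (w *\<^sub>R f b) * norm (?h (?d a b)))"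
      by (rule restriction_quadratic_form[OF \<psi> M \<mu> M0_fm S(1)])
    also have "\<dots> = w ^ 2 * (\<Sum>a\<in>S. \<Sum>b\<in>S. norm (f a) * norm (f b) * norm (?h (?d a b)))"
      using w by (simp add: sum_distrib_left power2_eq_square mult_ac)
    also have "\<dots> \<le> A2 * T powr (2 / p)"
    proof (cases "p = 1")
      case True
      have hK: "norm (?h x) \<le> K" for x
      proof -
        have "max 1 (max_norm ?I x) powr (- \<delta>) \<le> 1"
          using \<delta>(1) powr_mono[of "- \<delta>" 0 "max 1 (max_norm ?I x)"] by (auto simp: max_def split: if_splits)
        then have "K * max 1 (max_norm ?I x) powr (- \<delta>) \<le> K * 1"
          using K(1) by (rule mult_left_mono)
        then show ?thesis
          using K(2)[of x] by simp
      qed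
      have "w ^ 2 * (\<Sum>a\<in>S. \<Sum>b\<in>S. norm (f a) * norm (f b) * norm (?h (?d a b)))
          \<le> w ^ 2 * (\<Sum>a\<in>S. \<Sum>b\<in>S. norm (f a) * norm (f b) * K)"
        using hK by (intro mult_left_mono sum_mono) auto
      also have "\<dots> = K * (w * (\<Sum>a\<in>S. norm (f a))) * (w * (\<Sum>b\<in>S. norm (f b)))"
        by (simp add: sum_product sum_distrib_left sum_distrib_right power2_eq_square mult_ac)
      also have "\<dots> = A2 * T powr (2 / p)"
        using True T by (simp add: A2_def T_def power2_eq_square)
      finally show ?thesis .
    next
      case False
      then have p1: "1 < p" using p(1) by simp
      have r0: "0 \<le> r" using p1 by (simp add: r_def)
      define g where "g a b = K * max 1 (max_norm ?I (?d a b)) powr (- \<delta>)" for a b :: "nat \<Rightarrow> 'a"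
      have g_nonneg: "0 \<le> g a b" for a b
        using K(1) by (simp add: g_def)
      have g_sym: "g a b = g b a" for a b
      proof -
        have "(\<lambda>i. absval (a i - b i)) ` ?I = (\<lambda>i. absval (b i - a i)) ` ?I"
          by (rule image_cong[OF refl absval_minus_commute])
        then show ?thesis
          by (simp only: g_def max_norm_def)
      qed
      have sum_B: "w * (\<Sum>a\<in>S. g a b powr r) \<le> B" if b: "b \<in> S" for b
      proof -
        have "w * (\<Sum>a\<in>S. g a b powr r)
            = K powr r * (w * (\<Sum>a\<in>S. max 1 (max_norm ?I (?d a b)) powr (- (\<delta> * r))))"
          using K(1) by (simp add: g_def powr_mult powr_powr sum_distrib_left mult_ac)
        also have "\<dots> \<le> K powr r * (2 * ?q powr (\<delta> * r))"
        proof (rule mult_left_mono)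
          have "w = measure (haar ?I) (kball ?I b s)"
            unfolding w_def by (rule measure_kball_cong[OF s(1)])
          then show "w * (\<Sum>a\<in>S. max 1 (max_norm ?I (?d a b)) powr (- (\<delta> * r))) \<le> 2 * ?q powr (\<delta> * r)"
            using discrete_radial_sum_le[OF S(1) SK S(3) s(1,3) \<delta>r[OF p1], of b] b SK by auto
        qed simp
        finally show ?thesis by (simp add: B_def)
      qed
      have "w ^ 2 * (\<Sum>a\<in>S. \<Sum>b\<in>S. norm (f a) * norm (f b) * norm (?h (?d a b)))
          \<le> w ^ 2 * (\<Sum>a\<in>S. \<Sum>b\<in>S. norm (f a) * norm (f b) * g a b)"
        using K(2) unfolding g_def by (intro mult_left_mono sum_mono) auto
      also have "\<dots> \<le> (1 + 2 * B) * (w * (\<Sum>a\<in>S. norm (f a) powr p)) powr (2 / p)"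
      proof (rule discrete_young[OF S(1) w p1 p2])
        show "w * (\<Sum>a\<in>S. g a b powr (p / (2 * (p - 1)))) \<le> B" if "b \<in> S" for b
          using sum_B[OF that] by (simp only: r_def)
        show "w * (\<Sum>b\<in>S. g a b powr (p / (2 * (p - 1)))) \<le> B" if "a \<in> S" for a
          unfolding g_sym[of a] using sum_B[OF that] by (simp only: r_def)
      qed (use g_nonneg in auto)
      also have "\<dots> = A2 * T powr (2 / p)"
        using p1 by (simp add: A2_def T_def)
      finally show ?thesis .
    qed
    finally have "Q \<le> A2 * T powr (2 / p)" .
    also have "\<dots> = (sqrt A2 * T powr (1 / p)) ^ 2"
    proof -
      have "T powr (2 / p) = T powr (1 / p + 1 / p)"
        by simp
      also have "\<dots> = (T powr (1 / p)) ^ 2"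
        by (simp only: powr_add power2_eq_square)
      finally show ?thesis
        using A2 by (simp add: power_mult_distrib)
    qed
    finally have "sqrt Q \<le> sqrt A2 * T powr (1 / p)"
      using A2 by (intro real_le_lsqrt) auto
    then show ?thesis
      using Q0 unfolding Lp Q_def by (simp add: powr_half_sqrt)
  qed
  then show ?thesis
    by blast
qed

theorem theorem4p2:
  fixes haar :: "nat set \<Rightarrow> (nat \<Rightarrow> 'a::nonarch_local_field) measure"
    and \<psi> :: "'a \<Rightarrow> complex"
    and M :: "(nat \<Rightarrow> 'a) set"
    and \<mu>\<^sub>M :: "(nat \<Rightarrow> 'a) measure"
    and n d k :: nat
  assumes haar: "\<And>I. finite I \<Longrightarrow> normalized_haar I (haar I)"
    and \<psi>: "additive_character \<psi>"
      "\<forall>x\<in>maximal_ideal. \<psi> x = 1" "\<exists>x\<in>valuation_ring. \<psi> x \<noteq> 1"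
    and M: "K_analytic_manifold n d M"
    and type: "has_type n d M k"
    and \<mu>\<^sub>M: "induced_measure haar n d M \<mu>\<^sub>M"
    and char: "CHAR('a) = 0 \<or> k < CHAR('a)"
  shows "\<exists>p\<^sub>0>1. \<forall>p. 1 \<le> p \<and> p \<le> p\<^sub>0 \<longrightarrow> Lp_restriction_property haar \<psi> n M \<mu>\<^sub>M p 2"
proof -
  have \<psi>': "unramified_character \<psi>"
    using \<psi> by unfold_locales (auto simp: maximal_ideal_def valuation_ring_def)
  have MK: "M \<subseteq> Kspace {..<n}"
    using M by (simp add: K_analytic_manifold_def)
  have \<mu>: "space \<mu>\<^sub>M = M" "sets \<mu>\<^sub>M = borel_sets (subtopology (Ktop {..<n}) M)"
    using \<mu>\<^sub>M by (simp_all add: induced_measure_def)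
  define \<delta> :: real where "\<delta> = (1 / 3) ^ k / 2"
  have \<delta>: "0 < \<delta>" "\<delta> \<le> 1"
    using power_le_one[of "1 / 3 :: real" k] by (auto simp: \<delta>_def)
  have dec: "decaying \<psi> n \<delta> \<mu>\<^sub>M M\<^sub>0"
    if M0: "compactin (Ktop {..<n}) M\<^sub>0" "openin (subtopology (Ktop {..<n}) M) M\<^sub>0" for M\<^sub>0
  proof (rule decaying_compact_open[OF \<psi>' MK \<mu> M0(1)])
    show M0M: "M\<^sub>0 \<subseteq> M"
      using M0(2) openin_subset by fastforce
    fix x0 assume x0: "x0 \<in> M\<^sub>0"
    obtain \<U> where \<U>: "M = \<Union>\<U>" "\<forall>U\<in>\<U>. \<exists>J f. analytic_chart n d M U J f \<and>
          (\<forall>x\<in>U. \<forall>y\<in>U. max_norm J (\<lambda>i. x i - y i) = max_norm {..<n} (\<lambda>i. x i - y i)) \<and>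
          (\<forall>A\<in>sets \<mu>\<^sub>M. A \<subseteq> U \<longrightarrow> emeasure \<mu>\<^sub>M A = emeasure (haar J) ((\<lambda>x. restrict x J) ` A))"
      using \<mu>\<^sub>M unfolding induced_measure_def by (elim conjE exE)
    obtain U where U: "U \<in> \<U>" "x0 \<in> U"
      using x0 M0M \<U>(1) by blast
    obtain J f where chart: "analytic_chart n d M U J f"
      and iso: "\<forall>x\<in>U. \<forall>y\<in>U. max_norm J (\<lambda>i. x i - y i) = max_norm {..<n} (\<lambda>i. x i - y i)"
      and meas: "\<forall>A\<in>sets \<mu>\<^sub>M. A \<subseteq> U \<longrightarrow> emeasure \<mu>\<^sub>M A = emeasure (haar J) ((\<lambda>x. restrict x J) ` A)"
      using bspec[OF \<U>(2) U(1)] by (elim exE conjE)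
    have J: "finite J"
      using chart finite_subset by (auto simp: analytic_chart_def)
    have type_x0: "type_at_le n d M x0 k"
      using type x0 M0M unfolding has_type_def by blast
    show "\<exists>r>0. M \<inter> kball {..<n} x0 r \<subseteq> M\<^sub>0 \<and> decaying \<psi> n \<delta> \<mu>\<^sub>M (M \<inter> kball {..<n} x0 r)"
      unfolding \<delta>_def
      by (rule decaying_ball_in_manifold[where haar = haar, OF \<psi>' haar[OF J] MK \<mu> chart _ _ U(2) x0 M0(2) type_x0])
        (use iso meas in blast)+
  qed
  show ?thesis
  proof (intro exI[of _ "1 + \<delta> / (2 * (real n + 1))"] conjI allI impI)
    show "1 < 1 + \<delta> / (2 * (real n + 1))"
      using \<delta> by simp
    fix p :: real assume p: "1 \<le> p \<and> p \<le> 1 + \<delta> / (2 * (real n + 1))"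
    show "Lp_restriction_property haar \<psi> n M \<mu>\<^sub>M p 2"
      unfolding Lp_restriction_property_def
    proof (intro allI impI)
      fix M\<^sub>0 assume M0: "compactin (Ktop {..<n}) M\<^sub>0 \<and> openin (subtopology (Ktop {..<n}) M) M\<^sub>0"
      show "\<exists>A. \<forall>f. schwartz_bruhat n f \<longrightarrow>
          (LINT \<xi>:M\<^sub>0|\<mu>\<^sub>M. norm (fourier haar \<psi> n f \<xi>) powr 2) powr (1 / 2) \<le> A * Lp_norm (haar {..<n}) p f"
        using M0 p dec \<delta> by (intro restriction_of_decaying[where haar = haar, OF \<psi>' haar[OF finite_lessThan] MK \<mu>]) auto
    qed
  qed
qed

end
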